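(* Let $n\ge1$, let $\mathcal C$ be an $n$-Frobenius category and $M,N\in\mathcal C$. On the class $\bigcup_{\delta_N\in\mathcal U_n(N)}(\operatorname{Ext}^n(M,\Omega^nN)/\mathcal P,\delta_N)$ of pairs $(\bar\gamma,\delta_N)$, where $\delta_N:\Omega^nN\to P_{n-1}\to\cdots\to P_0\to N$ runs over all unit conflations of length $n$ ending at $N$ and $\bar\gamma\in\operatorname{Ext}^n(M,\Omega^nN)/\mathcal P$ with $\Omega^nN$ the left end term of $\delta_N$, define $(\bar\gamma,\delta_N)\sim(\bar\gamma',\delta'_N)$ if $a\gamma-b\gamma'$ is a $\mathcal P$-conflation, where $[a\delta_N,b\delta'_N]$ is an angled pair. Then $\sim$ is an equivalence relation.
   Context: Let $\mathcal A$ be an abelian category and $\mathcal C$ a full additive extension-closed subcategory with the inherited exact structure: conflations are short exact sequences of $\mathcal A$ with all terms in $\mathcal C$ (first map an inflation, second a deflation). $\operatorname{Ext}^t(A,B)=\operatorname{Ext}^t_{\mathcal C}(A,B)$ ($t\ge1$) is the abelian group (Baer sum) of equivalence classes of exact sequences $B\to X_{t-1}\to\cdots\to X_0\to A$ spliced from $t$ conflations. $g\gamma$, $\gamma h$ denote push-out along $g$ and pull-back along $h$. $P\in\mathcal C$ is $n$-projective (resp. $n$-injective) if $\operatorname{Ext}^i(P,Y)=0$ (resp. $\operatorname{Ext}^i(Y,P)=0$) for all $i>n$, $Y\in\mathcal C$. $\mathcal C$ is $n$-Frobenius if every object has a deflation from an $n$-projective and an inflation into an $n$-injective, and $n$-projectives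 and $n$-injectives coincide. $\mathcal P(X,Y)\subseteq\operatorname{Ext}^n(X,Y)$ is the subgroup of elements $\eta h$ with $h:X\to P$, $P$ $n$-projective, $\eta\in\operatorname{Ext}^n(P,Y)$; its elements are called $\mathcal P$-conflations, and bars denote classes modulo $\mathcal P$. A unit conflation of length $n$ is of the form $\Omega^nN\to P_{n-1}\to\cdots\to P_0\to N$ with all $P_i$ $n$-projective; $\mathcal U_n(N)$ is the class of unit conflations of length $n$ ending at $N$. $\Sigma$ is the class of quasi-invertible morphisms: those $f:A\to B$ such that $\operatorname{Ext}^{n+1}(X,A)\to\operatorname{Ext}^{n+1}(X,B)$, $\gamma\mapsto f\gamma$, is an isomorphism for all $X\in\mathcal C$ (equivalently, the analogous condition with pull-backs). For $\delta,\delta'\in\mathcal U_n(N)$, an angled pair $[a\delta,b\delta']$ consists of inflations $a,b\in\Sigma$ from the left end terms of $\delta,\delta'$ respectively to a common object, such that $a\delta=b\delta'$ in $\operatorname{Ext}^n$ and this is again in $\mathcal U_n(N)$; such pairs always exist for any $\delta,\delta'\in\mathcal U_n(N)$. *)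

theory Defs
  imports "HOL-Algebra.Coset"
begin

section \<open>Abelian categories\<close>

record ('o, 'a) precategory =
  Obj :: "'o set"
  Arr :: "'a set"
  Dom :: "'a \<Rightarrow> 'o"
  Cod :: "'a \<Rightarrow> 'o"
  Ident :: "'o \<Rightarrow> 'a"
  Comp :: "'a \<Rightarrow> 'a \<Rightarrow> 'a" (infixl "\<cdot>\<index>" 70)
  Plus :: "'a \<Rightarrow> 'a \<Rightarrow> 'a" (infixl "\<boxplus>\<index>" 65)
  Zero :: "'o \<Rightarrow> 'o \<Rightarrow> 'a"

definition Hom :: "('o, 'a) precategory \<Rightarrow> 'o \<Rightarrow> 'o \<Rightarrow> 'a set" where
  "Hom \<A> X Y = {f \<in> Arr \<A>. Dom \<A> f = X \<and> Cod \<A> f = Y}"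

definition Hom_group :: "('o, 'a) precategory \<Rightarrow> 'o \<Rightarrow> 'o \<Rightarrow> 'a monoid" where
  "Hom_group \<A> X Y = \<lparr>carrier = Hom \<A> X Y, mult = Plus \<A>, one = Zero \<A> X Y\<rparr>"

definition monic :: "('o, 'a) precategory \<Rightarrow> 'a \<Rightarrow> bool" where
  "monic \<A> m \<longleftrightarrow> m \<in> Arr \<A> \<and>
     (\<forall>W \<in> Obj \<A>. \<forall>u \<in> Hom \<A> W (Dom \<A> m). \<forall>v \<in> Hom \<A> W (Dom \<A> m).
        m \<cdot>\<^bsub>\<A>\<^esub> u = m \<cdot>\<^bsub>\<A>\<^esub> v \<longrightarrow> u = v)"

definition epic :: "('o, 'a) precategory \<Rightarrow> 'a \<Rightarrow> bool" where
  "epic \<A> e \<longleftrightarrow> e \<in> Arr \<A> \<and>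
     (\<forall>W \<in> Obj \<A>. \<forall>u \<in> Hom \<A> (Cod \<A> e) W. \<forall>v \<in> Hom \<A> (Cod \<A> e) W.
        u \<cdot>\<^bsub>\<A>\<^esub> e = v \<cdot>\<^bsub>\<A>\<^esub> e \<longrightarrow> u = v)"

definition is_kernel :: "('o, 'a) precategory \<Rightarrow> 'a \<Rightarrow> 'a \<Rightarrow> bool" where
  "is_kernel \<A> k f \<longleftrightarrow> f \<in> Arr \<A> \<and> k \<in> Arr \<A> \<and> Cod \<A> k = Dom \<A> f \<and>
     f \<cdot>\<^bsub>\<A>\<^esub> k = Zero \<A> (Dom \<A> k) (Cod \<A> f) \<and>
     (\<forall>W \<in> Obj \<A>. \<forall>u \<in> Hom \<A> W (Dom \<A> f). f \<cdot>\<^bsub>\<A>\<^esub> u = Zero \<A> W (Cod \<A> f) \<longrightarrow>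
        (\<exists>!w. w \<in> Hom \<A> W (Dom \<A> k) \<and> k \<cdot>\<^bsub>\<A>\<^esub> w = u))"

definition is_cokernel :: "('o, 'a) precategory \<Rightarrow> 'a \<Rightarrow> 'a \<Rightarrow> bool" where
  "is_cokernel \<A> q f \<longleftrightarrow> f \<in> Arr \<A> \<and> q \<in> Arr \<A> \<and> Dom \<A> q = Cod \<A> f \<and>
     q \<cdot>\<^bsub>\<A>\<^esub> f = Zero \<A> (Dom \<A> f) (Cod \<A> q) \<and>
     (\<forall>W \<in> Obj \<A>. \<forall>u \<in> Hom \<A> (Cod \<A> f) W. u \<cdot>\<^bsub>\<A>\<^esub> f = Zero \<A> (Dom \<A> f) W \<longrightarrow>
        (\<exists>!w. w \<in> Hom \<A> (Cod \<A> q) W \<and> w \<cdot>\<^bsub>\<A>\<^esub> q = u))"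

definition zero_object :: "('o, 'a) precategory \<Rightarrow> 'o \<Rightarrow> bool" where
  "zero_object \<A> Z \<longleftrightarrow> Z \<in> Obj \<A> \<and>
     (\<forall>X \<in> Obj \<A>. (\<exists>!f. f \<in> Hom \<A> X Z) \<and> (\<exists>!f. f \<in> Hom \<A> Z X))"

definition biproduct ::
  "('o, 'a) precategory \<Rightarrow> 'o \<Rightarrow> 'o \<Rightarrow> 'o \<Rightarrow> 'a \<Rightarrow> 'a \<Rightarrow> 'a \<Rightarrow> 'a \<Rightarrow> bool" where
  "biproduct \<A> X Y Z i1 i2 p1 p2 \<longleftrightarrow>
     i1 \<in> Hom \<A> X Z \<and> i2 \<in> Hom \<A> Y Z \<and> p1 \<in> Hom \<A> Z X \<and> p2 \<in> Hom \<A> Z Y \<and>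
     p1 \<cdot>\<^bsub>\<A>\<^esub> i1 = Ident \<A> X \<and> p2 \<cdot>\<^bsub>\<A>\<^esub> i2 = Ident \<A> Y \<and>
     p1 \<cdot>\<^bsub>\<A>\<^esub> i2 = Zero \<A> Y X \<and> p2 \<cdot>\<^bsub>\<A>\<^esub> i1 = Zero \<A> X Y \<and>
     i1 \<cdot>\<^bsub>\<A>\<^esub> p1 \<boxplus>\<^bsub>\<A>\<^esub> i2 \<cdot>\<^bsub>\<A>\<^esub> p2 = Ident \<A> Z"

locale abelian_category =
  fixes \<A> :: "('o, 'a) precategory" (structure)
  assumes Dom_closed: "f \<in> Arr \<A> \<Longrightarrow> Dom \<A> f \<in> Obj \<A>"
    and Cod_closed: "f \<in> Arr \<A> \<Longrightarrow> Cod \<A> f \<in> Obj \<A>"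
    and Ident_closed: "X \<in> Obj \<A> \<Longrightarrow> Ident \<A> X \<in> Hom \<A> X X"
    and Comp_closed: "\<lbrakk>f \<in> Hom \<A> X Y; g \<in> Hom \<A> Y Z\<rbrakk> \<Longrightarrow> g \<cdot> f \<in> Hom \<A> X Z"
    and Comp_assoc: "\<lbrakk>f \<in> Hom \<A> W X; g \<in> Hom \<A> X Y; h \<in> Hom \<A> Y Z\<rbrakk>
          \<Longrightarrow> (h \<cdot> g) \<cdot> f = h \<cdot> (g \<cdot> f)"
    and Ident_left: "f \<in> Hom \<A> X Y \<Longrightarrow> Ident \<A> Y \<cdot> f = f"
    and Ident_right: "f \<in> Hom \<A> X Y \<Longrightarrow> f \<cdot> Ident \<A> X = f"
    and Hom_comm_group: "\<lbrakk>X \<in> Obj \<A>; Y \<in> Obj \<A>\<rbrakk> \<Longrightarrow> comm_group (Hom_group \<A> X Y)"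
    and Comp_Plus_left: "\<lbrakk>f \<in> Hom \<A> X Y; g \<in> Hom \<A> Y Z; h \<in> Hom \<A> Y Z\<rbrakk>
          \<Longrightarrow> (g \<boxplus> h) \<cdot> f = g \<cdot> f \<boxplus> h \<cdot> f"
    and Comp_Plus_right: "\<lbrakk>f \<in> Hom \<A> X Y; g \<in> Hom \<A> X Y; h \<in> Hom \<A> Y Z\<rbrakk>
          \<Longrightarrow> h \<cdot> (f \<boxplus> g) = h \<cdot> f \<boxplus> h \<cdot> g"
    and zero_object_exists: "\<exists>Z. zero_object \<A> Z"
    and biproduct_exists: "\<lbrakk>X \<in> Obj \<A>; Y \<in> Obj \<A>\<rbrakk>
          \<Longrightarrow> \<exists>Z i1 i2 p1 p2. biproduct \<A> X Y Z i1 i2 p1 p2"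
    and kernel_exists: "f \<in> Arr \<A> \<Longrightarrow> \<exists>k. is_kernel \<A> k f"
    and cokernel_exists: "f \<in> Arr \<A> \<Longrightarrow> \<exists>q. is_cokernel \<A> q f"
    and monic_normal: "monic \<A> m \<Longrightarrow> \<exists>f. is_kernel \<A> m f"
    and epic_normal: "epic \<A> e \<Longrightarrow> \<exists>f. is_cokernel \<A> e f"

definition short_exact :: "('o, 'a) precategory \<Rightarrow> 'a \<Rightarrow> 'a \<Rightarrow> bool" where
  "short_exact \<A> i p \<longleftrightarrow> is_kernel \<A> i p \<and> is_cokernel \<A> p i"

text \<open>A full subcategory is given by its set of objects.\<close>

locale extension_closed_subcategory = abelian_category \<A> for \<A> :: "('o, 'a) precategory" +
  fixes \<C> :: "'o set"
  assumes subcategory: "\<C> \<subseteq> Obj \<A>"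
    and zero_object_in: "\<exists>Z \<in> \<C>. zero_object \<A> Z"
    and biproduct_in: "\<lbrakk>X \<in> \<C>; Y \<in> \<C>\<rbrakk>
          \<Longrightarrow> \<exists>Z \<in> \<C>. \<exists>i1 i2 p1 p2. biproduct \<A> X Y Z i1 i2 p1 p2"
    and extension_closed: "\<lbrakk>short_exact \<A> i p; Dom \<A> i \<in> \<C>; Cod \<A> p \<in> \<C>\<rbrakk> \<Longrightarrow> Cod \<A> i \<in> \<C>"

definition conflation :: "('o, 'a) precategory \<Rightarrow> 'o set \<Rightarrow> 'a \<Rightarrow> 'a \<Rightarrow> bool" where
  "conflation \<A> \<C> i p \<longleftrightarrow>
     short_exact \<A> i p \<and> Dom \<A> i \<in> \<C> \<and> Cod \<A> i \<in> \<C> \<and> Cod \<A> p \<in> \<C>"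

definition inflation :: "('o, 'a) precategory \<Rightarrow> 'o set \<Rightarrow> 'a \<Rightarrow> bool" where
  "inflation \<A> \<C> i \<longleftrightarrow> (\<exists>p. conflation \<A> \<C> i p)"

definition deflation :: "('o, 'a) precategory \<Rightarrow> 'o set \<Rightarrow> 'a \<Rightarrow> bool" where
  "deflation \<A> \<C> p \<longleftrightarrow> (\<exists>i. conflation \<A> \<C> i p)"


section \<open>Yoneda Ext groups\<close>

text \<open>
  A sequence \<open>B \<rightarrow> X\<^sub>t\<^sub>-\<^sub>1 \<rightarrow> \<dots> \<rightarrow> X\<^sub>0 \<rightarrow> A\<close> is the list of its \<open>t + 1\<close> arrows, read from left to
  right, so the term at position 0 is \<open>B\<close> and the term at position \<open>t + 1\<close> is \<open>A\<close>.
\<close>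

definition seq_term :: "('o, 'a) precategory \<Rightarrow> 'a list \<Rightarrow> nat \<Rightarrow> 'o" where
  "seq_term \<A> E k = (if k < length E then Dom \<A> (E ! k) else Cod \<A> (last E))"

definition left_end :: "('o, 'a) precategory \<Rightarrow> 'a list \<Rightarrow> 'o" where
  "left_end \<A> E = Dom \<A> (hd E)"

definition spliceable :: "('o, 'a) precategory \<Rightarrow> 'o set \<Rightarrow> ('a \<times> 'a) list \<Rightarrow> bool" where
  "spliceable \<A> \<C> cs \<longleftrightarrow> cs \<noteq> [] \<and> (\<forall>(i, p) \<in> set cs. conflation \<A> \<C> i p) \<and>
     (\<forall>k. Suc k < length cs \<longrightarrow> Cod \<A> (snd (cs ! k)) = Dom \<A> (fst (cs ! Suc k)))"

definition splice_conflations :: "('o, 'a) precategory \<Rightarrow> ('a \<times> 'a) list \<Rightarrow> 'a list" where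
  "splice_conflations \<A> cs =
     fst (hd cs) # map2 (\<lambda>c c'. fst c' \<cdot>\<^bsub>\<A>\<^esub> snd c) cs (tl cs) @ [snd (last cs)]"

definition ext_seqs ::
  "('o, 'a) precategory \<Rightarrow> 'o set \<Rightarrow> nat \<Rightarrow> 'o \<Rightarrow> 'o \<Rightarrow> 'a list set" where
  "ext_seqs \<A> \<C> t A B = {splice_conflations \<A> cs | cs. spliceable \<A> \<C> cs \<and> length cs = t \<and>
     Dom \<A> (fst (hd cs)) = B \<and> Cod \<A> (snd (last cs)) = A}"

definition seq_morphism ::
  "('o, 'a) precategory \<Rightarrow> 'a list \<Rightarrow> 'a list \<Rightarrow> (nat \<Rightarrow> 'a) \<Rightarrow> bool" where
  "seq_morphism \<A> E E' f \<longleftrightarrow> length E = length E' \<and>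
     (\<forall>k \<le> length E. f k \<in> Hom \<A> (seq_term \<A> E k) (seq_term \<A> E' k)) \<and>
     (\<forall>k < length E. (E' ! k) \<cdot>\<^bsub>\<A>\<^esub> f k = f (Suc k) \<cdot>\<^bsub>\<A>\<^esub> (E ! k))"

definition ext_step :: "('o, 'a) precategory \<Rightarrow> 'o set \<Rightarrow> ('a list \<times> 'a list) set" where
  "ext_step \<A> \<C> = {(E, E'). \<exists>t \<ge> 1. \<exists>A B f. E \<in> ext_seqs \<A> \<C> t A B \<and> E' \<in> ext_seqs \<A> \<C> t A B \<and>
     seq_morphism \<A> E E' f \<and> f 0 = Ident \<A> B \<and> f (Suc t) = Ident \<A> A}"

definition ext_class :: "('o, 'a) precategory \<Rightarrow> 'o set \<Rightarrow> 'a list \<Rightarrow> 'a list set" where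
  "ext_class \<A> \<C> E = {E'. (E, E') \<in> (ext_step \<A> \<C> \<union> (ext_step \<A> \<C>)\<inverse>)\<^sup>*}"

definition pushout_square :: "('o, 'a) precategory \<Rightarrow> 'a \<Rightarrow> 'a \<Rightarrow> 'a \<Rightarrow> 'a \<Rightarrow> bool" where
  "pushout_square \<A> i g x i' \<longleftrightarrow>
     i \<in> Arr \<A> \<and> g \<in> Arr \<A> \<and> Dom \<A> g = Dom \<A> i \<and>
     (\<exists>Z. x \<in> Hom \<A> (Cod \<A> i) Z \<and> i' \<in> Hom \<A> (Cod \<A> g) Z \<and> x \<cdot>\<^bsub>\<A>\<^esub> i = i' \<cdot>\<^bsub>\<A>\<^esub> g \<and>
       (\<forall>W \<in> Obj \<A>. \<forall>u \<in> Hom \<A> (Cod \<A> i) W. \<forall>v \<in> Hom \<A> (Cod \<A> g) W.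
          u \<cdot>\<^bsub>\<A>\<^esub> i = v \<cdot>\<^bsub>\<A>\<^esub> g \<longrightarrow>
          (\<exists>!w. w \<in> Hom \<A> Z W \<and> w \<cdot>\<^bsub>\<A>\<^esub> x = u \<and> w \<cdot>\<^bsub>\<A>\<^esub> i' = v)))"

definition pullback_square :: "('o, 'a) precategory \<Rightarrow> 'a \<Rightarrow> 'a \<Rightarrow> 'a \<Rightarrow> 'a \<Rightarrow> bool" where
  "pullback_square \<A> p h y p' \<longleftrightarrow>
     p \<in> Arr \<A> \<and> h \<in> Arr \<A> \<and> Cod \<A> h = Cod \<A> p \<and>
     (\<exists>Z. y \<in> Hom \<A> Z (Dom \<A> p) \<and> p' \<in> Hom \<A> Z (Dom \<A> h) \<and> p \<cdot>\<^bsub>\<A>\<^esub> y = h \<cdot>\<^bsub>\<A>\<^esub> p' \<and>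
       (\<forall>W \<in> Obj \<A>. \<forall>u \<in> Hom \<A> W (Dom \<A> p). \<forall>v \<in> Hom \<A> W (Dom \<A> h).
          p \<cdot>\<^bsub>\<A>\<^esub> u = h \<cdot>\<^bsub>\<A>\<^esub> v \<longrightarrow>
          (\<exists>!w. w \<in> Hom \<A> W Z \<and> y \<cdot>\<^bsub>\<A>\<^esub> w = u \<and> p' \<cdot>\<^bsub>\<A>\<^esub> w = v)))"

text \<open>
  Push-out along \<open>g\<close> changes only the two leftmost arrows \<open>i\<close>, \<open>d\<close>: the term between them is
  replaced by the push-out of \<open>i\<close> and \<open>g\<close>, and \<open>d'\<close> is induced by \<open>d\<close> and \<open>0\<close>. For \<open>t = 1\<close>
  the arrow \<open>d\<close> is the deflation. Pull-back is dual, at the right end.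
\<close>

definition is_pushout_seq :: "('o, 'a) precategory \<Rightarrow> 'a \<Rightarrow> 'a list \<Rightarrow> 'a list \<Rightarrow> bool" where
  "is_pushout_seq \<A> g E E' \<longleftrightarrow> (\<exists>i d ds i' d' x.
     E = i # d # ds \<and> E' = i' # d' # ds \<and> pushout_square \<A> i g x i' \<and>
     d' \<in> Hom \<A> (Cod \<A> i') (Cod \<A> d) \<and> d' \<cdot>\<^bsub>\<A>\<^esub> x = d \<and>
     d' \<cdot>\<^bsub>\<A>\<^esub> i' = Zero \<A> (Dom \<A> i') (Cod \<A> d))"

definition is_pullback_seq :: "('o, 'a) precategory \<Rightarrow> 'a \<Rightarrow> 'a list \<Rightarrow> 'a list \<Rightarrow> bool" where
  "is_pullback_seq \<A> h E E' \<longleftrightarrow> (\<exists>ds d p d' p' y.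
     E = ds @ [d, p] \<and> E' = ds @ [d', p'] \<and> pullback_square \<A> p h y p' \<and>
     d' \<in> Hom \<A> (Dom \<A> d) (Dom \<A> p') \<and> y \<cdot>\<^bsub>\<A>\<^esub> d' = d \<and>
     p' \<cdot>\<^bsub>\<A>\<^esub> d' = Zero \<A> (Dom \<A> d) (Cod \<A> p'))"

text \<open>
  The operations on classes are unions over all choices of representatives, push-outs, pull-backs
  and biproducts; all choices lead to the same class.
\<close>

definition push :: "('o, 'a) precategory \<Rightarrow> 'o set \<Rightarrow> 'a \<Rightarrow> 'a list set \<Rightarrow> 'a list set" where
  "push \<A> \<C> g \<gamma> = (\<Union>E \<in> \<gamma>. \<Union>E' \<in> {E'. is_pushout_seq \<A> g E E'}. ext_class \<A> \<C> E')"

definition pull :: "('o, 'a) precategory \<Rightarrow> 'o set \<Rightarrow> 'a list set \<Rightarrow> 'a \<Rightarrow> 'a list set" where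
  "pull \<A> \<C> \<gamma> h = (\<Union>E \<in> \<gamma>. \<Union>E' \<in> {E'. is_pullback_seq \<A> h E E'}. ext_class \<A> \<C> E')"

definition direct_sum_seq :: "('o, 'a) precategory \<Rightarrow> 'a list \<Rightarrow> 'a list \<Rightarrow> 'a list \<Rightarrow>
    (nat \<Rightarrow> 'a) \<Rightarrow> (nat \<Rightarrow> 'a) \<Rightarrow> (nat \<Rightarrow> 'a) \<Rightarrow> (nat \<Rightarrow> 'a) \<Rightarrow> bool" where
  "direct_sum_seq \<A> E E' S i1 i2 p1 p2 \<longleftrightarrow> length E' = length E \<and> length S = length E \<and>
     (\<forall>k \<le> length E. biproduct \<A> (seq_term \<A> E k) (seq_term \<A> E' k) (seq_term \<A> S k)
        (i1 k) (i2 k) (p1 k) (p2 k)) \<and>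
     (\<forall>k < length E. S ! k =
        i1 (Suc k) \<cdot>\<^bsub>\<A>\<^esub> ((E ! k) \<cdot>\<^bsub>\<A>\<^esub> p1 k) \<boxplus>\<^bsub>\<A>\<^esub> i2 (Suc k) \<cdot>\<^bsub>\<A>\<^esub> ((E' ! k) \<cdot>\<^bsub>\<A>\<^esub> p2 k))"

text \<open>
  The Baer sum \<open>\<nabla>(E \<oplus> E')\<Delta>\<close>: at the left end the codiagonal \<open>B \<oplus> B \<rightarrow> B\<close> is \<open>p1 + p2\<close>, at the
  right end the diagonal \<open>A \<rightarrow> A \<oplus> A\<close> is \<open>i1 + i2\<close>.
\<close>

definition baer_sum ::
  "('o, 'a) precategory \<Rightarrow> 'o set \<Rightarrow> 'a list set \<Rightarrow> 'a list set \<Rightarrow> 'a list set" where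
  "baer_sum \<A> \<C> \<gamma> \<gamma>' = (\<Union>E \<in> \<gamma>. \<Union>E' \<in> \<gamma>'.
     \<Union>{push \<A> \<C> (p1 0 \<boxplus>\<^bsub>\<A>\<^esub> p2 0)
          (pull \<A> \<C> (ext_class \<A> \<C> S) (i1 (length E) \<boxplus>\<^bsub>\<A>\<^esub> i2 (length E))) | S i1 i2 p1 p2.
        direct_sum_seq \<A> E E' S i1 i2 p1 p2})"

text \<open>The neutral element is the class of the sequences spliced from split conflations.\<close>

definition ext_zero ::
  "('o, 'a) precategory \<Rightarrow> 'o set \<Rightarrow> nat \<Rightarrow> 'o \<Rightarrow> 'o \<Rightarrow> 'a list set" where
  "ext_zero \<A> \<C> t A B = \<Union>{ext_class \<A> \<C> (splice_conflations \<A> cs) | cs.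
     spliceable \<A> \<C> cs \<and> length cs = t \<and>
     Dom \<A> (fst (hd cs)) = B \<and> Cod \<A> (snd (last cs)) = A \<and>
     (\<forall>(i, p) \<in> set cs. \<exists>r \<in> Hom \<A> (Cod \<A> i) (Dom \<A> i). r \<cdot>\<^bsub>\<A>\<^esub> i = Ident \<A> (Dom \<A> i))}"

definition Ext ::
  "('o, 'a) precategory \<Rightarrow> 'o set \<Rightarrow> nat \<Rightarrow> 'o \<Rightarrow> 'o \<Rightarrow> 'a list set monoid" where
  "Ext \<A> \<C> t A B = \<lparr>carrier = ext_class \<A> \<C> ` ext_seqs \<A> \<C> t A B,
     mult = baer_sum \<A> \<C>, one = ext_zero \<A> \<C> t A B\<rparr>"


section \<open>n-Frobenius categories\<close>

definition n_projective :: "('o, 'a) precategory \<Rightarrow> 'o set \<Rightarrow> nat \<Rightarrow> 'o \<Rightarrow> bool" where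
  "n_projective \<A> \<C> n P \<longleftrightarrow> P \<in> \<C> \<and>
     (\<forall>i > n. \<forall>Y \<in> \<C>. carrier (Ext \<A> \<C> i P Y) = {\<one>\<^bsub>Ext \<A> \<C> i P Y\<^esub>})"

definition n_injective :: "('o, 'a) precategory \<Rightarrow> 'o set \<Rightarrow> nat \<Rightarrow> 'o \<Rightarrow> bool" where
  "n_injective \<A> \<C> n P \<longleftrightarrow> P \<in> \<C> \<and>
     (\<forall>i > n. \<forall>Y \<in> \<C>. carrier (Ext \<A> \<C> i Y P) = {\<one>\<^bsub>Ext \<A> \<C> i Y P\<^esub>})"

definition n_Frobenius :: "('o, 'a) precategory \<Rightarrow> 'o set \<Rightarrow> nat \<Rightarrow> bool" where
  "n_Frobenius \<A> \<C> n \<longleftrightarrow>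
     (\<forall>X \<in> \<C>. \<exists>p. deflation \<A> \<C> p \<and> Cod \<A> p = X \<and> n_projective \<A> \<C> n (Dom \<A> p)) \<and>
     (\<forall>X \<in> \<C>. \<exists>i. inflation \<A> \<C> i \<and> Dom \<A> i = X \<and> n_injective \<A> \<C> n (Cod \<A> i)) \<and>
     (\<forall>P. n_projective \<A> \<C> n P \<longleftrightarrow> n_injective \<A> \<C> n P)"

definition P_conflations ::
  "('o, 'a) precategory \<Rightarrow> 'o set \<Rightarrow> nat \<Rightarrow> 'o \<Rightarrow> 'o \<Rightarrow> 'a list set set" where
  "P_conflations \<A> \<C> n X Y = {pull \<A> \<C> \<eta> h | \<eta> h P.
     n_projective \<A> \<C> n P \<and> h \<in> Hom \<A> X P \<and> \<eta> \<in> carrier (Ext \<A> \<C> n P Y)}"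

definition unit_conflations ::
  "('o, 'a) precategory \<Rightarrow> 'o set \<Rightarrow> nat \<Rightarrow> 'o \<Rightarrow> 'a list set" where
  "unit_conflations \<A> \<C> n N = {\<delta>. (\<exists>K. \<delta> \<in> ext_seqs \<A> \<C> n N K) \<and>
     (\<forall>k \<in> {1..n}. n_projective \<A> \<C> n (seq_term \<A> \<delta> k))}"

definition quasi_invertible :: "('o, 'a) precategory \<Rightarrow> 'o set \<Rightarrow> nat \<Rightarrow> 'a \<Rightarrow> bool" where
  "quasi_invertible \<A> \<C> n f \<longleftrightarrow> f \<in> Arr \<A> \<and> Dom \<A> f \<in> \<C> \<and> Cod \<A> f \<in> \<C> \<and>
     (\<forall>X \<in> \<C>. push \<A> \<C> f \<in>
        iso (Ext \<A> \<C> (n + 1) X (Dom \<A> f)) (Ext \<A> \<C> (n + 1) X (Cod \<A> f)))"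

text \<open>
  In an angled pair, \<open>a\<delta> = b\<delta>'\<close> is an equality in \<open>Ext\<^sup>n\<close>, whereas belonging again to the unit
  conflations is a condition on the push-out sequences themselves, not only on their class.
\<close>

definition angled_pair ::
  "('o, 'a) precategory \<Rightarrow> 'o set \<Rightarrow> nat \<Rightarrow> 'o \<Rightarrow> 'a \<Rightarrow> 'a list \<Rightarrow> 'a \<Rightarrow> 'a list \<Rightarrow> bool" where
  "angled_pair \<A> \<C> n N a \<delta> b \<delta>' \<longleftrightarrow>
     \<delta> \<in> unit_conflations \<A> \<C> n N \<and> \<delta>' \<in> unit_conflations \<A> \<C> n N \<and>
     inflation \<A> \<C> a \<and> quasi_invertible \<A> \<C> n a \<and> Dom \<A> a = left_end \<A> \<delta> \<and>
     inflation \<A> \<C> b \<and> quasi_invertible \<A> \<C> n b \<and> Dom \<A> b = left_end \<A> \<delta>' \<and>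
     Cod \<A> a = Cod \<A> b \<and>
     push \<A> \<C> a (ext_class \<A> \<C> \<delta>) = push \<A> \<C> b (ext_class \<A> \<C> \<delta>') \<and>
     (\<exists>E \<in> unit_conflations \<A> \<C> n N. is_pushout_seq \<A> a \<delta> E) \<and>
     (\<exists>E' \<in> unit_conflations \<A> \<C> n N. is_pushout_seq \<A> b \<delta>' E')"

definition unit_pairs ::
  "('o, 'a) precategory \<Rightarrow> 'o set \<Rightarrow> nat \<Rightarrow> 'o \<Rightarrow> 'o \<Rightarrow> ('a list set set \<times> 'a list) set" where
  "unit_pairs \<A> \<C> n M N = (\<Union>\<delta> \<in> unit_conflations \<A> \<C> n N.
     carrier (Ext \<A> \<C> n M (left_end \<A> \<delta>) Mod P_conflations \<A> \<C> n M (left_end \<A> \<delta>)) \<times> {\<delta>})"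

text \<open>
  Neither the representatives \<open>\<gamma>\<close>, \<open>\<gamma>'\<close> nor the angled pair are part of the data of a pair of
  elements; the relation asks for some choice of them.
\<close>

definition unit_pair_rel :: "('o, 'a) precategory \<Rightarrow> 'o set \<Rightarrow> nat \<Rightarrow> 'o \<Rightarrow> 'o \<Rightarrow>
    (('a list set set \<times> 'a list) \<times> ('a list set set \<times> 'a list)) set" where
  "unit_pair_rel \<A> \<C> n M N = {((c, \<delta>), (c', \<delta>')).
     (c, \<delta>) \<in> unit_pairs \<A> \<C> n M N \<and> (c', \<delta>') \<in> unit_pairs \<A> \<C> n M N \<and>
     (\<exists>\<gamma> \<in> c. \<exists>\<gamma>' \<in> c'. \<exists>a b. angled_pair \<A> \<C> n N a \<delta> b \<delta>' \<and>
        push \<A> \<C> a \<gamma> \<otimes>\<^bsub>Ext \<A> \<C> n M (Cod \<A> a)\<^esub>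
          inv\<^bsub>Ext \<A> \<C> n M (Cod \<A> a)\<^esub> (push \<A> \<C> b \<gamma>')
        \<in> P_conflations \<A> \<C> n M (Cod \<A> a))}"

end

theory Submission
  imports Defs
begin

text \<open>
  An iterated extension is handled through its conflations, so that \<open>Ext\<^sup>t\<close> becomes the set of lists of
  \<open>t\<close> composable conflations modulo sliding an arrow from one conflation to the next. Any two classes with
  common ends are push-outs \<open>g\<^sub>1T\<close>, \<open>g\<^sub>2T\<close> of one class \<open>T\<close>, and their Baer sum is \<open>(g\<^sub>1 + g\<^sub>2)T\<close>; hence
  \<open>Ext\<^sup>t\<close> is an abelian group, and push-out and pull-back are additive. Exactness of the covariant long
  sequence is proved by induction on \<open>t\<close>.

  Reflexivity and symmetry of the relation are then formal. For transitivity, let \<open>[a\<delta>, b\<delta>']\<close> and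
  \<open>[c\<delta>', d\<delta>'']\<close> be angled pairs, and let \<open>b'\<close>, \<open>c'\<close> be the push-outs of \<open>b\<close> along \<open>c\<close> and of \<open>c\<close> along \<open>b\<close>,
  so that \<open>c'b = b'c\<close>. Since \<open>\<delta>'\<close> and \<open>c\<delta>'\<close> are unit conflations, the cokernel of \<open>c\<close>, which is also that of
  \<open>c'\<close>, is \<open>n\<close>-injective; with the long exact sequence this makes \<open>c'\<close> quasi-invertible, and likewise \<open>b'\<close>.
  Hence \<open>[c'a\<delta>, b'd\<delta>'']\<close> is an angled pair, and the three differences \<open>c'(a\<gamma>\<^sub>1 - b\<gamma>\<^sub>2)\<close>, \<open>c'b(\<gamma>\<^sub>2 - \<gamma>\<^sub>2')\<close>,
  \<open>b'(c\<gamma>\<^sub>2' - d\<gamma>\<^sub>3)\<close> add up to a \<open>\<P>\<close>-conflation.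
\<close>

section \<open>Additive structure and duality\<close>

text \<open>Two obstacles shape the development. A sequence of arrows forgets the objects at which
  its conflations are spliced, and equality of classes is only generated by morphisms with identity
  ends, so it yields a zigzag and not a morphism. Hence a property of classes is first stated for
  chains of conflations and shown to survive one such morphism; \<open>cls_eq_invariant\<close> then
  carries it along the zigzag. The other obstacle is transitivity: two angled pairs need not have
  the same common target, and the relation asks for one angled pair joining the outer unit
  conflations. The targets are merged by a push-out, but its arrows must again be quasi-invertible.
  Surjectivity on \<open>Ext\<close> in degree \<open>n + 1\<close> comes from the vanishing of that
  group at the cokernel; injectivity needs exactness at the group where the connecting map ends.
  This is where the middle terms of unit conflations, \<open>n\<close>-projective by definition, are
  used as \<open>n\<close>-injective objects.\<close>

locale ext_cat = extension_closed_subcategory \<A> \<C>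
  for \<A> :: "('o, 'a) precategory" (structure) and \<C> :: "'o set"
begin

abbreviation "src \<equiv> Dom \<A>"
abbreviation "tgt \<equiv> Cod \<A>"
abbreviation "idn \<equiv> Ident \<A>"
abbreviation "nul \<equiv> Zero \<A>"
abbreviation "spl \<equiv> splice_conflations \<A>"
abbreviation "trm \<equiv> seq_term \<A>"
abbreviation "psh \<equiv> push \<A> \<C>"
abbreviation "pll \<equiv> pull \<A> \<C>"
abbreviation "EXT \<equiv> Ext \<A> \<C>"
abbreviation "PC \<equiv> P_conflations \<A> \<C>"
abbreviation "UC \<equiv> unit_conflations \<A> \<C>"

lemma mem_Hom [simp]: "f \<in> Hom \<A> X Y \<longleftrightarrow> f \<in> Arr \<A> \<and> src f = X \<and> tgt f = Y"
  by (simp add: Hom_def)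

lemma Dom_Obj [simp]: "f \<in> Arr \<A> \<Longrightarrow> src f \<in> Obj \<A>"
  and Cod_Obj [simp]: "f \<in> Arr \<A> \<Longrightarrow> tgt f \<in> Obj \<A>"
  by (simp_all add: Dom_closed Cod_closed)

lemma C_Obj [simp]: "X \<in> \<C> \<Longrightarrow> X \<in> Obj \<A>"
  using subcategory by blast

lemma comp_Hom [simp]:
  assumes "f \<in> Arr \<A>" "g \<in> Arr \<A>" "tgt f = src g"
  shows "g \<cdot> f \<in> Arr \<A>" "src (g \<cdot> f) = src f" "tgt (g \<cdot> f) = tgt g"
  using Comp_closed[of f "src f" "tgt f" g "tgt g"] assms by auto

lemma ident_Hom [simp]:
  assumes "X \<in> Obj \<A>"
  shows "idn X \<in> Arr \<A>" "src (idn X) = X" "tgt (idn X) = X"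
  using Ident_closed[OF assms] by auto

lemma comp_assoc [simp]:
  assumes "f \<in> Arr \<A>" "g \<in> Arr \<A>" "h \<in> Arr \<A>" "tgt f = src g" "tgt g = src h"
  shows "(h \<cdot> g) \<cdot> f = h \<cdot> (g \<cdot> f)"
  using Comp_assoc[of f "src f" "tgt f" g "tgt g" h "tgt h"] assms by auto

lemma ident_comp [simp]: "\<lbrakk>f \<in> Arr \<A>; tgt f = X\<rbrakk> \<Longrightarrow> idn X \<cdot> f = f"
  using Ident_left[of f "src f" X] by auto

lemma comp_ident [simp]: "\<lbrakk>f \<in> Arr \<A>; src f = X\<rbrakk> \<Longrightarrow> f \<cdot> idn X = f"
  using Ident_right[of f X "tgt f"] by auto

text \<open>The simplifier nests composites to the right, so an equation
  \<open>a \<cdot> b = c\<close> no longer matches inside \<open>a \<cdot> (b \<cdot> x)\<close>;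
  this restates it there.\<close>

lemma comp_eq_assoc:
  assumes "a \<cdot> b = c" "x \<in> Arr \<A>" "a \<in> Arr \<A>" "b \<in> Arr \<A>" "tgt x = src b" "tgt b = src a"
  shows "a \<cdot> (b \<cdot> x) = c \<cdot> x"
  using assms comp_assoc by metis

lemma plus_Hom [simp]:
  assumes "f \<in> Arr \<A>" "g \<in> Arr \<A>" "src g = src f" "tgt g = tgt f"
  shows "f \<boxplus> g \<in> Arr \<A>" "src (f \<boxplus> g) = src f" "tgt (f \<boxplus> g) = tgt f"
proof -
  interpret comm_group "Hom_group \<A> (src f) (tgt f)"
    using assms by (intro Hom_comm_group) auto
  show "f \<boxplus> g \<in> Arr \<A>" "src (f \<boxplus> g) = src f" "tgt (f \<boxplus> g) = tgt f"
    using m_closed[of f g] assms by (auto simp: Hom_group_def)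
qed

lemma zero_Hom [simp]:
  assumes "X \<in> Obj \<A>" "Y \<in> Obj \<A>"
  shows "nul X Y \<in> Arr \<A>" "src (nul X Y) = X" "tgt (nul X Y) = Y"
proof -
  interpret comm_group "Hom_group \<A> X Y" using assms by (intro Hom_comm_group) auto
  show "nul X Y \<in> Arr \<A>" "src (nul X Y) = X" "tgt (nul X Y) = Y"
    using one_closed by (auto simp: Hom_group_def)
qed

definition neg :: "'a \<Rightarrow> 'a" where
  "neg f = inv\<^bsub>Hom_group \<A> (src f) (tgt f)\<^esub> f"

lemma neg_Hom [simp]:
  assumes "f \<in> Arr \<A>"
  shows "neg f \<in> Arr \<A>" "src (neg f) = src f" "tgt (neg f) = tgt f"
    "f \<boxplus> neg f = nul (src f) (tgt f)" "neg f \<boxplus> f = nul (src f) (tgt f)"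
proof -
  interpret comm_group "Hom_group \<A> (src f) (tgt f)"
    using assms by (intro Hom_comm_group) auto
  show "neg f \<in> Arr \<A>" "src (neg f) = src f" "tgt (neg f) = tgt f"
    using inv_closed[of f] assms by (auto simp: Hom_group_def neg_def)
  show "f \<boxplus> neg f = nul (src f) (tgt f)" "neg f \<boxplus> f = nul (src f) (tgt f)"
    using r_inv[of f] l_inv[of f] assms by (auto simp: Hom_group_def neg_def)
qed

lemma plus_assoc [simp]:
  assumes "f \<in> Arr \<A>" "g \<in> Arr \<A>" "h \<in> Arr \<A>"
    "src g = src f" "tgt g = tgt f" "src h = src f" "tgt h = tgt f"
  shows "(f \<boxplus> g) \<boxplus> h = f \<boxplus> (g \<boxplus> h)"
proof -
  interpret comm_group "Hom_group \<A> (src f) (tgt f)"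
    using assms by (intro Hom_comm_group) auto
  show ?thesis using m_assoc[of f g h] assms by (simp add: Hom_group_def)
qed

lemma plus_comm:
  assumes "f \<in> Arr \<A>" "g \<in> Arr \<A>" "src g = src f" "tgt g = tgt f"
  shows "f \<boxplus> g = g \<boxplus> f"
proof -
  interpret comm_group "Hom_group \<A> (src f) (tgt f)"
    using assms by (intro Hom_comm_group) auto
  show ?thesis using m_comm[of f g] assms by (simp add: Hom_group_def)
qed

lemma plus_zero [simp]:
  assumes "f \<in> Arr \<A>" "src f = X" "tgt f = Y"
  shows "f \<boxplus> nul X Y = f" "nul X Y \<boxplus> f = f"
proof -
  interpret comm_group "Hom_group \<A> X Y" using assms by (intro Hom_comm_group) auto
  show "f \<boxplus> nul X Y = f" "nul X Y \<boxplus> f = f"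
    using r_one[of f] l_one[of f] assms by (auto simp: Hom_group_def)
qed

lemma plus_cancel:
  assumes "f \<boxplus> g = f \<boxplus> h" "f \<in> Arr \<A>" "g \<in> Arr \<A>" "h \<in> Arr \<A>"
    "src g = src f" "tgt g = tgt f" "src h = src f" "tgt h = tgt f"
  shows "g = h"
proof -
  have "neg f \<boxplus> (f \<boxplus> g) = neg f \<boxplus> (f \<boxplus> h)" using assms by simp
  then have "(neg f \<boxplus> f) \<boxplus> g = (neg f \<boxplus> f) \<boxplus> h" using assms(2-) plus_assoc[of "neg f" f] by simp
  then show ?thesis using assms(2-) by simp
qed

lemma comp_plus [simp]:
  assumes "f \<in> Arr \<A>" "g \<in> Arr \<A>" "h \<in> Arr \<A>" "src g = src f" "tgt g = tgt f" "tgt f = src h"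
  shows "h \<cdot> (f \<boxplus> g) = h \<cdot> f \<boxplus> h \<cdot> g"
  using Comp_Plus_right[of f "src f" "tgt f" g h "tgt h"] assms by simp

lemma plus_comp [simp]:
  assumes "f \<in> Arr \<A>" "g \<in> Arr \<A>" "h \<in> Arr \<A>" "src h = src g" "tgt h = tgt g" "tgt f = src g"
  shows "(g \<boxplus> h) \<cdot> f = g \<cdot> f \<boxplus> h \<cdot> f"
  using Comp_Plus_left[of f "src f" "tgt f" g "tgt g" h] assms by simp

lemma comp_zero [simp]:
  assumes "f \<in> Arr \<A>" "src f = X" "W \<in> Obj \<A>"
  shows "f \<cdot> nul W X = nul W (tgt f)"
proof -
  have X: "X \<in> Obj \<A>" using assms by auto
  have "f \<cdot> nul W X \<boxplus> f \<cdot> nul W X = f \<cdot> (nul W X \<boxplus> nul W X)"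
    using X assms by (intro comp_plus[symmetric]) auto
  also have "\<dots> = f \<cdot> nul W X \<boxplus> nul W (tgt f)"
    using X assms by (simp del: comp_plus)
  finally have "f \<cdot> nul W X \<boxplus> f \<cdot> nul W X = f \<cdot> nul W X \<boxplus> nul W (tgt f)" .
  then show ?thesis by (rule plus_cancel) (use X assms in auto)
qed

lemma zero_comp [simp]:
  assumes "f \<in> Arr \<A>" "tgt f = X" "W \<in> Obj \<A>"
  shows "nul X W \<cdot> f = nul (src f) W"
proof -
  have X: "X \<in> Obj \<A>" using assms by auto
  have "nul X W \<cdot> f \<boxplus> nul X W \<cdot> f = (nul X W \<boxplus> nul X W) \<cdot> f"
    using X assms by (intro plus_comp[symmetric]) auto
  also have "\<dots> = nul X W \<cdot> f \<boxplus> nul (src f) W"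
    using X assms by (simp del: plus_comp)
  finally have "nul X W \<cdot> f \<boxplus> nul X W \<cdot> f = nul X W \<cdot> f \<boxplus> nul (src f) W" .
  then show ?thesis by (rule plus_cancel) (use X assms in auto)
qed

lemma neg_unique:
  assumes "f \<boxplus> g = nul (src f) (tgt f)" "f \<in> Arr \<A>" "g \<in> Arr \<A>"
    "src g = src f" "tgt g = tgt f"
  shows "g = neg f"
  by (rule plus_cancel[of f]) (use assms in auto)

lemma comp_neg [simp]:
  assumes "f \<in> Arr \<A>" "h \<in> Arr \<A>" "tgt f = src h"
  shows "h \<cdot> neg f = neg (h \<cdot> f)"
  by (rule neg_unique) (use assms comp_plus[of f "neg f" h] in simp_all)

lemma neg_comp [simp]:
  assumes "f \<in> Arr \<A>" "h \<in> Arr \<A>" "tgt f = src h"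
  shows "neg h \<cdot> f = neg (h \<cdot> f)"
  by (rule neg_unique) (use assms plus_comp[of f h "neg h"] in simp_all)

lemma eq_of_diff:
  assumes "f \<boxplus> neg g = nul X Y" "f \<in> Arr \<A>" "g \<in> Arr \<A>"
    "src f = X" "tgt f = Y" "src g = X" "tgt g = Y"
  shows "f = g"
  by (rule plus_cancel[of "neg g"]) (use assms plus_comm[of f "neg g"] in auto)

lemma monic_cancel:
  assumes "monic \<A> m" "m \<cdot> u = m \<cdot> v" "u \<in> Arr \<A>" "v \<in> Arr \<A>"
    "tgt u = src m" "tgt v = src m" "src v = src u"
  shows "u = v"
proof -
  have "u \<in> Hom \<A> (src u) (src m)" "v \<in> Hom \<A> (src u) (src m)" "src u \<in> Obj \<A>"
    using assms by auto
  then show ?thesis using assms(1,2) unfolding monic_def by blast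
qed

lemma epic_cancel:
  assumes "epic \<A> e" "u \<cdot> e = v \<cdot> e" "u \<in> Arr \<A>" "v \<in> Arr \<A>"
    "src u = tgt e" "src v = tgt e" "tgt v = tgt u"
  shows "u = v"
proof -
  have "u \<in> Hom \<A> (tgt e) (tgt u)" "v \<in> Hom \<A> (tgt e) (tgt u)" "tgt u \<in> Obj \<A>"
    using assms by auto
  then show ?thesis using assms(1,2) unfolding epic_def by blast
qed

text \<open>By bilinearity two arrows with equal composites differ by one with zero composite, so
  only arrows killed by \<open>m\<close> have to be tested.\<close>

lemma monicI:
  assumes "m \<in> Arr \<A>"
    and "\<And>u. \<lbrakk>u \<in> Arr \<A>; tgt u = src m; m \<cdot> u = nul (src u) (tgt m)\<rbrakk>
           \<Longrightarrow> u = nul (src u) (src m)"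
  shows "monic \<A> m"
  unfolding monic_def
proof (intro conjI ballI impI)
  fix W u v assume W: "W \<in> Obj \<A>" "u \<in> Hom \<A> W (src m)" "v \<in> Hom \<A> W (src m)" "m \<cdot> u = m \<cdot> v"
  then have "m \<cdot> (u \<boxplus> neg v) = nul W (tgt m)" using assms(1) by auto
  then have "u \<boxplus> neg v = nul W (src m)" using assms(2)[of "u \<boxplus> neg v"] W assms(1) by auto
  then show "u = v" using W by (auto intro: eq_of_diff)
qed (fact assms(1))

lemma kernel_facts:
  assumes "is_kernel \<A> k f"
  shows "f \<in> Arr \<A>" "k \<in> Arr \<A>" "tgt k = src f" "f \<cdot> k = nul (src k) (tgt f)"
  using assms by (auto simp: is_kernel_def)

lemma kernel_unique_factor:
  assumes "is_kernel \<A> k f" "u \<in> Arr \<A>" "tgt u = src f" "f \<cdot> u = nul (src u) (tgt f)"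
  shows "\<exists>!w. w \<in> Hom \<A> (src u) (src k) \<and> k \<cdot> w = u"
proof -
  have "src u \<in> Obj \<A>" "u \<in> Hom \<A> (src u) (src f)" using assms by auto
  then show ?thesis using assms(1,4) unfolding is_kernel_def by blast
qed

lemma kernel_factor:
  assumes "is_kernel \<A> k f" "u \<in> Arr \<A>" "tgt u = src f" "f \<cdot> u = nul (src u) (tgt f)"
  obtains w where "w \<in> Arr \<A>" "src w = src u" "tgt w = src k" "k \<cdot> w = u"
  using kernel_unique_factor[OF assms] by auto

lemma kernel_monic:
  assumes "is_kernel \<A> k f"
  shows "monic \<A> k"
proof (rule monicI)
  note k = kernel_facts[OF assms]
  show "k \<in> Arr \<A>" by (fact k)
  fix u assume u: "u \<in> Arr \<A>" "tgt u = src k" "k \<cdot> u = nul (src u) (tgt k)"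
  let ?z = "nul (src u) (src k)"
  have "\<exists>!w. w \<in> Hom \<A> (src (k \<cdot> u)) (src k) \<and> k \<cdot> w = k \<cdot> u"
    by (rule kernel_unique_factor[OF assms]) (use u k in auto)
  moreover have "?z \<in> Hom \<A> (src (k \<cdot> u)) (src k)" "k \<cdot> ?z = k \<cdot> u"
    "u \<in> Hom \<A> (src (k \<cdot> u)) (src k)" using u k by auto
  ultimately show "u = ?z" by blast
qed

lemma is_kernelI:
  assumes "monic \<A> k" "k \<in> Arr \<A>" "f \<in> Arr \<A>" "tgt k = src f" "f \<cdot> k = nul (src k) (tgt f)"
    and "\<And>u. \<lbrakk>u \<in> Arr \<A>; tgt u = src f; f \<cdot> u = nul (src u) (tgt f)\<rbrakk>
      \<Longrightarrow> \<exists>w. w \<in> Arr \<A> \<and> src w = src u \<and> tgt w = src k \<and> k \<cdot> w = u"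
  shows "is_kernel \<A> k f"
  unfolding is_kernel_def
proof (intro conjI ballI impI)
  fix W u assume u: "W \<in> Obj \<A>" "u \<in> Hom \<A> W (src f)" "f \<cdot> u = nul W (tgt f)"
  then obtain w where w: "w \<in> Arr \<A>" "src w = src u" "tgt w = src k" "k \<cdot> w = u"
    using assms(6)[of u] by auto
  show "\<exists>!w. w \<in> Hom \<A> W (src k) \<and> k \<cdot> w = u"
  proof (rule ex1I[of _ w])
    fix v assume "v \<in> Hom \<A> W (src k) \<and> k \<cdot> v = u"
    then show "v = w" using monic_cancel[OF assms(1), of v w] w u by simp
  qed (use w u in auto)
qed (use assms in auto)

end

section \<open>The opposite category and duality\<close>

definition opposite :: "('o, 'a) precategory \<Rightarrow> ('o, 'a) precategory" where
  "opposite \<A> = \<lparr>Obj = Obj \<A>, Arr = Arr \<A>, Dom = Cod \<A>, Cod = Dom \<A>, Ident = Ident \<A>,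
     Comp = (\<lambda>f g. Comp \<A> g f), Plus = Plus \<A>, Zero = (\<lambda>X Y. Zero \<A> Y X)\<rparr>"

lemma opposite_simps [simp]:
  "Obj (opposite \<A>) = Obj \<A>" "Arr (opposite \<A>) = Arr \<A>" "Dom (opposite \<A>) = Cod \<A>"
  "Cod (opposite \<A>) = Dom \<A>" "Ident (opposite \<A>) = Ident \<A>"
  "Comp (opposite \<A>) = (\<lambda>f g. Comp \<A> g f)" "Plus (opposite \<A>) = Plus \<A>"
  "Zero (opposite \<A>) = (\<lambda>X Y. Zero \<A> Y X)"
  by (simp_all add: opposite_def)

lemma Hom_opposite [simp]: "Hom (opposite \<A>) X Y = Hom \<A> Y X"
  by (auto simp: Hom_def)

lemma monic_opposite [simp]: "monic (opposite \<A>) = epic \<A>"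
  by (auto simp: monic_def epic_def fun_eq_iff)

lemma epic_opposite [simp]: "epic (opposite \<A>) = monic \<A>"
  by (auto simp: monic_def epic_def fun_eq_iff)

lemma is_kernel_opposite [simp]: "is_kernel (opposite \<A>) = is_cokernel \<A>"
  by (auto simp: is_kernel_def is_cokernel_def fun_eq_iff)

lemma is_cokernel_opposite [simp]: "is_cokernel (opposite \<A>) = is_kernel \<A>"
  by (auto simp: is_kernel_def is_cokernel_def fun_eq_iff)

lemma short_exact_opposite [simp]: "short_exact (opposite \<A>) p i \<longleftrightarrow> short_exact \<A> i p"
  by (auto simp: short_exact_def)

lemma zero_object_opposite [simp]: "zero_object (opposite \<A>) = zero_object \<A>"
  by (auto simp: zero_object_def fun_eq_iff)

lemma biproduct_opposite [simp]:
  "biproduct (opposite \<A>) X Y Z i1 i2 p1 p2 \<longleftrightarrow> biproduct \<A> X Y Z p1 p2 i1 i2"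
  by (auto simp: biproduct_def)

lemma pushout_square_opposite [simp]:
  "pushout_square (opposite \<A>) = pullback_square \<A>"
  by (simp add: pushout_square_def pullback_square_def fun_eq_iff)

context ext_cat
begin

lemma conflation_opposite [simp]:
  "conflation (opposite \<A>) \<C> p i \<longleftrightarrow> conflation \<A> \<C> i p"
proof -
  have "tgt i = src p" if "short_exact \<A> i p"
    using that by (auto simp: short_exact_def is_kernel_def)
  then show ?thesis by (auto simp: conflation_def)
qed

text \<open>Every axiom is self-dual or paired with its dual. The rules above simplify opposite
  notions to the original ones, so instantiating a lemma here yields its dual.\<close>

lemma ext_cat_opposite: "ext_cat (opposite \<A>) \<C>"
proof (intro ext_cat.intro extension_closed_subcategory.intro abelian_category.intro
    extension_closed_subcategory_axioms.intro)
  fix X Y assume "X \<in> Obj (opposite \<A>)" "Y \<in> Obj (opposite \<A>)"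
  then have "comm_group (Hom_group \<A> Y X)" by (intro Hom_comm_group) auto
  then show "comm_group (Hom_group (opposite \<A>) X Y)" by (simp add: Hom_group_def)
next
  fix X Y assume "X \<in> Obj (opposite \<A>)" "Y \<in> Obj (opposite \<A>)"
  then show "\<exists>Z i1 i2 p1 p2. biproduct (opposite \<A>) X Y Z i1 i2 p1 p2"
    using biproduct_exists[of X Y] by (simp, blast)
next
  fix X Y assume "X \<in> \<C>" "Y \<in> \<C>"
  then show "\<exists>Z\<in>\<C>. \<exists>i1 i2 p1 p2. biproduct (opposite \<A>) X Y Z i1 i2 p1 p2"
    using biproduct_in[of X Y] by (simp, blast)
next
  fix i p assume "short_exact (opposite \<A>) i p" "Dom (opposite \<A>) i \<in> \<C>" "Cod (opposite \<A>) p \<in> \<C>"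
  moreover from this have "tgt p = src i" by (auto simp: short_exact_def is_kernel_def)
  ultimately show "Cod (opposite \<A>) i \<in> \<C>" using extension_closed[of p i] by simp
qed (use zero_object_exists kernel_exists cokernel_exists monic_normal epic_normal subcategory
  zero_object_in in auto)

lemma neg_opposite [simp]: "ext_cat.neg (opposite \<A>) = neg"
proof -
  have "Hom_group (opposite \<A>) (tgt f) (src f) = Hom_group \<A> (src f) (tgt f)" for f
    by (simp add: Hom_group_def)
  then show ?thesis
    by (simp add: fun_eq_iff ext_cat.neg_def[OF ext_cat_opposite] neg_def)
qed

lemmas epicI = ext_cat.monicI[OF ext_cat_opposite, simplified]
lemmas cokernel_facts = ext_cat.kernel_facts[OF ext_cat_opposite, simplified]
lemmas cokernel_factor = ext_cat.kernel_factor[OF ext_cat_opposite, simplified]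
lemmas cokernel_epic = ext_cat.kernel_monic[OF ext_cat_opposite, simplified]
lemmas is_cokernelI = ext_cat.is_kernelI[OF ext_cat_opposite, simplified]

text \<open>By normality \<open>m\<close> is a kernel of some \<open>f\<close>, and \<open>f\<close>
  factors through the cokernel \<open>q\<close>; so an arrow killed by \<open>q\<close> is killed by
  \<open>f\<close> and factors through \<open>m\<close>.\<close>

lemma monic_short_exact:
  assumes m: "monic \<A> m" and q: "is_cokernel \<A> q m"
  shows "short_exact \<A> m q"
proof -
  note qf = cokernel_facts[OF q]
  obtain f where f: "is_kernel \<A> m f" using monic_normal m by blast
  note ff = kernel_facts[OF f]
  obtain f' where f': "f' \<in> Arr \<A>" "tgt f' = tgt f" "src f' = tgt q" "f' \<cdot> q = f"
    by (rule cokernel_factor[OF q, of f]) (use ff qf in auto)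
  have "is_kernel \<A> m q"
  proof (rule is_kernelI[OF m])
    fix u assume u: "u \<in> Arr \<A>" "tgt u = src q" "q \<cdot> u = nul (src u) (tgt q)"
    have "f \<cdot> u = f' \<cdot> (q \<cdot> u)"
      by (rule comp_eq_assoc[OF f'(4), symmetric]) (use u f' qf in auto)
    also have "\<dots> = nul (src u) (tgt f)" unfolding u(3) using u f' qf by simp
    finally have "f \<cdot> u = nul (src u) (tgt f)" .
    then show "\<exists>w. w \<in> Arr \<A> \<and> src w = src u \<and> tgt w = src m \<and> m \<cdot> w = u"
      using kernel_factor[OF f, of u] u ff qf by metis
  qed (use qf in auto)
  then show ?thesis using q by (simp add: short_exact_def)
qed

lemmas epic_short_exact = ext_cat.monic_short_exact[OF ext_cat_opposite, simplified]

text \<open>\<open>m\<close> is the kernel of some \<open>f\<close>; since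
  \<open>f \<cdot> m\<close> vanishes and \<open>m\<close> is epic, \<open>f\<close> is zero, so the
  identity of the target factors through \<open>m\<close>.\<close>

lemma monic_epic_iso:
  assumes m: "monic \<A> m" and e: "epic \<A> m"
  obtains w where "w \<in> Arr \<A>" "src w = tgt m" "tgt w = src m"
    "m \<cdot> w = idn (tgt m)" "w \<cdot> m = idn (src m)"
proof -
  obtain f where f: "is_kernel \<A> m f" using monic_normal m by blast
  note ff = kernel_facts[OF f]
  have "f = nul (tgt m) (tgt f)"
    by (rule epic_cancel[OF e]) (use ff in auto)
  moreover have "nul (tgt m) (tgt f) \<cdot> idn (tgt m) = nul (tgt m) (tgt f)"
    using ff by simp
  ultimately have "f \<cdot> idn (tgt m) = nul (tgt m) (tgt f)" by metis
  then obtain w where w: "w \<in> Arr \<A>" "src w = tgt m" "tgt w = src m" "m \<cdot> w = idn (tgt m)"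
    using kernel_factor[OF f, of "idn (tgt m)"] ff by (metis Cod_Obj ident_Hom)
  have "w \<cdot> m = idn (src m)"
  proof (rule monic_cancel[OF m])
    have "m \<cdot> (w \<cdot> m) = (m \<cdot> w) \<cdot> m" using w(1-3) ff by simp
    then show "m \<cdot> (w \<cdot> m) = m \<cdot> idn (src m)" unfolding w(4) using ff by simp
  qed (use w ff in auto)
  then show thesis using that w by blast
qed

section \<open>Conflations and their morphisms\<close>

definition conf :: "'o \<Rightarrow> 'o \<Rightarrow> 'a \<times> 'a \<Rightarrow> bool" where
  "conf B A e \<longleftrightarrow> conflation \<A> \<C> (fst e) (snd e) \<and> src (fst e) = B \<and> tgt (snd e) = A"

lemma conf_facts:
  assumes "conf B A (i, p)"
  shows "i \<in> Arr \<A>" "p \<in> Arr \<A>" "src i = B" "tgt p = A" "src p = tgt i"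
    "p \<cdot> i = nul B A" "B \<in> \<C>" "A \<in> \<C>" "tgt i \<in> \<C>"
    "monic \<A> i" "epic \<A> p" "is_kernel \<A> i p" "is_cokernel \<A> p i"
  using assms kernel_facts[of i p] kernel_monic[of i p] cokernel_epic[of p i]
  by (auto simp: conf_def conflation_def short_exact_def)

lemma conf_opposite [simp]: "ext_cat.conf (opposite \<A>) \<C> A B (p, i) \<longleftrightarrow> conf B A (i, p)"
  by (auto simp: conf_def ext_cat.conf_def[OF ext_cat_opposite])

lemma confI:
  assumes "monic \<A> i" "is_cokernel \<A> p i" "src i = B" "tgt p = A" "B \<in> \<C>" "A \<in> \<C>"
  shows "conf B A (i, p)"
  using monic_short_exact[OF assms(1,2)] extension_closed[of i p] assms
  by (auto simp: conf_def conflation_def)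

lemma conf_of_conflation:
  assumes "conflation \<A> \<C> i p" shows "conf (src i) (tgt p) (i, p)"
  using assms by (simp add: conf_def)

text \<open>The middle arrow stays hidden: the end components do not determine it, and only its
  existence is used later.\<close>

definition cmor :: "'a \<times> 'a \<Rightarrow> 'a \<times> 'a \<Rightarrow> 'a \<Rightarrow> 'a \<Rightarrow> bool" where
  "cmor e e' g h \<longleftrightarrow> g \<in> Hom \<A> (src (fst e)) (src (fst e')) \<and>
     h \<in> Hom \<A> (tgt (snd e)) (tgt (snd e')) \<and>
     (\<exists>f \<in> Hom \<A> (tgt (fst e)) (tgt (fst e')). f \<cdot> fst e = fst e' \<cdot> g \<and> snd e' \<cdot> f = h \<cdot> snd e)"

lemma cmor_typ:
  assumes "conf B A e" "conf B' A' e'" "cmor e e' g h"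
  shows "g \<in> Arr \<A>" "src g = B" "tgt g = B'" "h \<in> Arr \<A>" "src h = A" "tgt h = A'"
  using assms by (auto simp: conf_def cmor_def)

lemma cmorE:
  assumes "cmor (i, p) (j, q) g h" "conf B A (i, p)" "conf B' A' (j, q)"
  obtains f where "f \<in> Arr \<A>" "src f = tgt i" "tgt f = tgt j" "f \<cdot> i = j \<cdot> g" "q \<cdot> f = h \<cdot> p"
    "g \<in> Arr \<A>" "src g = B" "tgt g = B'" "h \<in> Arr \<A>" "src h = A" "tgt h = A'"
  using assms cmor_typ[OF assms(2,3,1)] by (auto simp: cmor_def)

lemma cmorI:
  assumes "f \<cdot> i = j \<cdot> g" "q \<cdot> f = h \<cdot> p" "f \<in> Arr \<A>" "src f = tgt i" "tgt f = tgt j"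
    "g \<in> Arr \<A>" "src g = src i" "tgt g = src j" "h \<in> Arr \<A>" "src h = tgt p" "tgt h = tgt q"
  shows "cmor (i, p) (j, q) g h"
  using assms by (auto simp: cmor_def)

lemma cmor_opposite [simp]:
  assumes "conf B A (i, p)" "conf B' A' (j, q)"
  shows "ext_cat.cmor (opposite \<A>) (q, j) (p, i) h g \<longleftrightarrow> cmor (i, p) (j, q) g h"
  using conf_facts[OF assms(1)] conf_facts[OF assms(2)]
  by (auto simp: cmor_def ext_cat.cmor_def[OF ext_cat_opposite])

lemma cmor_id: "conf B A e \<Longrightarrow> cmor e e (idn B) (idn A)"
  using conf_facts[of B A "fst e" "snd e"]
  by (cases e, intro cmorI[where f = "idn (tgt (fst e))", of "fst e" "fst e" _ "snd e" _ "snd e", simplified]) auto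

lemma cmor_comp:
  assumes e: "conf B A e" "conf B' A' e'" "conf B'' A'' e''"
    and m: "cmor e e' g h" "cmor e' e'' g' h'"
  shows "cmor e e'' (g' \<cdot> g) (h' \<cdot> h)"
proof -
  obtain i p i' p' i'' p'' where [simp]: "e = (i, p)" "e' = (i', p')" "e'' = (i'', p'')"
    by (cases e, cases e', cases e'')
  obtain f where f: "f \<in> Arr \<A>" "src f = tgt i" "tgt f = tgt i'" "f \<cdot> i = i' \<cdot> g" "p' \<cdot> f = h \<cdot> p"
    "g \<in> Arr \<A>" "src g = B" "tgt g = B'" "h \<in> Arr \<A>" "src h = A" "tgt h = A'"
    using m(1) e by (auto elim!: cmorE)
  obtain f' where f': "f' \<in> Arr \<A>" "src f' = tgt i'" "tgt f' = tgt i''" "f' \<cdot> i' = i'' \<cdot> g'" "p'' \<cdot> f' = h' \<cdot> p'"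
    "g' \<in> Arr \<A>" "src g' = B'" "tgt g' = B''" "h' \<in> Arr \<A>" "src h' = A'" "tgt h' = A''"
    using m(2) e by (auto elim!: cmorE)
  note c = conf_facts[OF e(1)[simplified]] conf_facts[OF e(2)[simplified]] conf_facts[OF e(3)[simplified]]
  have "(f' \<cdot> f) \<cdot> i = i'' \<cdot> (g' \<cdot> g)"
    using comp_eq_assoc[OF f'(4), of g] f f' c by simp
  moreover have "p'' \<cdot> (f' \<cdot> f) = (h' \<cdot> h) \<cdot> p"
    using comp_eq_assoc[OF f'(5), of f] f f' c by simp
  ultimately show ?thesis
    by (auto intro!: cmorI[where f = "f' \<cdot> f"] simp: f f' c)
qed

lemma cmor_add:
  assumes e: "conf B A e" "conf B' A' e'"
    and m: "cmor e e' g h" "cmor e e' g' h'"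
  shows "cmor e e' (g \<boxplus> g') (h \<boxplus> h')"
proof -
  obtain i p i' p' where [simp]: "e = (i, p)" "e' = (i', p')"
    by (cases e, cases e')
  obtain f where f: "f \<in> Arr \<A>" "src f = tgt i" "tgt f = tgt i'" "f \<cdot> i = i' \<cdot> g" "p' \<cdot> f = h \<cdot> p"
    "g \<in> Arr \<A>" "src g = B" "tgt g = B'" "h \<in> Arr \<A>" "src h = A" "tgt h = A'"
    using m(1) e by (auto elim!: cmorE)
  obtain f' where f': "f' \<in> Arr \<A>" "src f' = tgt i" "tgt f' = tgt i'" "f' \<cdot> i = i' \<cdot> g'" "p' \<cdot> f' = h' \<cdot> p"
    "g' \<in> Arr \<A>" "src g' = B" "tgt g' = B'" "h' \<in> Arr \<A>" "src h' = A" "tgt h' = A'"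
    using m(2) e by (auto elim!: cmorE)
  note c = conf_facts[OF e(1)[simplified]] conf_facts[OF e(2)[simplified]]
  show ?thesis
    by (auto intro!: cmorI[where f = "f \<boxplus> f'"] simp: f f' c)
qed

section \<open>Push-out squares and biproducts\<close>

lemma pushout_square_facts:
  assumes "pushout_square \<A> i g x i'"
  shows "i \<in> Arr \<A>" "g \<in> Arr \<A>" "src g = src i" "x \<in> Arr \<A>" "src x = tgt i"
    "i' \<in> Arr \<A>" "src i' = tgt g" "tgt x = tgt i'" "x \<cdot> i = i' \<cdot> g"
  using assms by (auto simp: pushout_square_def)

lemma pushout_square_ex1:
  assumes "pushout_square \<A> i g x i'" "u \<in> Arr \<A>" "v \<in> Arr \<A>" "src u = tgt i" "src v = tgt g"
    "tgt u = tgt v" "u \<cdot> i = v \<cdot> g"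
  shows "\<exists>!w. w \<in> Hom \<A> (tgt i') (tgt v) \<and> w \<cdot> x = u \<and> w \<cdot> i' = v"
proof -
  obtain Z where Z: "x \<in> Hom \<A> (tgt i) Z" "i' \<in> Hom \<A> (tgt g) Z"
     "\<forall>W \<in> Obj \<A>. \<forall>u \<in> Hom \<A> (tgt i) W. \<forall>v \<in> Hom \<A> (tgt g) W.
          u \<cdot> i = v \<cdot> g \<longrightarrow> (\<exists>!w. w \<in> Hom \<A> Z W \<and> w \<cdot> x = u \<and> w \<cdot> i' = v)"
    using assms(1) unfolding pushout_square_def by blast
  have "u \<in> Hom \<A> (tgt i) (tgt v)" "v \<in> Hom \<A> (tgt g) (tgt v)" "tgt v \<in> Obj \<A>" "tgt i' = Z"
    using assms Z by auto
  then show ?thesis using Z(3) assms(7) by blast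
qed

lemma pushout_square_factor:
  assumes "pushout_square \<A> i g x i'" "u \<in> Arr \<A>" "v \<in> Arr \<A>" "src u = tgt i" "src v = tgt g"
    "tgt u = tgt v" "u \<cdot> i = v \<cdot> g"
  obtains w where "w \<in> Arr \<A>" "src w = tgt i'" "tgt w = tgt v" "w \<cdot> x = u" "w \<cdot> i' = v"
  using pushout_square_ex1[OF assms] by auto

lemma pushout_square_eq:
  assumes "pushout_square \<A> i g x i'" "u \<in> Arr \<A>" "v \<in> Arr \<A>" "src u = tgt i'" "src v = tgt i'"
    "tgt u = tgt v" "u \<cdot> x = v \<cdot> x" "u \<cdot> i' = v \<cdot> i'"
  shows "u = v"
proof -
  note p = pushout_square_facts[OF assms(1)]
  have "\<exists>!w. w \<in> Hom \<A> (tgt i') (tgt (v \<cdot> i')) \<and> w \<cdot> x = u \<cdot> x \<and> w \<cdot> i' = v \<cdot> i'"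
  proof (rule pushout_square_ex1[OF assms(1)])
    have "u \<cdot> (x \<cdot> i) = u \<cdot> (i' \<cdot> g)" using p by simp
    also have "\<dots> = (u \<cdot> i') \<cdot> g" using p assms(2-6) by simp
    also have "\<dots> = (v \<cdot> i') \<cdot> g" by (simp only: assms)
    finally show "(u \<cdot> x) \<cdot> i = (v \<cdot> i') \<cdot> g" using p assms(2-6) by simp
  qed (use p assms in auto)
  moreover have "u \<in> Hom \<A> (tgt i') (tgt (v \<cdot> i'))" "v \<in> Hom \<A> (tgt i') (tgt (v \<cdot> i'))"
    using p assms by auto
  ultimately show ?thesis using assms(7,8) by metis
qed

lemma biproduct_facts:
  assumes "biproduct \<A> X Y Z i1 i2 p1 p2"
  shows "i1 \<in> Arr \<A>" "i2 \<in> Arr \<A>" "p1 \<in> Arr \<A>" "p2 \<in> Arr \<A>"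
    "src i1 = X" "tgt i1 = Z" "src i2 = Y" "tgt i2 = Z"
    "src p1 = Z" "tgt p1 = X" "src p2 = Z" "tgt p2 = Y"
    "p1 \<cdot> i1 = idn X" "p2 \<cdot> i2 = idn Y" "p1 \<cdot> i2 = nul Y X" "p2 \<cdot> i1 = nul X Y"
    "i1 \<cdot> p1 \<boxplus> i2 \<cdot> p2 = idn Z" "X \<in> Obj \<A>" "Y \<in> Obj \<A>" "Z \<in> Obj \<A>"
  using assms Dom_Obj[of i1] Dom_Obj[of i2] Dom_Obj[of p1] by (auto simp: biproduct_def)

lemma biproduct_comp:
  assumes b: "biproduct \<A> X Y Z i1 i2 p1 p2" and u: "u \<in> Arr \<A>"
  shows "tgt u = X \<Longrightarrow> p1 \<cdot> (i1 \<cdot> u) = u" "tgt u = Y \<Longrightarrow> p2 \<cdot> (i2 \<cdot> u) = u"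
    "tgt u = Y \<Longrightarrow> p1 \<cdot> (i2 \<cdot> u) = nul (src u) X" "tgt u = X \<Longrightarrow> p2 \<cdot> (i1 \<cdot> u) = nul (src u) Y"
  using biproduct_facts[OF b] u
    comp_eq_assoc[of p1 i1 _ u] comp_eq_assoc[of p2 i2 _ u] comp_eq_assoc[of p1 i2 _ u] comp_eq_assoc[of p2 i1 _ u]
  by simp_all

lemma biproduct_into_eq:
  assumes b: "biproduct \<A> X Y Z i1 i2 p1 p2"
    and u: "u \<in> Arr \<A>" "v \<in> Arr \<A>" "tgt u = Z" "tgt v = Z" "src u = src v"
    and e: "p1 \<cdot> u = p1 \<cdot> v" "p2 \<cdot> u = p2 \<cdot> v"
  shows "u = v"
proof -
  note bf = biproduct_facts[OF b]
  have "u = (i1 \<cdot> p1 \<boxplus> i2 \<cdot> p2) \<cdot> u" using bf u by (simp del: plus_comp)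
  also have "\<dots> = i1 \<cdot> (p1 \<cdot> u) \<boxplus> i2 \<cdot> (p2 \<cdot> u)" using bf(1-12) u by simp
  also have "\<dots> = i1 \<cdot> (p1 \<cdot> v) \<boxplus> i2 \<cdot> (p2 \<cdot> v)" by (simp only: e)
  also have "\<dots> = (i1 \<cdot> p1 \<boxplus> i2 \<cdot> p2) \<cdot> v" using bf(1-12) u by simp
  also have "\<dots> = v" using bf u by (simp del: plus_comp)
  finally show ?thesis .
qed

lemma biproduct_out_eq:
  assumes b: "biproduct \<A> X Y Z i1 i2 p1 p2"
    and u: "u \<in> Arr \<A>" "v \<in> Arr \<A>" "src u = Z" "src v = Z" "tgt u = tgt v"
    and e: "u \<cdot> i1 = v \<cdot> i1" "u \<cdot> i2 = v \<cdot> i2"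
  shows "u = v"
  by (rule ext_cat.biproduct_into_eq[OF ext_cat_opposite, of X Y Z p1 p2 i1 i2]) (use assms in auto)

text \<open>Arrows out of a biproduct are pairs, and such a pair kills \<open>(i, -g)\<close>
  exactly when it is a competitor for the push-out of \<open>i\<close> and \<open>g\<close>.\<close>

lemma pushout_square_of_cokernel:
  assumes b: "biproduct \<A> X Y Z j1 j2 q1 q2" and i: "i \<in> Arr \<A>" "g \<in> Arr \<A>" "src g = src i"
    "tgt i = X" "tgt g = Y" and c: "is_cokernel \<A> c (j1 \<cdot> i \<boxplus> neg (j2 \<cdot> g))"
  shows "pushout_square \<A> i g (c \<cdot> j1) (c \<cdot> j2)"
proof -
  note bf = biproduct_facts[OF b]
  let ?m = "j1 \<cdot> i \<boxplus> neg (j2 \<cdot> g)"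
  have m: "?m \<in> Arr \<A>" "src ?m = src i" "tgt ?m = Z" using bf(1-12) i by auto
  note cf = cokernel_facts[OF c]
  have "c \<cdot> ?m = (c \<cdot> j1) \<cdot> i \<boxplus> neg ((c \<cdot> j2) \<cdot> g)" using bf(1-12) cf(1-3) m i by simp
  then have "(c \<cdot> j1) \<cdot> i \<boxplus> neg ((c \<cdot> j2) \<cdot> g) = nul (src i) (tgt c)" using cf(4) m by simp
  then have sq: "(c \<cdot> j1) \<cdot> i = (c \<cdot> j2) \<cdot> g"
    by (rule eq_of_diff) (simp_all add: bf(1-12) cf(1-3) m i)
  show ?thesis unfolding pushout_square_def
  proof (intro conjI exI[of _ "tgt c"] ballI impI)
    fix W u v assume u: "W \<in> Obj \<A>" "u \<in> Hom \<A> (tgt i) W" "v \<in> Hom \<A> (tgt g) W" "u \<cdot> i = v \<cdot> g"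
    let ?u = "u \<cdot> q1 \<boxplus> v \<cdot> q2"
    have u1: "?u \<cdot> j1 = u" "?u \<cdot> j2 = v" using u bf i by simp_all
    have "?u \<cdot> ?m = (?u \<cdot> j1) \<cdot> i \<boxplus> neg ((?u \<cdot> j2) \<cdot> g)" using u(1-3) bf(1-12) i by (simp del: plus_comp)
    also have "\<dots> = nul (src i) W" unfolding u1 using u i by simp
    finally obtain w where w: "w \<in> Arr \<A>" "tgt w = W" "src w = tgt c" "w \<cdot> c = ?u"
      using u bf(1-12) m i cokernel_factor[OF c, of ?u] by auto
    show "\<exists>!w. w \<in> Hom \<A> (tgt c) W \<and> w \<cdot> (c \<cdot> j1) = u \<and> w \<cdot> (c \<cdot> j2) = v"
    proof (rule ex1I[of _ w])
      show "w \<in> Hom \<A> (tgt c) W \<and> w \<cdot> (c \<cdot> j1) = u \<and> w \<cdot> (c \<cdot> j2) = v"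
        using comp_eq_assoc[OF w(4), of j1] comp_eq_assoc[OF w(4), of j2] w(1-3) u1 bf(1-12) cf(1-3) m by simp
    next
      fix w' assume w': "w' \<in> Hom \<A> (tgt c) W \<and> w' \<cdot> (c \<cdot> j1) = u \<and> w' \<cdot> (c \<cdot> j2) = v"
      show "w' = w"
      proof (rule epic_cancel[OF cokernel_epic[OF c]])
        show "w' \<cdot> c = w \<cdot> c"
          by (rule biproduct_out_eq[OF b])
            (use w w' u1 bf(1-12) cf(1-3) m comp_eq_assoc[OF w(4), of j1] comp_eq_assoc[OF w(4), of j2] in auto)
      qed (use w w' cf m in auto)
    qed
  qed (use sq bf(1-12) cf(1-3) m i in auto)
qed

text \<open>Allows kernel and cokernel arguments for an arbitrary given push-out, not only for one
  constructed as a cokernel; the definition of \<open>push\<close> ranges over all of them.\<close>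

lemma cokernel_of_pushout_square:
  assumes b: "biproduct \<A> X Y Z j1 j2 q1 q2" and P: "pushout_square \<A> i g x i'" and XY: "tgt i = X" "tgt g = Y"
  shows "is_cokernel \<A> (x \<cdot> q1 \<boxplus> i' \<cdot> q2) (j1 \<cdot> i \<boxplus> neg (j2 \<cdot> g))"
proof (rule is_cokernelI)
  note bf = biproduct_facts[OF b] note pf = pushout_square_facts[OF P]
  let ?m = "j1 \<cdot> i \<boxplus> neg (j2 \<cdot> g)" let ?c = "x \<cdot> q1 \<boxplus> i' \<cdot> q2"
  show m: "?m \<in> Arr \<A>" and c: "?c \<in> Arr \<A>" and d: "src ?c = tgt ?m" using bf(1-12) XY pf by auto
  have c1: "?c \<cdot> j1 = x" "?c \<cdot> j2 = i'" using bf XY pf by simp_all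
  have "?c \<cdot> ?m = (?c \<cdot> j1) \<cdot> i \<boxplus> neg ((?c \<cdot> j2) \<cdot> g)" using bf(1-12) XY pf by (simp del: plus_comp)
  also have "\<dots> = nul (src ?m) (tgt ?c)" unfolding c1 using bf(1-12) XY pf by simp
  finally show "?c \<cdot> ?m = nul (src ?m) (tgt ?c)" .
  show "epic \<A> ?c"
  proof (rule epicI)
    fix u assume u: "u \<in> Arr \<A>" "src u = tgt ?c" "u \<cdot> ?c = nul (src ?c) (tgt u)"
    have "u \<cdot> x = (u \<cdot> ?c) \<cdot> j1" "u \<cdot> i' = (u \<cdot> ?c) \<cdot> j2"
      using c1 u(1,2) bf(1-12) XY pf by (simp_all del: plus_comp comp_plus)
    then have ux: "u \<cdot> x = nul (tgt i) (tgt u)" "u \<cdot> i' = nul (tgt g) (tgt u)"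
      unfolding u(3) by (simp_all add: u(1,2) bf(1-12) XY pf(1-8))
    show "u = nul (tgt ?c) (tgt u)"
      by (rule pushout_square_eq[OF P]) (simp_all add: ux u(1,2) bf(1-12) XY pf(1-8))
  qed (fact c)
  fix u assume u: "u \<in> Arr \<A>" "src u = tgt ?m" "u \<cdot> ?m = nul (src ?m) (tgt u)"
  have "u \<cdot> ?m = (u \<cdot> j1) \<cdot> i \<boxplus> neg ((u \<cdot> j2) \<cdot> g)" using bf(1-12) u(1,2) XY pf by simp
  then have "(u \<cdot> j1) \<cdot> i \<boxplus> neg ((u \<cdot> j2) \<cdot> g) = nul (src i) (tgt u)"
    using u(3) by (simp add: bf(1-12) XY pf)
  then have ueq: "(u \<cdot> j1) \<cdot> i = (u \<cdot> j2) \<cdot> g"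
    by (rule eq_of_diff) (simp_all add: bf(1-12) XY pf u)
  obtain w where w: "w \<in> Arr \<A>" "src w = tgt i'" "tgt w = tgt u" "w \<cdot> x = u \<cdot> j1" "w \<cdot> i' = u \<cdot> j2"
    by (rule pushout_square_factor[OF P _ _ _ _ _ ueq]) (simp_all add: bf(1-12) XY pf(1-8) u(1,2))
  have "w \<cdot> ?c = u"
    by (rule biproduct_out_eq[OF b])
      (use w c1 bf(1-12) XY pf u(1,2) in \<open>auto simp del: plus_comp comp_plus\<close>)
  then show "\<exists>v. v \<in> Arr \<A> \<and> tgt v = tgt u \<and> src v = tgt ?c \<and> v \<cdot> ?c = u"
    using w bf(1-12) XY pf by (intro exI[of _ w]) auto
qed

lemma pushout_exists:
  assumes "i \<in> Arr \<A>" "g \<in> Arr \<A>" "src g = src i"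
  obtains x i' where "pushout_square \<A> i g x i'"
proof -
  obtain Z j1 j2 q1 q2 where b: "biproduct \<A> (tgt i) (tgt g) Z j1 j2 q1 q2"
    using biproduct_exists[of "tgt i" "tgt g"] assms by auto
  have "j1 \<cdot> i \<boxplus> neg (j2 \<cdot> g) \<in> Arr \<A>" using biproduct_facts[OF b] assms by auto
  then obtain c where "is_cokernel \<A> c (j1 \<cdot> i \<boxplus> neg (j2 \<cdot> g))" using cokernel_exists by blast
  then show thesis using pushout_square_of_cokernel[OF b, of i g c] assms that by auto
qed

text \<open>\<open>(i, -g)\<close> is monic because its first component is, so it is the kernel of
  its cokernel. If \<open>i'\<close> kills \<open>u\<close>, then \<open>(0, u)\<close> factors
  through it by some \<open>w\<close> with \<open>i \<cdot> w\<close> zero; thus \<open>w\<close>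
  and \<open>u\<close> vanish. The deflation \<open>p'\<close> is induced by \<open>p\<close> and
  zero.\<close>

lemma pushout_conf:
  assumes e: "conf B A (i, p)" and P: "pushout_square \<A> i g x i'" and B': "tgt g \<in> \<C>"
  obtains p' where "conf (tgt g) A (i', p')" "p' \<cdot> x = p"
proof -
  note ef = conf_facts[OF e] note pf = pushout_square_facts[OF P]
  obtain Z j1 j2 q1 q2 where b: "biproduct \<A> (tgt i) (tgt g) Z j1 j2 q1 q2"
    using biproduct_exists[of "tgt i" "tgt g"] pf by auto
  note bf = biproduct_facts[OF b]
  let ?m = "j1 \<cdot> i \<boxplus> neg (j2 \<cdot> g)" let ?c = "x \<cdot> q1 \<boxplus> i' \<cdot> q2"
  have coker: "is_cokernel \<A> ?c ?m" by (rule cokernel_of_pushout_square[OF b P]) simp_all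
  have m: "?m \<in> Arr \<A>" "src ?m = B" "tgt ?m = Z" using bf(1-12) pf ef by auto
  \<comment> \<open>The instance of \<open>neg_unique\<close> says that minus zero is zero, which
    disposes of the second component.\<close>
  have qm: "q1 \<cdot> ?m = i"
    using bf pf ef biproduct_comp[OF b, of i] biproduct_comp[OF b, of g] plus_zero[of i B] 
    by (simp add: neg_unique[symmetric, of "nul B (tgt i)" "nul B (tgt i)"])
  have "monic \<A> ?m"
  proof (rule monicI[OF m(1)])
    fix u assume u: "u \<in> Arr \<A>" "tgt u = src ?m" "?m \<cdot> u = nul (src u) (tgt ?m)"
    have "i \<cdot> u = q1 \<cdot> (?m \<cdot> u)"
      by (rule comp_eq_assoc[OF qm, symmetric]) (use u m bf in auto)
    also have "\<dots> = i \<cdot> nul (src u) B" unfolding u(3) using bf u m ef by simp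
    finally have "u = nul (src u) B"
      by (rule monic_cancel[OF ef(10)]) (use u m ef in auto)
    then show "u = nul (src u) (src ?m)" using m by simp
  qed
  then have ker: "is_kernel \<A> ?m ?c" using monic_short_exact[OF _ coker] by (simp add: short_exact_def)
  have cj: "?c \<cdot> j2 = i'" using bf pf by simp
  have mono: "monic \<A> i'"
  proof (rule monicI[OF pf(6)])
    fix u assume u: "u \<in> Arr \<A>" "tgt u = src i'" "i' \<cdot> u = nul (src u) (tgt i')"
    have "?c \<cdot> (j2 \<cdot> u) = nul (src u) (tgt i')"
      using comp_eq_assoc[OF cj, of u] u bf(1-12) pf by (simp del: plus_comp)
    then obtain w where w: "w \<in> Arr \<A>" "src w = src u" "tgt w = B" "?m \<cdot> w = j2 \<cdot> u"
      using kernel_factor[OF ker, of "j2 \<cdot> u"] m u bf(1-12) pf by auto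
    have "i \<cdot> w = q1 \<cdot> (?m \<cdot> w)"
      by (rule comp_eq_assoc[OF qm, symmetric]) (use w m bf in auto)
    also have "\<dots> = i \<cdot> nul (src u) B"
      unfolding w(4) using biproduct_comp[OF b, of u] u pf ef by simp
    finally have "w = nul (src u) B" by (rule monic_cancel[OF ef(10)]) (use w u ef in auto)
    then have "j2 \<cdot> u = nul (src u) Z" using w(4) m u by (simp del: plus_comp)
    then have "q2 \<cdot> (j2 \<cdot> u) = q2 \<cdot> nul (src u) Z" by simp
    then show "u = nul (src u) (src i')"
      using biproduct_comp[OF b, of u] u pf bf by simp
  qed
  obtain p' where p': "p' \<in> Arr \<A>" "src p' = tgt i'" "tgt p' = A" "p' \<cdot> x = p" "p' \<cdot> i' = nul (tgt g) A"
    by (rule pushout_square_factor[OF P, of p "nul (tgt g) A"]) (use ef pf in auto)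
  have "is_cokernel \<A> p' i'"
  proof (rule is_cokernelI)
    show "epic \<A> p'"
    proof (rule epicI[OF p'(1)])
      fix u assume u: "u \<in> Arr \<A>" "src u = tgt p'" "u \<cdot> p' = nul (src p') (tgt u)"
      have "u \<cdot> p = (u \<cdot> p') \<cdot> x" using p' u(1,2) pf by simp
      also have "\<dots> = nul A (tgt u) \<cdot> p" unfolding u(3) using p' u(1,2) pf ef by simp
      finally have "u = nul A (tgt u)"
        by (rule epic_cancel[OF ef(11)]) (use p' u ef in auto)
      then show "u = nul (tgt p') (tgt u)" using p' by simp
    qed
    fix u assume u: "u \<in> Arr \<A>" "src u = tgt i'" "u \<cdot> i' = nul (src i') (tgt u)"
    have "(u \<cdot> x) \<cdot> i = u \<cdot> (i' \<cdot> g)" using pf u(1,2) by simp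
    also have "\<dots> = (u \<cdot> i') \<cdot> g" using pf u(1,2) by simp
    also have "\<dots> = nul B (tgt u)" unfolding u(3) using pf u(1,2) ef by simp
    finally obtain w where w: "w \<in> Arr \<A>" "tgt w = tgt u" "src w = A" "w \<cdot> p = u \<cdot> x"
      using cokernel_factor[OF ef(13), of "u \<cdot> x"] ef pf u by auto
    have "w \<cdot> p' = u"
      by (rule pushout_square_eq[OF P]) (use w p' u pf in auto)
    then show "\<exists>v. v \<in> Arr \<A> \<and> tgt v = tgt u \<and> src v = tgt p' \<and> v \<cdot> p' = u"
      using w p' by auto
  qed (use p' pf in auto)
  then have "conf (tgt g) A (i', p')"
    by (intro confI) (use mono p' pf B' ef in auto)
  then show thesis using that p' by blast
qed

lemma pushout_cmor:
  assumes e: "conf B A (i, p)" and P: "pushout_square \<A> i g x i'" and e': "conf B' A (i', p')"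
    and p: "p' \<cdot> x = p"
  shows "cmor (i, p) (i', p') g (idn A)"
  by (rule cmorI[of x]) (use conf_facts[OF e] conf_facts[OF e'] pushout_square_facts[OF P] p in auto)

lemma pushout_cmor_factor:
  assumes e: "conf B A (i, p)" and P: "pushout_square \<A> i g x i'" and e': "conf B' A (i', p')"
    and p: "p' \<cdot> x = p" and c: "conf B'' A'' (j, q)" "cmor (i, p) (j, q) g h"
  shows "cmor (i', p') (j, q) (idn B') h"
proof -
  note ef = conf_facts[OF e] conf_facts[OF e'] conf_facts[OF c(1)] note pf = pushout_square_facts[OF P]
  obtain f where f: "f \<in> Arr \<A>" "src f = tgt i" "tgt f = tgt j" "f \<cdot> i = j \<cdot> g" "q \<cdot> f = h \<cdot> p"
    "g \<in> Arr \<A>" "src g = B" "tgt g = B''" "h \<in> Arr \<A>" "src h = A" "tgt h = A''"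
    using cmorE[OF c(2) e c(1)] by blast
  have BB: "B'' = B'" using f pf ef by simp
  obtain u where u: "u \<in> Arr \<A>" "src u = tgt i'" "tgt u = tgt j" "u \<cdot> x = f" "u \<cdot> i' = j"
    by (rule pushout_square_factor[OF P, of f j]) (use f ef pf in auto)
  have "q \<cdot> u = h \<cdot> p'"
    by (rule pushout_square_eq[OF P]) (use f u p ef pf BB in auto)
  then show ?thesis by (intro cmorI[of u]) (use u f ef BB in auto)
qed

text \<open>The middle arrow is monic and epic, hence invertible. In this form it says that, for
  single conflations, the steps generating equality of classes can be reversed.\<close>

lemma short_five:
  assumes e: "conf B A (i, p)" "conf B A (j, q)" and m: "cmor (i, p) (j, q) (idn B) (idn A)"
  shows "cmor (j, q) (i, p) (idn B) (idn A)"
proof -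
  note ef = conf_facts[OF e(1)] conf_facts[OF e(2)]
  obtain f where f: "f \<in> Arr \<A>" "src f = tgt i" "tgt f = tgt j" "f \<cdot> i = j" "q \<cdot> f = p"
    using cmorE[OF m e] ef by (metis ident_comp comp_ident C_Obj)
  have "monic \<A> f"
  proof (rule monicI[OF f(1)])
    fix u assume u: "u \<in> Arr \<A>" "tgt u = src f" "f \<cdot> u = nul (src u) (tgt f)"
    have "p \<cdot> u = q \<cdot> (f \<cdot> u)" by (rule comp_eq_assoc[OF f(5), symmetric]) (use u f ef in auto)
    also have "\<dots> = nul (src u) A" unfolding u(3) using u(1,2) f ef by simp
    finally obtain w where w: "w \<in> Arr \<A>" "src w = src u" "tgt w = B" "i \<cdot> w = u"
      using kernel_factor[OF ef(12), of u] u ef f by auto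
    have "j \<cdot> w = f \<cdot> (i \<cdot> w)" by (rule comp_eq_assoc[OF f(4), symmetric]) (use w f ef in auto)
    also have "\<dots> = j \<cdot> nul (src u) B" unfolding w(4) u(3) using u(1,2) f ef by simp
    finally have "w = nul (src u) B" by (rule monic_cancel[OF ef(23)]) (use w u ef in auto)
    then show "u = nul (src u) (src f)" using w u f ef by auto
  qed
  moreover have "epic \<A> f"
  proof (rule epicI[OF f(1)])
    fix u assume u: "u \<in> Arr \<A>" "src u = tgt f" "u \<cdot> f = nul (src f) (tgt u)"
    have "u \<cdot> j = (u \<cdot> f) \<cdot> i" using u(1,2) f ef by simp
    also have "\<dots> = nul B (tgt u)" unfolding u(3) using u(1,2) f ef by simp
    finally obtain w where w: "w \<in> Arr \<A>" "tgt w = tgt u" "src w = A" "w \<cdot> q = u"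
      using cokernel_factor[OF ef(26), of u] u ef f by auto
    have "w \<cdot> p = (w \<cdot> q) \<cdot> f" using w(1-3) f ef by simp
    also have "\<dots> = nul A (tgt u) \<cdot> p" unfolding w(4) u(3) using u(1,2) f ef by simp
    finally have "w = nul A (tgt u)" by (rule epic_cancel[OF ef(11)]) (use w u ef in auto)
    then show "u = nul (tgt f) (tgt u)" using w u f ef by auto
  qed
  ultimately obtain w where w: "w \<in> Arr \<A>" "src w = tgt f" "tgt w = src f"
    "f \<cdot> w = idn (tgt f)" "w \<cdot> f = idn (src f)"
    using monic_epic_iso by blast
  have "w \<cdot> j = i" using comp_eq_assoc[OF w(5), of i] w(1-3) f ef by simp
  moreover have "p \<cdot> w = (q \<cdot> f) \<cdot> w" using f(5) by simp
  then have "p \<cdot> w = q" using w f(1-3) ef by simp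
  ultimately show ?thesis by (intro cmorI[of w]) (use w f ef in auto)
qed

lemma push_conf:
  assumes e: "conf B A e" and g: "g \<in> Arr \<A>" "src g = B" "tgt g \<in> \<C>"
  obtains e' where "conf (tgt g) A e'" "cmor e e' g (idn A)"
proof -
  obtain i p where ip: "e = (i, p)" by (cases e)
  note ef = conf_facts[OF e[unfolded ip]]
  obtain x i' where P: "pushout_square \<A> i g x i'" using pushout_exists[of i g] ef g by auto
  obtain p' where p': "conf (tgt g) A (i', p')" "p' \<cdot> x = p"
    using pushout_conf[OF e[unfolded ip] P] g by auto
  show thesis using that[OF p'(1)] pushout_cmor[OF e[unfolded ip] P p'] ip by simp
qed

text \<open>Every morphism of conflations with an identity at the right end is a push-out.\<close>

lemma cmor_factor:
  assumes e: "conf B A e" "conf B' A e'" "conf B' A'' e''"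
    and m: "cmor e e' g (idn A)" "cmor e e'' g h"
  shows "cmor e' e'' (idn B') h"
proof -
  obtain i p i' p' j q where ip: "e = (i, p)" "e' = (i', p')" "e'' = (j, q)"
    by (cases e, cases e', cases e'')
  note e = e[unfolded ip] note m = m[unfolded ip]
  note ef = conf_facts[OF e(1)] conf_facts[OF e(2)] conf_facts[OF e(3)]
  have g: "g \<in> Arr \<A>" "src g = B" "tgt g = B'" "h \<in> Arr \<A>" "src h = A" "tgt h = A''"
    using cmor_typ[OF e(1,2) m(1)] cmor_typ[OF e(1,3) m(2)] by auto
  obtain x i0 where P: "pushout_square \<A> i g x i0" using pushout_exists[of i g] ef g by auto
  obtain p0 where p0: "conf (tgt g) A (i0, p0)" "p0 \<cdot> x = p"
    using pushout_conf[OF e(1) P] ef g by auto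
  note p0 = p0[unfolded g]
  have "cmor (i', p') (i0, p0) (idn B') (idn A)"
    by (rule short_five[OF p0(1) e(2) pushout_cmor_factor[OF e(1) P p0 e(2) m(1)]])
  from cmor_comp[OF e(2) p0(1) e(3) this pushout_cmor_factor[OF e(1) P p0 e(3) m(2)]]
  show ?thesis using g ip ef by simp
qed

lemma pull_conf:
  assumes e: "conf B A e" and h: "h \<in> Arr \<A>" "tgt h = A" "src h \<in> \<C>"
  obtains e' where "conf B (src h) e'" "cmor e' e (idn B) h"
proof -
  obtain i p where ip: "e = (i, p)" by (cases e)
  note e = e[unfolded ip]
  obtain e' where e': "ext_cat.conf (opposite \<A>) \<C> (src h) B e'"
    "ext_cat.cmor (opposite \<A>) (p, i) e' h (idn B)"
    by (rule ext_cat.push_conf[OF ext_cat_opposite, of A B "(p, i)" h]) (use e h in auto)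
  obtain p' i' where p: "e' = (p', i')" by (cases e')
  show thesis
    by (rule that[of "(i', p')"]) (use e' e cmor_opposite[of B "src h" i' p' B A i p] in \<open>auto simp: p ip\<close>)
qed

lemma cmor_pull_factor:
  assumes e: "conf B A e" "conf B' A e'" "conf B' A'' e''"
    and m: "cmor e' e'' (idn B') h" "cmor e e'' g h"
  shows "cmor e e' g (idn A)"
proof -
  obtain i p i' p' j q where ip: "e = (i, p)" "e' = (i', p')" "e'' = (j, q)"
    by (cases e, cases e', cases e'')
  note e = e[unfolded ip] note m = m[unfolded ip]
  show ?thesis unfolding ip
    using ext_cat.cmor_factor[OF ext_cat_opposite, of A'' B' "(q, j)" A "(p', i')" B "(p, i)" h g] e m
    by (simp add: cmor_opposite[OF e(2,3)] cmor_opposite[OF e(1,3)] cmor_opposite[OF e(1,2)])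
qed

text \<open>The cokernel of \<open>i \<cdot> f\<close> is the push-out \<open>x\<close> of
  \<open>i\<close> along \<open>q\<close>, and its target is an extension of \<open>K\<close> by
  \<open>C\<close>. That second conflation serves both the lifting of extensions and the cokernels
  of composed legs of angled pairs.\<close>

lemma conf_compose:
  assumes e: "conf A C (f, q)" "conf B K (i, p)" and fi: "tgt f = B"
  obtains v w x where "conf A (tgt x) (i \<cdot> f, x)" "conf C K (v, w)" "x \<cdot> i = v \<cdot> q" "w \<cdot> x = p"
    "x \<in> Arr \<A>" "src x = tgt i" "tgt x = tgt v"
proof -
  note ef = conf_facts[OF e(1)] conf_facts[OF e(2)]
  obtain x v where P: "pushout_square \<A> i q x v" using pushout_exists[of i q] ef fi by auto
  note pf = pushout_square_facts[OF P]
  obtain w where w: "conf (tgt q) K (v, w)" "w \<cdot> x = p" using pushout_conf[OF e(2) P] ef by auto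
  have C: "tgt q = C" using ef by simp
  note wf = conf_facts[OF w(1)]
  have "is_cokernel \<A> x (i \<cdot> f)"
  proof (rule is_cokernelI)
    have "x \<cdot> (i \<cdot> f) = (v \<cdot> q) \<cdot> f" using comp_eq_assoc[OF pf(9), of f] ef fi pf by simp
    also have "\<dots> = nul (src (i \<cdot> f)) (tgt x)" using ef fi pf by simp
    finally show "x \<cdot> (i \<cdot> f) = nul (src (i \<cdot> f)) (tgt x)" .
    show "epic \<A> x"
    proof (rule epicI[OF pf(4)])
      fix u assume u: "u \<in> Arr \<A>" "src u = tgt x" "u \<cdot> x = nul (src x) (tgt u)"
      have "(u \<cdot> v) \<cdot> q = u \<cdot> (x \<cdot> i)" using u(1,2) pf by simp
      also have "\<dots> = (u \<cdot> x) \<cdot> i" using u(1,2) pf(1-8) by simp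
      also have "\<dots> = nul C (tgt u) \<cdot> q" unfolding u(3) using u(1,2) pf(1-8) ef fi by simp
      finally have "u \<cdot> v = nul C (tgt u)"
        by (rule epic_cancel[OF ef(11)]) (use u pf ef in auto)
      then show "u = nul (tgt x) (tgt u)"
        using u by (intro pushout_square_eq[OF P, of u "nul (tgt x) (tgt u)"]) (use pf ef in auto)
    qed
    fix u assume u: "u \<in> Arr \<A>" "src u = tgt (i \<cdot> f)" "u \<cdot> (i \<cdot> f) = nul (src (i \<cdot> f)) (tgt u)"
    then obtain t where t: "t \<in> Arr \<A>" "tgt t = tgt u" "src t = C" "t \<cdot> q = u \<cdot> i"
      using cokernel_factor[OF ef(13), of "u \<cdot> i"] ef fi by auto
    obtain z where "z \<in> Arr \<A>" "src z = tgt v" "tgt z = tgt t" "z \<cdot> x = u" "z \<cdot> v = t"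
      by (rule pushout_square_factor[OF P, of u t]) (use u t ef fi in auto)
    then show "\<exists>w. w \<in> Arr \<A> \<and> tgt w = tgt u \<and> src w = tgt x \<and> w \<cdot> x = u" using t pf by auto
  qed (use ef fi pf in auto)
  moreover have "monic \<A> (i \<cdot> f)"
  proof (rule monicI)
    fix u assume u: "u \<in> Arr \<A>" "tgt u = src (i \<cdot> f)" "i \<cdot> f \<cdot> u = nul (src u) (tgt (i \<cdot> f))"
    then have "i \<cdot> (f \<cdot> u) = i \<cdot> (f \<cdot> nul (src u) A)" using ef fi by simp
    then have "f \<cdot> u = f \<cdot> nul (src u) A"
      by (rule monic_cancel[OF ef(23)]) (use u ef fi in auto)
    then have "u = nul (src u) A"
      by (rule monic_cancel[OF ef(10)]) (use u ef fi in auto)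
    then show "u = nul (src u) (src (i \<cdot> f))" using ef fi by simp
  qed (use ef fi in auto)
  ultimately have "conf A (tgt x) (i \<cdot> f, x)"
    by (intro confI) (use ef fi pf wf in auto)
  then show thesis using that w pf C by auto
qed

definition split_conf :: "'a \<times> 'a \<Rightarrow> bool" where
  "split_conf e \<longleftrightarrow>
     (\<exists>r \<in> Hom \<A> (tgt (fst e)) (src (fst e)). r \<cdot> fst e = idn (src (fst e)))"

lemma split_confE:
  assumes "split_conf (i, p)" "conf B A (i, p)"
  obtains r where "r \<in> Arr \<A>" "src r = tgt i" "tgt r = B" "r \<cdot> i = idn B"
  using assms conf_facts[OF assms(2)] by (auto simp: split_conf_def)

lemma split_conf_section:
  assumes s: "split_conf (i, p)" and e: "conf B A (i, p)"
  obtains s where "s \<in> Arr \<A>" "src s = A" "tgt s = tgt i" "p \<cdot> s = idn A"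
proof -
  note ef = conf_facts[OF e]
  obtain r where r: "r \<in> Arr \<A>" "src r = tgt i" "tgt r = B" "r \<cdot> i = idn B"
    using split_confE[OF s e] .
  \<comment> \<open>The projector complementary to \<open>i \<cdot> r\<close> kills
    \<open>i\<close>, so it factors through \<open>p\<close>; the factor is the section.\<close>
  let ?u = "idn (tgt i) \<boxplus> neg (i \<cdot> r)"
  have "?u \<cdot> i = nul B (tgt i)" using r ef by simp
  then obtain s where s: "s \<in> Arr \<A>" "tgt s = tgt i" "src s = A" "s \<cdot> p = ?u"
    using cokernel_factor[OF ef(13), of ?u] r ef by auto
  have "(p \<cdot> s) \<cdot> p = p \<cdot> ?u" using s ef by simp
  also have "\<dots> = p \<boxplus> neg ((p \<cdot> i) \<cdot> r)" using r ef(1-5,7-9) by simp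
  also have "\<dots> = idn A \<cdot> p \<boxplus> (nul (tgt i) A)"
    unfolding ef(6) using r ef(1-5,7-9) by (simp add: neg_unique[symmetric, of _ "nul (tgt i) A"])
  also have "\<dots> = idn A \<cdot> p" using ef by simp
  finally have "p \<cdot> s = idn A" by (rule epic_cancel[OF ef(11)]) (use s ef in auto)
  then show thesis using s that by blast
qed

lemma split_conf_of_section:
  assumes e: "conf B A (i, p)" and s: "s \<in> Arr \<A>" "src s = A" "tgt s = tgt i" "p \<cdot> s = idn A"
  shows "split_conf (i, p)"
proof -
  have "ext_cat.split_conf (opposite \<A>) (p, i)"
    using s conf_facts[OF e] by (auto simp: ext_cat.split_conf_def[OF ext_cat_opposite] intro!: bexI[of _ s])
  then obtain r where "r \<in> Arr \<A>" "tgt r = B" "src r = src p" "r \<cdot> i = idn B"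
    using ext_cat.split_conf_section[OF ext_cat_opposite, of p i A B] e by auto
  then show ?thesis using conf_facts[OF e] by (auto simp: split_conf_def intro!: bexI[of _ r])
qed

lemma split_conf_cmor:
  assumes e: "conf B A e" "conf B' A e'" and m: "cmor e e' g (idn A)" and s: "split_conf e"
  shows "split_conf e'"
proof -
  obtain i p i' p' where ip: "e = (i, p)" "e' = (i', p')" by (cases e, cases e')
  note e = e[unfolded ip] note ef = conf_facts[OF e(1)] conf_facts[OF e(2)]
  obtain s where s: "s \<in> Arr \<A>" "src s = A" "tgt s = tgt i" "p \<cdot> s = idn A"
    using split_conf_section[OF s[unfolded ip] e(1)] .
  obtain f where f: "f \<in> Arr \<A>" "src f = tgt i" "tgt f = tgt i'" "p' \<cdot> f = idn A \<cdot> p"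
    using cmorE[OF m[unfolded ip] e] .
  have "p' \<cdot> (f \<cdot> s) = (idn A \<cdot> p) \<cdot> s" by (rule comp_eq_assoc[OF f(4)]) (use s f ef in auto)
  then show ?thesis unfolding ip
    by (intro split_conf_of_section[OF e(2), of "f \<cdot> s"]) (use s f ef in auto)
qed

text \<open>Exactness of \<open>Ext\<^sup>1(K, A) \<rightarrow> Ext\<^sup>1(K, B) \<rightarrow> Ext\<^sup>1(K, C)\<close>.\<close>

lemma conf_lift:
  assumes a: "conf A C (f, q)" "tgt f = B" and e: "conf B K e" "conf C K e1"
    and m: "cmor e e1 q (idn K)" and s: "split_conf e1"
  obtains e' where "conf A K e'" "cmor e' e f (idn K)"
proof -
  obtain i p where ip: "e = (i, p)" by (cases e)
  note e = e[unfolded ip]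
  \<comment> \<open>\<open>(v, w)\<close> is the push-out of \<open>e\<close> along
    \<open>q\<close>, so it splits together with \<open>e1\<close>.\<close>
  obtain v w x where x: "conf A (tgt x) (i \<cdot> f, x)" "conf C K (v, w)" "x \<cdot> i = v \<cdot> q" "w \<cdot> x = p"
    "x \<in> Arr \<A>" "src x = tgt i" "tgt x = tgt v"
    using conf_compose[OF a(1) e(1) a(2)] .
  note ef = conf_facts[OF a(1)] conf_facts[OF e(1)] note xf = conf_facts[OF x(1)] conf_facts[OF x(2)]
  have "cmor (i, p) (v, w) q (idn K)" by (rule cmorI[of x]) (use x ef xf a(2) in auto)
  then have "split_conf (v, w)"
    using split_conf_cmor[OF e(2) x(2) cmor_factor[OF e x(2) m[unfolded ip]] s] by blast
  then obtain s where s: "s \<in> Arr \<A>" "src s = K" "tgt s = tgt v" "w \<cdot> s = idn K"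
    using split_conf_section[OF _ x(2)] by blast
  \<comment> \<open>Pulling back the conflation of the composite \<open>i \<cdot> f\<close> along
    the section \<open>s\<close> brings its right end from the cokernel back to
    \<open>K\<close>.\<close>
  obtain j p' where e': "conf A K (j, p')" "cmor (j, p') (i \<cdot> f, x) (idn A) s"
    using pull_conf[OF x(1), of s] s x(7) ef by (metis surj_pair)
  note e'f = conf_facts[OF e'(1)]
  obtain y where y: "y \<in> Arr \<A>" "src y = tgt j" "tgt y = tgt (i \<cdot> f)" "y \<cdot> j = (i \<cdot> f) \<cdot> idn A"
    "x \<cdot> y = s \<cdot> p'"
    using cmorE[OF e'(2,1) x(1)] .
  have "p \<cdot> y = w \<cdot> (x \<cdot> y)" by (rule comp_eq_assoc[OF x(4), symmetric]) (use y ef x a(2) xf in auto)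
  also have "\<dots> = (w \<cdot> s) \<cdot> p'" unfolding y(5) using s(1-3) e'f xf x(7) by simp
  finally have "p \<cdot> y = idn K \<cdot> p'" using s by simp
  then have "cmor (j, p') e f (idn K)" unfolding ip
    by (intro cmorI[of y]) (use y ef e'f a(2) in auto)
  then show thesis using that e'(1) by blast
qed

text \<open>Exactness of \<open>Hom(Y, C) \<rightarrow> Ext\<^sup>1(Y, A) \<rightarrow> Ext\<^sup>1(Y, B)\<close>.\<close>

lemma conf_connecting:
  assumes a: "conf A C (f, q)" "tgt f = B" and e: "conf A Y e" "conf B Y e1"
    and m: "cmor e e1 f (idn Y)" and s: "split_conf e1"
  obtains h where "h \<in> Arr \<A>" "src h = Y" "tgt h = C" "cmor e (f, q) (idn A) h"
proof -
  obtain i p i1 p1 where ip: "e = (i, p)" "e1 = (i1, p1)" by (cases e, cases e1)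
  note e = e[unfolded ip] note ef = conf_facts[OF a(1)] conf_facts[OF e(1)] conf_facts[OF e(2)]
  obtain r where r: "r \<in> Arr \<A>" "src r = tgt i1" "tgt r = B" "r \<cdot> i1 = idn B"
    using split_confE[OF s[unfolded ip] e(2)] .
  obtain g where g: "g \<in> Arr \<A>" "src g = tgt i" "tgt g = tgt i1" "g \<cdot> i = i1 \<cdot> f"
    using cmorE[OF m[unfolded ip] e] .
  \<comment> \<open>\<open>r \<cdot> g\<close> extends \<open>f\<close> along \<open>i\<close>;
    followed by \<open>q\<close> it kills \<open>i\<close>, and the arrow induced on
    \<open>Y\<close> is \<open>h\<close>.\<close>
  have rg: "(r \<cdot> g) \<cdot> i = f" using comp_eq_assoc[OF r(4), of f] r(1-3) g ef a(2) by simp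
  have "(q \<cdot> (r \<cdot> g)) \<cdot> i = q \<cdot> ((r \<cdot> g) \<cdot> i)" using r(1-3) g(1-3) ef a(2) by simp
  also have "\<dots> = nul A C" unfolding rg using ef by simp
  finally obtain h where h: "h \<in> Arr \<A>" "tgt h = C" "src h = Y" "h \<cdot> p = q \<cdot> (r \<cdot> g)"
    using cokernel_factor[OF ef(26), of "q \<cdot> (r \<cdot> g)"] r(1-3) g(1-3) ef a(2) by auto
  have "cmor e (f, q) (idn A) h" unfolding ip
    by (rule cmorI[of "r \<cdot> g"]) (simp_all only: rg h(4), use r(1-3) g(1-3) h(1-3) ef a(2) in auto)
  then show thesis using that h by blast
qed

text \<open>Here \<open>e'\<close> is the pull-back of a conflation along its own deflation. The two
  arrows \<open>f\<close> and \<open>p'\<close> from the middle of \<open>e'\<close> to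
  \<open>tgt i\<close> agree after \<open>p\<close>, so their difference factors through
  \<open>i\<close>, and the factor is a retraction.\<close>

lemma split_pull_self:
  assumes e: "conf B K (i, p)" "conf B (tgt i) e'" and m: "cmor e' (i, p) (idn B) p"
  shows "split_conf e'"
proof -
  obtain i' p' where ip: "e' = (i', p')" by (cases e')
  note e = e[unfolded ip] note ef = conf_facts[OF e(1)] conf_facts[OF e(2)]
  obtain f where f: "f \<in> Arr \<A>" "src f = tgt i'" "tgt f = tgt i" "f \<cdot> i' = i \<cdot> idn B" "p \<cdot> f = p \<cdot> p'"
    using cmorE[OF m[unfolded ip] e(2,1)] .
  have "p \<cdot> (f \<boxplus> neg p') = nul (tgt i') K" using f ef by simp
  then obtain r where r: "r \<in> Arr \<A>" "src r = tgt i'" "tgt r = B" "i \<cdot> r = f \<boxplus> neg p'"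
    using kernel_factor[OF ef(12), of "f \<boxplus> neg p'"] f ef by auto
  have "i \<cdot> (r \<cdot> i') = (f \<boxplus> neg p') \<cdot> i'" by (rule comp_eq_assoc[OF r(4)]) (use r f ef in auto)
  also have "\<dots> = i \<boxplus> neg (nul B (tgt i))" using f ef by simp
  also have "\<dots> = i \<cdot> idn B"
    using ef by (simp add: neg_unique[symmetric, of "nul B (tgt i)" "nul B (tgt i)"])
  finally have "r \<cdot> i' = idn B" by (rule monic_cancel[OF ef(10)]) (use r ef in auto)
  then show ?thesis unfolding split_conf_def ip using r ef by (auto intro!: bexI[of _ r])
qed

text \<open>The Mayer-Vietoris conflation: a pull-back is the kernel of the difference of
  \<open>p'\<close> and \<open>k\<close> on the biproduct. In \<open>exact_right_step\<close> it
  lifts two classes with the same image over \<open>K'\<close> jointly.\<close>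

lemma pullback_conf:
  assumes e: "conf B K' (i', p')" and k: "k \<in> Arr \<A>" "src k = K" "tgt k = K'" "K \<in> \<C>"
    and b: "biproduct \<A> (tgt i') K Z j1 j2 q1 q2"
  obtains y i0 p0 where "conf B K (i0, p0)" "cmor (i0, p0) (i', p') (idn B) k"
    "conf (tgt i0) K' (j1 \<cdot> y \<boxplus> j2 \<cdot> p0, p' \<cdot> q1 \<boxplus> neg (k \<cdot> q2))"
    "y \<in> Arr \<A>" "src y = tgt i0" "tgt y = tgt i'"
proof -
  note ef = conf_facts[OF e] note bf = biproduct_facts[OF b]
  obtain y p0 where P: "pullback_square \<A> p' k y p0"
    using ext_cat.pushout_exists[OF ext_cat_opposite, of p' k] ef k by auto
  note pf = ext_cat.pushout_square_facts[OF ext_cat_opposite, simplified, OF P]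
  obtain i0 where i0: "conf B K (i0, p0)" "y \<cdot> i0 = i'"
    using ext_cat.pushout_conf[OF ext_cat_opposite, of K' B p' i' k y p0] P e k by auto
  note i0f = conf_facts[OF i0(1)]
  have m: "cmor (i0, p0) (i', p') (idn B) k"
    by (rule cmorI[of y]) (use ef i0f pf i0 k in auto)
  let ?d = "p' \<cdot> q1 \<boxplus> neg (k \<cdot> q2)"
  have d: "?d \<in> Arr \<A>" "src ?d = Z" "tgt ?d = K'" using bf ef k by auto
  have ker: "is_kernel \<A> (j1 \<cdot> y \<boxplus> j2 \<cdot> p0) ?d"
    using ext_cat.cokernel_of_pushout_square[OF ext_cat_opposite, of "tgt i'" K Z q1 q2 j1 j2 p' k y p0]
      b P ef k by simp
  have d1: "?d \<cdot> j1 = p'" using bf ef k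
    by (simp add: neg_unique[symmetric, of "nul (tgt i') K'" "nul (tgt i') K'"])
  have "epic \<A> ?d"
  proof (rule epicI[OF d(1)])
    fix u assume u: "u \<in> Arr \<A>" "src u = tgt ?d" "u \<cdot> ?d = nul (src ?d) (tgt u)"
    have "u \<cdot> (?d \<cdot> j1) = (u \<cdot> ?d) \<cdot> j1"
      using comp_assoc[of j1 ?d u] u(1,2) bf(1-12) d by (simp del: plus_comp comp_plus)
    then have "u \<cdot> p' = nul K' (tgt u) \<cdot> p'" unfolding d1 u(3) using u(1,2) bf d ef by simp
    then have "u = nul K' (tgt u)" by (rule epic_cancel[OF ef(11)]) (use u d ef in auto)
    then show "u = nul (tgt ?d) (tgt u)" using d by simp
  qed
  then have se: "short_exact \<A> (j1 \<cdot> y \<boxplus> j2 \<cdot> p0) ?d" by (rule epic_short_exact[OF _ ker])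
  have "src (j1 \<cdot> y \<boxplus> j2 \<cdot> p0) = tgt i0" using bf(1-12) pf i0f ef k by auto
  moreover from this have "tgt (j1 \<cdot> y \<boxplus> j2 \<cdot> p0) \<in> \<C>"
    using extension_closed[OF se] i0f d ef by simp
  ultimately have "conf (tgt i0) K' (j1 \<cdot> y \<boxplus> j2 \<cdot> p0, ?d)"
    using se i0f d ef by (simp add: conf_def conflation_def)
  then show thesis using that i0 m pf i0f ef by auto
qed

lemma sum_kernel:
  assumes b: "biproduct \<A> B B' ZB b1 b2 c1 c2" "biproduct \<A> X X' ZX x1 x2 y1 y2" "biproduct \<A> A A' ZA a1 a2 d1 d2"
    and k: "is_kernel \<A> i p" "is_kernel \<A> i' p'"
    and o: "src i = B" "src i' = B'" "tgt i = X" "tgt i' = X'" "tgt p = A" "tgt p' = A'"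
  shows "is_kernel \<A> (x1 \<cdot> (i \<cdot> c1) \<boxplus> x2 \<cdot> (i' \<cdot> c2)) (a1 \<cdot> (p \<cdot> y1) \<boxplus> a2 \<cdot> (p' \<cdot> y2))"
    (is "is_kernel _ ?I ?P")
proof -
  note bB = biproduct_facts[OF b(1)] note bX = biproduct_facts[OF b(2)] note bA = biproduct_facts[OF b(3)]
  note kf = kernel_facts[OF k(1)] kernel_facts[OF k(2)]
  have pX: "src p = X" "src p' = X'" using kf o by auto
  note kf = kf(1,2) pX(1) kf(4-6) pX(2) kf(8)
  have IP: "?I \<in> Arr \<A>" "src ?I = ZB" "tgt ?I = ZX" "?P \<in> Arr \<A>" "src ?P = ZX" "tgt ?P = ZA"
    using bB(1-12) bX(1-12) bA(1-12) kf o by auto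
  have y1I: "y1 \<cdot> ?I = i \<cdot> c1" and y2I: "y2 \<cdot> ?I = i' \<cdot> c2"
    using bB bX kf o biproduct_comp[OF b(2), of "i \<cdot> c1"] biproduct_comp[OF b(2), of "i' \<cdot> c2"] by simp_all
  have d1P: "d1 \<cdot> ?P = p \<cdot> y1" and d2P: "d2 \<cdot> ?P = p' \<cdot> y2"
    using bX bA kf o biproduct_comp[OF b(3), of "p \<cdot> y1"] biproduct_comp[OF b(3), of "p' \<cdot> y2"] by simp_all
  show ?thesis
  proof (rule is_kernelI)
    have "(p \<cdot> i) \<cdot> c1 = nul ZB A" "(p' \<cdot> i') \<cdot> c2 = nul ZB A'"
      unfolding kf(4) kf(8) using bB bA kf(1-3,5-7) o by simp_all
    then have z: "p \<cdot> (i \<cdot> c1) = nul ZB A" "p' \<cdot> (i' \<cdot> c2) = nul ZB A'"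
      using bB(1-12) bA kf(1-3,5-7) o by simp_all
    show "?P \<cdot> ?I = nul (src ?I) (tgt ?P)"
    proof (rule biproduct_into_eq[OF b(3)])
      have "d1 \<cdot> (?P \<cdot> ?I) = (p \<cdot> y1) \<cdot> ?I" by (rule comp_eq_assoc[OF d1P]) (simp_all only: IP bA)
      also have "\<dots> = p \<cdot> (y1 \<cdot> ?I)" by (rule comp_assoc) (simp_all only: IP bX kf o)
      finally show "d1 \<cdot> (?P \<cdot> ?I) = d1 \<cdot> nul (src ?I) (tgt ?P)"
        unfolding y1I z IP using bB bA by simp
      have "d2 \<cdot> (?P \<cdot> ?I) = (p' \<cdot> y2) \<cdot> ?I" by (rule comp_eq_assoc[OF d2P]) (simp_all only: IP bA)
      also have "\<dots> = p' \<cdot> (y2 \<cdot> ?I)" by (rule comp_assoc) (simp_all only: IP bX kf o)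
      finally show "d2 \<cdot> (?P \<cdot> ?I) = d2 \<cdot> nul (src ?I) (tgt ?P)"
        unfolding y2I z IP using bB bA by simp
    qed (simp_all only: IP comp_Hom zero_Hom bA bB)
    show "monic \<A> ?I"
    proof (rule monicI[OF IP(1)])
      fix u assume u: "u \<in> Arr \<A>" "tgt u = src ?I" "?I \<cdot> u = nul (src u) (tgt ?I)"
      have uc: "tgt u = ZB" using u IP by simp
      have "i \<cdot> (c1 \<cdot> u) = y1 \<cdot> (?I \<cdot> u)"
        using comp_eq_assoc[OF y1I, of u] u(1) uc IP bX bB kf o by (simp del: plus_comp comp_plus)
      then have "i \<cdot> (c1 \<cdot> u) = i \<cdot> nul (src u) B"
        unfolding u(3) IP using u(1) bX bB kf o by simp
      then have 1: "c1 \<cdot> u = nul (src u) B"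
        by (rule monic_cancel[OF kernel_monic[OF k(1)]]) (use u(1) uc bB o in auto)
      have "i' \<cdot> (c2 \<cdot> u) = y2 \<cdot> (?I \<cdot> u)"
        using comp_eq_assoc[OF y2I, of u] u(1) uc IP bX bB kf o by (simp del: plus_comp comp_plus)
      then have "i' \<cdot> (c2 \<cdot> u) = i' \<cdot> nul (src u) B'"
        unfolding u(3) IP using u(1) bX bB kf o by simp
      then have 2: "c2 \<cdot> u = nul (src u) B'"
        by (rule monic_cancel[OF kernel_monic[OF k(2)]]) (use u(1) uc bB o in auto)
      have "u = nul (src u) ZB"
        by (rule biproduct_into_eq[OF b(1)]) (simp_all add: 1 2 u(1) uc bB)
      then show "u = nul (src u) (src ?I)" unfolding IP .
    qed
    fix u assume u: "u \<in> Arr \<A>" "tgt u = src ?P" "?P \<cdot> u = nul (src u) (tgt ?P)"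
    have uc: "tgt u = ZX" using u IP by simp
    have "p \<cdot> (y1 \<cdot> u) = d1 \<cdot> (?P \<cdot> u)"
      using comp_eq_assoc[OF d1P, of u] u(1) uc IP bX bA kf o by (simp del: plus_comp comp_plus)
    then have "p \<cdot> (y1 \<cdot> u) = nul (src u) A" unfolding u(3) IP using u(1) bA by simp
    then obtain w1 where w1: "w1 \<in> Arr \<A>" "src w1 = src u" "tgt w1 = B" "i \<cdot> w1 = y1 \<cdot> u"
      using kernel_factor[OF k(1), of "y1 \<cdot> u"] u(1) uc bX kf o by auto
    have "p' \<cdot> (y2 \<cdot> u) = d2 \<cdot> (?P \<cdot> u)"
      using comp_eq_assoc[OF d2P, of u] u(1) uc IP bX bA kf o by (simp del: plus_comp comp_plus)
    then have "p' \<cdot> (y2 \<cdot> u) = nul (src u) A'" unfolding u(3) IP using u(1) bA by simp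
    then obtain w2 where w2: "w2 \<in> Arr \<A>" "src w2 = src u" "tgt w2 = B'" "i' \<cdot> w2 = y2 \<cdot> u"
      using kernel_factor[OF k(2), of "y2 \<cdot> u"] u(1) uc bX kf o by auto
    let ?w = "b1 \<cdot> w1 \<boxplus> b2 \<cdot> w2"
    have w: "?w \<in> Arr \<A>" "src ?w = src u" "tgt ?w = ZB" using w1 w2 bB by auto
    have cw: "c1 \<cdot> ?w = w1" "c2 \<cdot> ?w = w2"
      using biproduct_comp[OF b(1), of w1] biproduct_comp[OF b(1), of w2] w1(1-3) w2(1-3) bB u(1) by simp_all
    have "?I \<cdot> ?w = u"
    proof (rule biproduct_into_eq[OF b(2)])
      have "y1 \<cdot> (?I \<cdot> ?w) = (i \<cdot> c1) \<cdot> ?w"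
        by (rule comp_eq_assoc[OF y1I]) (simp_all only: IP w bX)
      also have "\<dots> = i \<cdot> (c1 \<cdot> ?w)" by (rule comp_assoc) (simp_all only: w bB kf o)
      finally show "y1 \<cdot> (?I \<cdot> ?w) = y1 \<cdot> u" by (simp only: cw w1)
      have "y2 \<cdot> (?I \<cdot> ?w) = (i' \<cdot> c2) \<cdot> ?w"
        by (rule comp_eq_assoc[OF y2I]) (simp_all only: IP w bX)
      also have "\<dots> = i' \<cdot> (c2 \<cdot> ?w)" by (rule comp_assoc) (simp_all only: w bB kf o)
      finally show "y2 \<cdot> (?I \<cdot> ?w) = y2 \<cdot> u" by (simp only: cw w2)
    qed (simp_all only: comp_Hom IP w u uc)
    then show "\<exists>w. w \<in> Arr \<A> \<and> src w = src u \<and> tgt w = src ?I \<and> ?I \<cdot> w = u"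
      unfolding IP using w by (intro exI[of _ ?w]) simp
  qed (simp_all only: IP)
qed

lemma biproduct_conf:
  assumes b: "biproduct \<A> X Y Z i1 i2 p1 p2" and C: "X \<in> \<C>" "Y \<in> \<C>"
  shows "conf X Y (i1, p2)"
proof -
  note bf = biproduct_facts[OF b]
  have "is_kernel \<A> i1 p2"
  proof (rule is_kernelI)
    show "monic \<A> i1"
    proof (rule monicI)
      fix u assume u: "u \<in> Arr \<A>" "tgt u = src i1" "i1 \<cdot> u = nul (src u) (tgt i1)"
      have "u = p1 \<cdot> (i1 \<cdot> u)" using biproduct_comp[OF b, of u] u(1,2) bf by simp
      then show "u = nul (src u) (src i1)" unfolding u(3) using u bf by simp
    qed (rule bf)
    fix u assume u: "u \<in> Arr \<A>" "tgt u = src p2" "p2 \<cdot> u = nul (src u) (tgt p2)"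
    have "u = i1 \<cdot> (p1 \<cdot> u)"
      by (rule biproduct_into_eq[OF b]) (use u bf biproduct_comp[OF b, of "p1 \<cdot> u"] in simp_all)
    then show "\<exists>w. w \<in> Arr \<A> \<and> src w = src u \<and> tgt w = src i1 \<and> i1 \<cdot> w = u"
      using u bf by (intro exI[of _ "p1 \<cdot> u"]) auto
  qed (use bf in auto)
  moreover have "epic \<A> p2"
  proof (rule epicI)
    fix u assume u: "u \<in> Arr \<A>" "src u = tgt p2" "u \<cdot> p2 = nul (src p2) (tgt u)"
    have "u = (u \<cdot> p2) \<cdot> i2" using bf u(1,2) by simp
    then show "u = nul (tgt p2) (tgt u)" unfolding u(3) using bf u(1,2) by simp
  qed (use biproduct_facts[OF b] in simp)
  ultimately have "short_exact \<A> i1 p2" using epic_short_exact by blast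
  then show ?thesis
    using extension_closed[of i1 p2] C biproduct_facts[OF b] by (simp add: conf_def conflation_def)
qed

text \<open>The axiom \<open>biproduct_in\<close> puts one biproduct into \<open>\<C>\<close>;
  extension closure puts every biproduct there.\<close>

lemma biproduct_C:
  assumes b: "biproduct \<A> X Y Z i1 i2 p1 p2" and C: "X \<in> \<C>" "Y \<in> \<C>"
  shows "Z \<in> \<C>"
  using conf_facts[OF biproduct_conf[OF assms]] biproduct_facts[OF b] by simp

lemma sum_conf:
  assumes b: "biproduct \<A> B B' ZB b1 b2 c1 c2" "biproduct \<A> (tgt i) (tgt i') ZX x1 x2 y1 y2"
    "biproduct \<A> A A' ZA a1 a2 d1 d2"
    and e: "conf B A (i, p)" "conf B' A' (i', p')"
  shows "conf ZB ZA (x1 \<cdot> (i \<cdot> c1) \<boxplus> x2 \<cdot> (i' \<cdot> c2), a1 \<cdot> (p \<cdot> y1) \<boxplus> a2 \<cdot> (p' \<cdot> y2))"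
    (is "conf _ _ (?I, ?P)")
proof -
  note ef = conf_facts[OF e(1)] conf_facts[OF e(2)]
  note bB = biproduct_facts[OF b(1)] note bX = biproduct_facts[OF b(2)] note bA = biproduct_facts[OF b(3)]
  have 1: "is_kernel \<A> ?I ?P"
    by (rule sum_kernel[OF b ef(12,25)]) (use ef in auto)
  \<comment> \<open>The cokernel half is dual to \<open>sum_kernel\<close> and comes out bracketed
    the other way.\<close>
  have 2: "is_cokernel \<A> ((a1 \<cdot> p) \<cdot> y1 \<boxplus> (a2 \<cdot> p') \<cdot> y2) ((x1 \<cdot> i) \<cdot> c1 \<boxplus> (x2 \<cdot> i') \<cdot> c2)"
    using ext_cat.sum_kernel[OF ext_cat_opposite, of A A' ZA d1 d2 a1 a2 "tgt i" "tgt i'" ZX y1 y2 x1 x2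
        B B' ZB c1 c2 b1 b2 p i p' i'] b ef by simp
  have "(a1 \<cdot> p) \<cdot> y1 \<boxplus> (a2 \<cdot> p') \<cdot> y2 = ?P" "(x1 \<cdot> i) \<cdot> c1 \<boxplus> (x2 \<cdot> i') \<cdot> c2 = ?I"
    using bB(1-12) bX(1-12) bA(1-12) ef(1-5,14-18) by simp_all
  then have "short_exact \<A> ?I ?P" using 1 2 by (simp add: short_exact_def)
  moreover have "src ?I = ZB" "tgt ?P = ZA" "tgt ?I = ZX"
    using bB(1-12) bX(1-12) bA(1-12) ef by simp_all
  moreover have "ZB \<in> \<C>" "ZA \<in> \<C>" "ZX \<in> \<C>"
    using biproduct_C[OF b(1)] biproduct_C[OF b(2)] biproduct_C[OF b(3)] ef by auto
  ultimately show ?thesis by (simp add: conf_def conflation_def)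
qed

definition zero_obj :: 'o where "zero_obj = (SOME Z. Z \<in> \<C> \<and> zero_object \<A> Z)"

lemma zero_obj: "zero_obj \<in> \<C>" "zero_object \<A> zero_obj"
  using someI_ex[of "\<lambda>Z. Z \<in> \<C> \<and> zero_object \<A> Z"] zero_object_in unfolding zero_obj_def by blast+

lemma to_zero_object:
  assumes "zero_object \<A> Z" "f \<in> Arr \<A>" "tgt f = Z"
  shows "f = nul (src f) Z"
proof -
  have "\<exists>!f'. f' \<in> Hom \<A> (src f) Z" using assms unfolding zero_object_def by auto
  moreover have "Z \<in> Obj \<A>" using assms by auto
  ultimately show ?thesis using assms by (metis mem_Hom zero_Hom Dom_Obj)
qed

lemma conf_zero_left: 
  assumes "A \<in> \<C>" "zero_object \<A> Z" "Z \<in> \<C>"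
  shows "conf Z A (nul Z A, idn A)"
proof (rule confI)
  have A: "A \<in> Obj \<A>" "Z \<in> Obj \<A>" using assms by auto
  show "monic \<A> (nul Z A)"
  proof (rule monicI)
    fix u assume "u \<in> Arr \<A>" "tgt u = src (nul Z A)"
    then show "u = nul (src u) (src (nul Z A))"
      using to_zero_object[OF assms(2), of u] A by simp
  qed (use A in simp)
  show "is_cokernel \<A> (idn A) (nul Z A)"
  proof (rule is_cokernelI)
    show "epic \<A> (idn A)" by (rule epicI) (use A in simp_all)
  qed (use A in auto)
qed (use assms in auto)

lemma conf_zero_right:
  assumes "B \<in> \<C>" "zero_object \<A> Z" "Z \<in> \<C>"
  shows "conf B Z (idn B, nul B Z)"
  using ext_cat.conf_zero_left[OF ext_cat_opposite, of B Z] assms by simp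

section \<open>Chains of conflations\<close>

fun chain :: "'o \<Rightarrow> 'o \<Rightarrow> ('a \<times> 'a) list \<Rightarrow> bool" where
  "chain B A [] \<longleftrightarrow> B = A \<and> A \<in> \<C>"
| "chain B A (e # es) \<longleftrightarrow> (\<exists>K. conf B K e \<and> chain K A es)"

text \<open>
  Of a morphism of spliced sequences only the end components \<open>g\<close>, \<open>h\<close> are recorded; the bound \<open>k\<close> are the
  components induced at the objects where the conflations are spliced.
\<close>

fun mseq :: "'a \<Rightarrow> 'a \<Rightarrow> ('a \<times> 'a) list \<Rightarrow> ('a \<times> 'a) list \<Rightarrow> bool" where
  "mseq g h [] [] \<longleftrightarrow> g = h"
| "mseq g h (e # es) (e' # es') \<longleftrightarrow> (\<exists>k. cmor e e' g k \<and> mseq k h es es')"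
| "mseq g h _ _ \<longleftrightarrow> False"

lemma mseq_length: "mseq g h xs ys \<Longrightarrow> length xs = length ys"
  by (induction g h xs ys rule: mseq.induct) auto

lemma conf_C: "conf B A e \<Longrightarrow> B \<in> \<C>" "conf B A e \<Longrightarrow> A \<in> \<C>"
  by (cases e, simp add: conf_facts)+

lemma chain_C: "chain B A cs \<Longrightarrow> B \<in> \<C> \<and> A \<in> \<C>"
  by (induction cs arbitrary: B) (auto dest: conf_C)

lemma mseq_typ:
  assumes "chain B A xs" "chain B' A' ys" "mseq g h xs ys" "xs \<noteq> []"
  shows "g \<in> Arr \<A>" "src g = B" "tgt g = B'" "h \<in> Arr \<A>" "src h = A" "tgt h = A'"
proof -
  have "g \<in> Hom \<A> B B' \<and> h \<in> Hom \<A> A A'"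
    using assms
  proof (induction g h xs ys arbitrary: B B' rule: mseq.induct)
    case (2 g h e es e' es')
    then obtain k K K' where k: "cmor e e' g k" "mseq k h es es'" "conf B K e" "chain K A es"
      "conf B' K' e'" "chain K' A' es'" by auto
    note t = cmor_typ[OF k(3,5,1)]
    show ?case
    proof (cases "es = []")
      case True
      then have "es' = []" using mseq_length[OF k(2)] by simp
      then show ?thesis using t k True by simp
    qed (use "2.IH" k t in auto)
  qed auto
  then show "g \<in> Arr \<A>" "src g = B" "tgt g = B'" "h \<in> Arr \<A>" "src h = A" "tgt h = A'" by auto
qed

lemma mseq_id: "chain B A cs \<Longrightarrow> mseq (idn B) (idn A) cs cs"
  by (induction cs arbitrary: B) (auto dest: cmor_id)

lemma mseq_comp:
  assumes "chain B A xs" "chain B' A' ys" "chain B'' A'' zs" "mseq g h xs ys" "mseq g' h' ys zs"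
  shows "mseq (g' \<cdot> g) (h' \<cdot> h) xs zs"
  using assms
proof (induction xs arbitrary: ys zs B B' B'' g g')
  case Nil
  have "ys = []" "zs = []" using mseq_length[OF Nil(4)] mseq_length[OF Nil(5)] by auto
  then show ?case using Nil by simp
next
  case (Cons e es)
  then obtain e' es' where y: "ys = e' # es'" by (cases ys) auto
  then obtain e'' es'' where z: "zs = e'' # es''" using Cons by (cases zs) auto
  obtain k K K' k' K'' where k: "cmor e e' g k" "mseq k h es es'" "conf B K e" "chain K A es"
      "conf B' K' e'" "chain K' A' es'" "cmor e' e'' g' k'" "mseq k' h' es' es''" "conf B'' K'' e''" "chain K'' A'' es''"
    using Cons.prems y z by auto
  show ?case unfolding z
    using Cons.IH[OF k(4,6,10,2,8)] cmor_comp[OF k(3,5,9,1,7)] by auto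
qed

lemma mseq_add:
  assumes "chain B A xs" "chain B' A' ys" "mseq g h xs ys" "mseq g' h' xs ys"
  shows "mseq (g \<boxplus> g') (h \<boxplus> h') xs ys"
  using assms
proof (induction xs arbitrary: ys B B' g g')
  case Nil
  then have "ys = []" using mseq_length by fastforce
  then show ?case using Nil by simp
next
  case (Cons e es)
  then obtain e' es' where y: "ys = e' # es'" by (cases ys) auto
  obtain k K K' k' where k: "cmor e e' g k" "mseq k h es es'" "conf B K e" "chain K A es"
      "conf B' K' e'" "chain K' A' es'" "cmor e e' g' k'" "mseq k' h' es es'"
    using Cons.prems y by auto
  show ?case unfolding y
    using Cons.IH[OF k(4,6,2,8)] cmor_add[OF k(3,5,1,7)] by auto
qed

lemma chain_append: "chain B A (xs @ ys) \<longleftrightarrow> (\<exists>K. chain B K xs \<and> chain K A ys)"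
  by (induction xs arbitrary: B) (auto dest: chain_C)

lemma mseq_append:
  "length xs = length xs' \<Longrightarrow> mseq g h (xs @ ys) (xs' @ ys') \<longleftrightarrow> (\<exists>k. mseq g k xs xs' \<and> mseq k h ys ys')"
  by (induction g h xs xs' rule: mseq.induct) auto

definition Ch :: "nat \<Rightarrow> 'o \<Rightarrow> 'o \<Rightarrow> ('a \<times> 'a) list set" where
  "Ch t B A = {cs. chain B A cs \<and> length cs = t}"

lemma Ch_C: "x \<in> Ch t B A \<Longrightarrow> B \<in> \<C>" "x \<in> Ch t B A \<Longrightarrow> A \<in> \<C>"
  by (auto simp: Ch_def dest: chain_C)

lemma Ch_Suc: "e # es \<in> Ch (Suc t) B A \<longleftrightarrow> (\<exists>K. conf B K e \<and> es \<in> Ch t K A)"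
  by (auto simp: Ch_def)

lemma Ch_SucE:
  assumes "x \<in> Ch (Suc t) B A"
  obtains e es K where "x = e # es" "conf B K e" "es \<in> Ch t K A"
  using assms by (cases x) (auto simp: Ch_def)

lemma Ch_snoc: "es @ [e] \<in> Ch (Suc t) B A \<longleftrightarrow> (\<exists>K. es \<in> Ch t B K \<and> conf K A e)"
  by (auto simp: Ch_def chain_append dest: conf_C)

lemma Ch_snocE:
  assumes "x \<in> Ch (Suc t) B A"
  obtains e es K where "x = es @ [e]" "es \<in> Ch t B K" "conf K A e"
proof (cases x rule: rev_cases)
  case (snoc es e)
  then show thesis using assms that by (auto simp: Ch_snoc)
qed (use assms in \<open>auto simp: Ch_def\<close>)

text \<open>Only the first conflation is pushed out. The last clause is the universal property,
  which will make the class of the push-out independent of its choice.\<close>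

lemma Ch_push:
  assumes x: "x \<in> Ch (Suc t) B A" and g: "g \<in> Arr \<A>" "src g = B" "tgt g = B'" "B' \<in> \<C>"
  obtains x' where "x' \<in> Ch (Suc t) B' A" "mseq g (idn A) x x'"
    "\<And>h A'' y. \<lbrakk>y \<in> Ch (Suc t) B' A''; mseq g h x y\<rbrakk> \<Longrightarrow> mseq (idn B') h x' y"
proof -
  obtain e es K where e: "x = e # es" "conf B K e" "es \<in> Ch t K A" using Ch_SucE[OF x] .
  obtain e' where e': "conf B' K e'" "cmor e e' g (idn K)"
    using push_conf[OF e(2), of g] g by auto
  have "mseq (idn B') h (e' # es) y" if y: "y \<in> Ch (Suc t) B' A''" "mseq g h x y" for h A'' y
  proof -
    obtain f fs L where f: "y = f # fs" "conf B' L f" "fs \<in> Ch t L A''" using Ch_SucE[OF y(1)] .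
    obtain k where "cmor e f g k" "mseq k h es fs" using y(2) e f by auto
    then show ?thesis using cmor_factor[OF e(2) e'(1) f(2) e'(2)] f by auto
  qed
  moreover have "mseq g (idn A) x (e' # es)" "e' # es \<in> Ch (Suc t) B' A"
    using e e' mseq_id[of K A es] by (auto simp: Ch_def)
  ultimately show thesis using that by blast
qed

lemma Ch_pull:
  assumes x: "x \<in> Ch (Suc t) B A" and h: "h \<in> Arr \<A>" "src h = A'" "tgt h = A" "A' \<in> \<C>"
  obtains x' where "x' \<in> Ch (Suc t) B A'" "mseq (idn B) h x' x"
    "\<And>g B'' y. \<lbrakk>y \<in> Ch (Suc t) B'' A'; mseq g h y x\<rbrakk> \<Longrightarrow> mseq g (idn A') y x'"
proof -
  obtain e es K where e: "x = es @ [e]" "es \<in> Ch t B K" "conf K A e" using Ch_snocE[OF x] .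
  obtain e' where e': "conf K A' e'" "cmor e' e (idn K) h"
    using pull_conf[OF e(3), of h] h by auto
  have "mseq g (idn A') y (es @ [e'])" if y: "y \<in> Ch (Suc t) B'' A'" "mseq g h y x" for g B'' y
  proof -
    obtain f fs L where f: "y = fs @ [f]" "fs \<in> Ch t B'' L" "conf L A' f" using Ch_snocE[OF y(1)] .
    have l: "length fs = length es" using e f by (simp add: Ch_def)
    obtain k where k: "mseq g k fs es" "cmor f e k h" using y(2) e f by (auto simp: mseq_append[OF l])
    have "cmor f e' k (idn A')" by (rule cmor_pull_factor[OF f(3) e'(1) e(3) e'(2) k(2)])
    then show ?thesis using k f by (auto simp: mseq_append[OF l])
  qed
  moreover have "mseq (idn B) h (es @ [e']) x" "es @ [e'] \<in> Ch (Suc t) B A'"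
    using e e' mseq_id[of B K es] by (auto simp: Ch_snoc mseq_append) (auto simp: Ch_def)
  ultimately show thesis using that by blast
qed

section \<open>Splicing chains into sequences of arrows\<close>

lemma splice_one: "spl [c] = [fst c, snd c]"
  by (simp add: splice_conflations_def)

lemma splice_two:
  "spl (c # c' # cs) = fst c # (fst c' \<cdot> snd c) # tl (spl (c' # cs))"
  by (simp add: splice_conflations_def)

lemma splice_Cons: "spl (c # cs) = fst c # tl (spl (c # cs))"
  by (simp add: splice_conflations_def)

lemma splice_length: "cs \<noteq> [] \<Longrightarrow> length (spl cs) = Suc (length cs)"
  by (cases cs) (simp_all add: splice_conflations_def)

lemma splice_last: "cs \<noteq> [] \<Longrightarrow> last (spl cs) = snd (last cs)"
  by (simp add: splice_conflations_def)

lemma splice_hd: "hd (spl cs) = fst (hd cs)"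
  by (simp add: splice_conflations_def)

text \<open>Pull-back acts on the right end of a sequence, where \<open>splice_two\<close>, which
  opens a splice on the left, is of no help.\<close>

lemma splice_snoc:
  "spl (cs @ [c', c]) = butlast (spl (cs @ [c'])) @ [fst c \<cdot> snd c', snd c]"
proof (induction cs)
  case Nil
  then show ?case by (simp add: splice_one splice_two)
next
  case (Cons a cs)
  then show ?case
  proof (cases cs)
    case Nil
    then show ?thesis by (simp add: splice_one splice_two)
  next
    case (Cons b bs)
    have "tl (butlast (spl (cs @ [c'])) @ [fst c \<cdot> snd c', snd c]) =
      butlast (tl (spl (cs @ [c']))) @ [fst c \<cdot> snd c', snd c]"
      using splice_Cons[of "hd (cs @ [c'])" "tl (cs @ [c'])"] splice_length[of "cs @ [c']"]
      by (cases "spl (cs @ [c'])"; cases "tl (spl (cs @ [c']))")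
        (auto simp: Cons)
    moreover have "tl (spl (cs @ [c'])) \<noteq> []"
      using splice_length[of "cs @ [c']"] by (cases "spl (cs @ [c'])") (auto simp: Cons)
    ultimately show ?thesis using Cons.IH by (simp add: Cons splice_two)
  qed
qed

lemma spliceable_Cons:
  "spliceable \<A> \<C> (c # c' # cs) \<longleftrightarrow>
     conflation \<A> \<C> (fst c) (snd c) \<and> tgt (snd c) = src (fst c') \<and> spliceable \<A> \<C> (c' # cs)"
proof -
  have "(\<forall>k. Suc k < length (c # c' # cs) \<longrightarrow> tgt (snd ((c # c' # cs) ! k)) = src (fst ((c # c' # cs) ! Suc k)))
    \<longleftrightarrow> tgt (snd c) = src (fst c') \<and>
      (\<forall>k. Suc k < length (c' # cs) \<longrightarrow> tgt (snd ((c' # cs) ! k)) = src (fst ((c' # cs) ! Suc k)))"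
    (is "(\<forall>k. ?P k) \<longleftrightarrow> ?Q \<and> (\<forall>k. ?R k)")
  proof -
    have "?P 0 \<longleftrightarrow> ?Q" "\<And>k. ?P (Suc k) \<longleftrightarrow> ?R k" by simp_all
    then show ?thesis by (metis nat.exhaust)
  qed
  then show ?thesis by (auto simp: spliceable_def split: prod.splits)
qed

lemma spliceable_iff_chain:
  assumes "cs \<noteq> []"
  shows "spliceable \<A> \<C> cs \<and> src (fst (hd cs)) = B \<and> tgt (snd (last cs)) = A \<longleftrightarrow> chain B A cs"
  using assms
proof (induction cs arbitrary: B rule: induct_list012)
  case (2 c)
  then show ?case by (cases c) (auto simp: spliceable_def conf_def conflation_def)
next
  case (3 c c' cs)
  have "chain B A (c # c' # cs) \<longleftrightarrow> conf B (src (fst c')) c \<and> chain (src (fst c')) A (c' # cs)"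
    by (metis chain.simps(2) conf_def)
  then show ?case using "3.IH"(2)[of "src (fst c')"]
    by (cases "cs = []") (auto simp: spliceable_Cons conf_def simp del: chain.simps)
qed simp

lemma ext_seqs_eq: "ext_seqs \<A> \<C> (Suc t) A B = spl ` Ch (Suc t) B A"
proof -
  have "cs \<in> Ch (Suc t) B A \<longleftrightarrow> spliceable \<A> \<C> cs \<and> length cs = Suc t \<and>
     src (fst (hd cs)) = B \<and> tgt (snd (last cs)) = A" for cs
    using spliceable_iff_chain[of cs B A] by (cases "cs = []") (auto simp: Ch_def)
  then show ?thesis unfolding ext_seqs_def by blast
qed

text \<open>A form of \<open>seq_morphism\<close> fit for list induction. Each arrow checks the
  components at its own source and target, so agreement with \<open>seq_morphism\<close> presupposes
  that neighbouring arrows match.\<close>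

fun smor :: "(nat \<Rightarrow> 'a) \<Rightarrow> 'a list \<Rightarrow> 'a list \<Rightarrow> bool" where
  "smor f [] [] \<longleftrightarrow> True"
| "smor f (d # ds) (d' # ds') \<longleftrightarrow> f 0 \<in> Hom \<A> (src d) (src d') \<and> f (Suc 0) \<in> Hom \<A> (tgt d) (tgt d') \<and>
     d' \<cdot> f 0 = f (Suc 0) \<cdot> d \<and> smor (\<lambda>k. f (Suc k)) ds ds'"
| "smor f _ _ \<longleftrightarrow> False"

lemma seq_morphism_iff_smor:
  assumes "E \<noteq> []" "successively (\<lambda>d d'. tgt d = src d') E" "successively (\<lambda>d d'. tgt d = src d') E'"
  shows "seq_morphism \<A> E E' f \<longleftrightarrow> smor f E E'"
  using assms
proof (induction f E E' rule: smor.induct)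
  case (2 f d ds d' ds')
  show ?case
  proof (cases "ds = [] \<or> ds' = []")
    case True
    have le: "(\<forall>k \<le> Suc 0. P k) \<longleftrightarrow> P 0 \<and> P (Suc 0)" for P :: "nat \<Rightarrow> bool"
      by (auto simp: le_Suc_eq)
    show ?thesis
    proof (cases "length ds = length ds'")
      case True
      then have "ds = []" "ds' = []" using \<open>ds = [] \<or> ds' = []\<close> by auto
      then show ?thesis by (simp add: seq_morphism_def seq_term_def le del: mem_Hom)
    next
      case False
      then show ?thesis using \<open>ds = [] \<or> ds' = []\<close>
        by (cases ds; cases ds') (simp_all add: seq_morphism_def)
    qed
  next
    case False
    then obtain a as b bs where ab: "ds = a # as" "ds' = b # bs" by (cases ds; cases ds') auto
    have le: "(\<forall>k \<le> Suc n. P k) \<longleftrightarrow> P 0 \<and> (\<forall>k \<le> n. P (Suc k))" for n and P :: "nat \<Rightarrow> bool"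
      by (metis Suc_le_mono nat.exhaust zero_le)
    have lt: "(\<forall>k < Suc n. P k) \<longleftrightarrow> P 0 \<and> (\<forall>k < n. P (Suc k))" for n and P :: "nat \<Rightarrow> bool"
      by (rule All_less_Suc2)
    have t: "trm (d # ds) 0 = src d" "trm (d' # ds') 0 = src d'"
      "\<And>k. trm (d # ds) (Suc k) = trm ds k" "\<And>k. trm (d' # ds') (Suc k) = trm ds' k"
      using ab by (auto simp: seq_term_def)
    have "seq_morphism \<A> (d # ds) (d' # ds') f \<longleftrightarrow> f 0 \<in> Hom \<A> (src d) (src d') \<and>
      d' \<cdot> f 0 = f (Suc 0) \<cdot> d \<and> seq_morphism \<A> ds ds' (\<lambda>k. f (Suc k))"
      unfolding seq_morphism_def by (simp add: le lt t del: mem_Hom) blast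
    moreover have "seq_morphism \<A> ds ds' (\<lambda>k. f (Suc k)) \<longleftrightarrow> smor (\<lambda>k. f (Suc k)) ds ds'"
      using 2 ab by auto
    moreover have "smor (\<lambda>k. f (Suc k)) ds ds' \<Longrightarrow> f (Suc 0) \<in> Hom \<A> (tgt d) (tgt d')"
      using 2 ab by auto
    ultimately show ?thesis by auto
  qed
qed (auto simp: seq_morphism_def)

lemma splice_successively:
  assumes "chain B A cs" "cs \<noteq> []"
  shows "successively (\<lambda>d d'. tgt d = src d') (spl cs)"
  using assms
proof (induction cs arbitrary: B rule: induct_list012)
  case (2 c)
  then show ?case by (cases c) (auto simp: splice_one dest: conf_facts)
next
  case (3 c c' cs)
  then obtain K K' where K: "conf B K (fst c, snd c)" "conf K K' (fst c', snd c')" "chain K A (c' # cs)" by auto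
  note f = conf_facts[OF K(1)] conf_facts[OF K(2)]
  have s: "successively (\<lambda>d d'. tgt d = src d') (spl (c' # cs))"
    using "3.IH"(2) K by simp
  obtain ds where ds: "spl (c' # cs) = fst c' # ds" using splice_Cons by blast
  show ?case using s f unfolding splice_two ds by (cases ds) auto
qed simp

text \<open>At a splice object \<open>snd c' \<cdot> f 1\<close> kills the inflation
  \<open>fst c\<close>, since it moves past it to \<open>snd c' \<cdot> fst c'\<close>; so it
  induces an arrow \<open>k\<close> between the splice objects. Cancelling the deflation
  \<open>snd c\<close> shows that \<open>k\<close> is compatible with the next inflations.\<close>

lemma smor_splice_imp_mseq:
  assumes "chain B A xs" "chain B' A' ys" "xs \<noteq> []" "length xs = length ys"
    "smor f (spl xs) (spl ys)"
  shows "mseq (f 0) (f (Suc (length xs))) xs ys"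
  using assms
proof (induction xs arbitrary: B B' ys f rule: induct_list012)
  case (2 c)
  then obtain c' where y: "ys = [c']" by (cases ys) auto
  then show ?case using 2
    by (auto simp: splice_one cmor_def intro!: bexI[of _ "f (Suc 0)"])
next
  case (3 c d xs)
  then obtain c' d' zs where y: "ys = c' # d' # zs" by (cases ys; cases "tl ys") auto
  obtain K L K' L' where K: "conf B K (fst c, snd c)" "conf K L (fst d, snd d)" "chain K A (d # xs)"
    "conf B' K' (fst c', snd c')" "conf K' L' (fst d', snd d')" "chain K' A' (d' # zs)"
    using 3(3,4) unfolding y prod.collapse chain.simps(2) by blast
  note cf = conf_facts[OF K(1)] conf_facts[OF K(2)] and cf' = conf_facts[OF K(4)] conf_facts[OF K(5)]
  obtain ds where ds: "spl (d # xs) = fst d # ds" using splice_Cons by blast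
  obtain ds' where ds': "spl (d' # zs) = fst d' # ds'" using splice_Cons by blast
  have s: "f 0 \<in> Hom \<A> B B'" "f 1 \<in> Hom \<A> (tgt (fst c)) (tgt (fst c'))"
    "fst c' \<cdot> f 0 = f 1 \<cdot> fst c" "f 2 \<in> Hom \<A> (tgt (fst d)) (tgt (fst d'))"
    "(fst d' \<cdot> snd c') \<cdot> f 1 = f 2 \<cdot> (fst d \<cdot> snd c)" "smor (\<lambda>k. f (Suc (Suc k))) ds ds'"
    using 3(7) cf cf' unfolding y splice_two ds ds' by (auto simp: numeral_2_eq_2)
  have "(snd c' \<cdot> f 1) \<cdot> fst c = snd c' \<cdot> (f 1 \<cdot> fst c)" using s(1,2) cf cf' by simp
  also have "\<dots> = (snd c' \<cdot> fst c') \<cdot> f 0"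
    unfolding s(3)[symmetric] by (rule comp_assoc[symmetric]) (use s(1,2) cf cf' in auto)
  also have "\<dots> = nul B K'" unfolding cf'(6) using s(1) cf cf' by simp
  finally obtain k where k: "k \<in> Arr \<A>" "tgt k = K'" "src k = K" "k \<cdot> snd c = snd c' \<cdot> f 1"
    using cokernel_factor[OF cf(13), of "snd c' \<cdot> f 1"] s(2) cf cf' by auto
  have "(f 2 \<cdot> fst d) \<cdot> snd c = fst d' \<cdot> (snd c' \<cdot> f 1)" using s(2,4,5) cf cf' by simp
  also have "\<dots> = (fst d' \<cdot> k) \<cdot> snd c" unfolding k(4)[symmetric] using k(1-3) cf cf' by simp
  finally have "f 2 \<cdot> fst d = fst d' \<cdot> k"
    by (rule epic_cancel[OF cf(11)]) (use s(4) k cf cf' in auto)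
  \<comment> \<open>The tail starts at the splice object: \<open>k\<close> becomes component 0, and
    the old components from \<open>f 2\<close> on move down by one.\<close>
  then have "smor (case_nat k (\<lambda>m. f (Suc (Suc m)))) (spl (d # xs)) (spl (d' # zs))"
    unfolding ds ds' using k s(4,6) cf cf' by (simp add: numeral_2_eq_2)
  then have "mseq k (f (Suc (Suc (length (d # xs))))) (d # xs) (d' # zs)"
    using "3.IH"(2)[of K K' "d' # zs" "case_nat k (\<lambda>m. f (Suc (Suc m)))"] 3(6) K y by simp
  moreover have "cmor c c' (f 0) k"
    using cmorI[of "f 1" "fst c" "fst c'" "f 0" "snd c'" k "snd c"] s(1-3) k cf cf' by simp
  ultimately show ?case unfolding y by auto
qed simp

lemma mseq_imp_smor_splice:
  assumes "chain B A xs" "chain B' A' ys" "xs \<noteq> []" "mseq g h xs ys"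
  shows "\<exists>f. smor f (spl xs) (spl ys) \<and> f 0 = g \<and> f (Suc (length xs)) = h"
  using assms
proof (induction xs arbitrary: B B' ys g rule: induct_list012)
  case (2 c)
  then obtain c' where y: "ys = [c']" using mseq_length[OF 2(4)] by (cases ys) auto
  obtain K K' where K: "conf B K (fst c, snd c)" "conf B' K' (fst c', snd c')" using 2 y by auto
  obtain f where f: "f \<in> Hom \<A> (tgt (fst c)) (tgt (fst c'))" "f \<cdot> fst c = fst c' \<cdot> g" "snd c' \<cdot> f = h \<cdot> snd c"
    "g \<in> Hom \<A> (src (fst c)) (src (fst c'))" "h \<in> Hom \<A> (tgt (snd c)) (tgt (snd c'))"
    using 2(4) y by (auto simp: cmor_def)
  show ?case unfolding y
    by (rule exI[of _ "case_nat g (case_nat f (\<lambda>_. h))"])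
      (use f conf_facts[OF K(1)] conf_facts[OF K(2)] in \<open>auto simp: splice_one\<close>)
next
  case (3 c d xs)
  then obtain c' d' zs where y: "ys = c' # d' # zs"
    using mseq_length[OF 3(6)] by (cases ys; cases "tl ys") auto
  obtain k where k: "cmor c c' g k" "mseq k h (d # xs) (d' # zs)" using 3(6) y by auto
  obtain K L K' L' where K: "conf B K (fst c, snd c)" "conf K L (fst d, snd d)" "chain K A (d # xs)"
    "conf B' K' (fst c', snd c')" "conf K' L' (fst d', snd d')" "chain K' A' (d' # zs)"
    using 3(3,4) unfolding y prod.collapse chain.simps(2) by blast
  note cf = conf_facts[OF K(1)] conf_facts[OF K(2)] and cf' = conf_facts[OF K(4)] conf_facts[OF K(5)]
  obtain ds where ds: "spl (d # xs) = fst d # ds" using splice_Cons by blast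
  obtain ds' where ds': "spl (d' # zs) = fst d' # ds'" using splice_Cons by blast
  obtain f where f: "smor f (fst d # ds) (fst d' # ds')" "f 0 = k" "f (Suc (length (d # xs))) = h"
    using "3.IH"(2)[OF K(3,6) _ k(2)] unfolding ds ds' by auto
  obtain m where m: "m \<in> Hom \<A> (tgt (fst c)) (tgt (fst c'))" "m \<cdot> fst c = fst c' \<cdot> g" "snd c' \<cdot> m = k \<cdot> snd c"
    "g \<in> Hom \<A> (src (fst c)) (src (fst c'))" "k \<in> Hom \<A> (tgt (snd c)) (tgt (snd c'))"
    using k by (auto simp: cmor_def)
  have fk: "fst d' \<cdot> k = f (Suc 0) \<cdot> fst d" "f (Suc 0) \<in> Hom \<A> (tgt (fst d)) (tgt (fst d'))"
    using f by auto
  have "(fst d' \<cdot> snd c') \<cdot> m = fst d' \<cdot> (k \<cdot> snd c)" using m(1,3) cf cf' by simp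
  also have "\<dots> = (f (Suc 0) \<cdot> fst d) \<cdot> snd c" unfolding fk(1)[symmetric] using m(5) cf cf' by simp
  also have "\<dots> = f (Suc 0) \<cdot> (fst d \<cdot> snd c)" using fk(2) cf cf' by simp
  finally have "smor (case_nat g (case_nat m (\<lambda>k. f (Suc k)))) (spl (c # d # xs)) (spl ys)"
    unfolding y splice_two ds ds' using f m fk(2) cf cf' by simp
  then show ?case
    by (rule exI[of _ "case_nat g (case_nat m (\<lambda>k. f (Suc k)))", OF conjI]) (use f in simp)
qed simp

lemma ext_step_iff:
  assumes x: "x \<in> Ch (Suc t) B A" and y: "y \<in> Ch (Suc t) B A"
  shows "(spl x, spl y) \<in> ext_step \<A> \<C> \<longleftrightarrow> mseq (idn B) (idn A) x y"
    (is "(?X, ?Y) \<in> _ \<longleftrightarrow> _")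
proof -
  have xc: "chain B A x" "x \<noteq> []" "length x = Suc t" and yc: "chain B A y" "y \<noteq> []" "length y = Suc t"
    using x y by (auto simp: Ch_def)
  have iff: "seq_morphism \<A> ?X ?Y f \<longleftrightarrow> smor f ?X ?Y" for f
    by (rule seq_morphism_iff_smor)
      (use splice_successively[OF xc(1,2)] splice_successively[OF yc(1,2)] splice_length[OF xc(2)] in auto)
  show ?thesis
  proof
    assume "(?X, ?Y) \<in> ext_step \<A> \<C>"
    then obtain t' A' B' f where f: "t' \<ge> 1" "?X \<in> ext_seqs \<A> \<C> t' A' B'" "seq_morphism \<A> ?X ?Y f"
      "f 0 = idn B'" "f (Suc t') = idn A'" unfolding ext_step_def by blast
    obtain t'' where t'': "t' = Suc t''" using f(1) by (cases t') auto
    obtain x' where x': "x' \<in> Ch t' B' A'" "?X = spl x'"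
      using f(2) unfolding t'' ext_seqs_eq by auto
    then have x'c: "chain B' A' x'" "x' \<noteq> []" "length x' = t'" using t'' by (auto simp: Ch_def)
    \<comment> \<open>A sequence determines its length, its first source and its last target, so the
      data bound in \<open>ext_step\<close> are the given ones.\<close>
    have "B' = B" "A' = A" "t' = Suc t"
      using spliceable_iff_chain[OF x'c(2), of B' A'] spliceable_iff_chain[OF xc(2), of B A] x'c xc
        splice_hd[of x] splice_hd[of x'] splice_last[of x] splice_last[of x'] splice_length[of x] splice_length[of x'] x'(2)
      by auto
    then show "mseq (idn B) (idn A) x y"
      using smor_splice_imp_mseq[OF xc(1) yc(1) xc(2), of f] f xc yc iff by auto
  next
    assume "mseq (idn B) (idn A) x y"
    then obtain f where "smor f ?X ?Y" "f 0 = idn B" "f (Suc (Suc t)) = idn A"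
      using mseq_imp_smor_splice[OF xc(1) yc(1) xc(2)] xc by auto
    then have "Suc t \<ge> 1 \<and> ?X \<in> ext_seqs \<A> \<C> (Suc t) A B \<and> ?Y \<in> ext_seqs \<A> \<C> (Suc t) A B \<and>
      seq_morphism \<A> ?X ?Y f \<and> f 0 = idn B \<and> f (Suc (Suc t)) = idn A"
      using x y by (auto simp: ext_seqs_eq iff)
    then show "(?X, ?Y) \<in> ext_step \<A> \<C>" unfolding ext_step_def by blast
  qed
qed

text \<open>Different chains can splice to the same sequence, because splice objects are forgotten.
  The identity of that sequence then induces a morphism between the chains.\<close>

lemma splice_eq_mseq:
  assumes x: "x \<in> Ch (Suc t) B A" and y: "y \<in> Ch (Suc t) B A" and e: "spl x = spl y"
  shows "mseq (idn B) (idn A) x y"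
proof -
  have "mseq (idn B) (idn A) x x" using x mseq_id by (auto simp: Ch_def)
  then show ?thesis using ext_step_iff[OF x x] ext_step_iff[OF x y] e by simp
qed

lemma ext_step_E:
  assumes "(E, E') \<in> ext_step \<A> \<C>"
  obtains t B A x y where "x \<in> Ch (Suc t) B A" "y \<in> Ch (Suc t) B A" "E = spl x" "E' = spl y"
    "mseq (idn B) (idn A) x y"
proof -
  obtain t A B where t: "t \<ge> 1" "E \<in> ext_seqs \<A> \<C> t A B" "E' \<in> ext_seqs \<A> \<C> t A B"
    using assms unfolding ext_step_def by blast
  then obtain t' where "t = Suc t'" by (cases t) auto
  with t obtain x y where "x \<in> Ch (Suc t') B A" "y \<in> Ch (Suc t') B A" "E = spl x" "E' = spl y"
    by (auto simp: ext_seqs_eq)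
  then show thesis using that assms ext_step_iff by blast
qed

section \<open>Equivalence classes of chains\<close>

definition cls :: "('a \<times> 'a) list \<Rightarrow> 'a list set" where
  "cls x = ext_class \<A> \<C> (spl x)"

lemma ext_class_eq_iff:
  "ext_class \<A> \<C> E = ext_class \<A> \<C> E' \<longleftrightarrow> (E, E') \<in> (ext_step \<A> \<C> \<union> (ext_step \<A> \<C>)\<inverse>)\<^sup>*"
proof -
  let ?R = "(ext_step \<A> \<C> \<union> (ext_step \<A> \<C>)\<inverse>)\<^sup>*"
  have s: "sym ?R" by (intro sym_rtrancl) (auto simp: sym_def)
  have "(E, E') \<in> ?R \<Longrightarrow> ext_class \<A> \<C> E = ext_class \<A> \<C> E'"
    using s unfolding ext_class_def by (auto dest: symD intro: rtrancl_trans)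
  moreover have "E' \<in> ext_class \<A> \<C> E'" by (simp add: ext_class_def)
  ultimately show ?thesis unfolding ext_class_def by auto
qed

lemma cls_step:
  assumes "x \<in> Ch (Suc t) B A" "y \<in> Ch (Suc t) B A" "mseq (idn B) (idn A) x y"
  shows "cls x = cls y"
  unfolding cls_def ext_class_eq_iff using assms ext_step_iff by blast

text \<open>Each step of the closure joins two spliced sequences with the same ends and length, so
  no member of a class leaves the range of splicing.\<close>

lemma ext_class_mem:
  assumes x: "x \<in> Ch (Suc t) B A" and E: "E \<in> cls x"
  obtains y where "y \<in> Ch (Suc t) B A" "E = spl y" "cls y = cls x"
proof -
  have 1: "(spl x, E) \<in> (ext_step \<A> \<C> \<union> (ext_step \<A> \<C>)\<inverse>)\<^sup>*"
    using E by (simp add: cls_def ext_class_def)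
  have "\<exists>y \<in> Ch (Suc t) B A. E = spl y"
    using 1
  proof (induction rule: rtrancl_induct)
    case (step y z)
    obtain t' B' A' u v where uv: "u \<in> Ch (Suc t') B' A'" "v \<in> Ch (Suc t') B' A'"
      "(y = spl u \<and> z = spl v) \<or> (z = spl u \<and> y = spl v)"
      using step(2) by (auto elim!: ext_step_E)
    obtain w w' where w: "w \<in> Ch (Suc t') B' A'" "w' \<in> Ch (Suc t') B' A'" "y = spl w" "z = spl w'"
      using uv by blast
    obtain x' where x': "x' \<in> Ch (Suc t) B A" "y = spl x'" using step by blast
    have ne: "w \<noteq> []" "x' \<noteq> []" using w x' by (auto simp: Ch_def)
    have "B' = B" "A' = A" "t' = t"
      using spliceable_iff_chain[OF ne(1), of B' A'] spliceable_iff_chain[OF ne(2), of B A] w x' ne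
        splice_hd[of w] splice_hd[of x'] splice_last[of w] splice_last[of x'] splice_length[of w] splice_length[of x']
      by (auto simp: Ch_def)
    then show ?case using w by blast
  qed (use x in auto)
  then obtain y where "y \<in> Ch (Suc t) B A" "E = spl y" by blast
  moreover from this have "cls y = cls x" using 1 ext_class_eq_iff unfolding cls_def by blast
  ultimately show thesis using that by blast
qed

text \<open>The zigzag behind an equality of classes runs through sequences, not chains. The
  induction therefore speaks of every chain splicing to the sequence reached; two such chains are
  linked by \<open>splice_eq_mseq\<close>. \<open>P\<close> may take values of any type and is used
  below with truth values, classes and sets of classes.\<close>

lemma cls_eq_invariant:
  assumes x: "x \<in> Ch (Suc t) B A" and y: "y \<in> Ch (Suc t) B A" and e: "cls x = cls y"
    and P: "\<And>x y. \<lbrakk>x \<in> Ch (Suc t) B A; y \<in> Ch (Suc t) B A; mseq (idn B) (idn A) x y\<rbrakk> \<Longrightarrow> P x = P y"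
  shows "P x = P y"
proof -
  have 1: "(spl x, spl y) \<in> (ext_step \<A> \<C> \<union> (ext_step \<A> \<C>)\<inverse>)\<^sup>*"
    using e ext_class_eq_iff by (simp add: cls_def)
  have "\<forall>z \<in> Ch (Suc t) B A. E = spl z \<longrightarrow> P x = P z"
    if "(spl x, E) \<in> (ext_step \<A> \<C> \<union> (ext_step \<A> \<C>)\<inverse>)\<^sup>*" for E
    using that
  proof (induction rule: rtrancl_induct)
    case base
    then show ?case using splice_eq_mseq[OF x] P[OF x] by blast
  next
    case (step E E')
    then have "E \<in> cls x" by (simp add: cls_def ext_class_def)
    then obtain u where u: "u \<in> Ch (Suc t) B A" "E = spl u" using ext_class_mem[OF x] by blast
    show ?case
    proof (intro ballI impI)
      fix z assume z: "z \<in> Ch (Suc t) B A" "E' = spl z"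
      have "P u = P z" using step(2) u z P ext_step_iff[OF u(1) z(1)] ext_step_iff[OF z(1) u(1)] by auto
      then show "P x = P z" using step(3) u by auto
    qed
  qed
  then show ?thesis using 1 y by blast
qed

section \<open>Push-out and pull-back of classes\<close>

text \<open>Ties raw push-outs of sequences to chains. The arrow \<open>d'\<close> is fixed by its
  composites with \<open>y\<close> and \<open>i'\<close>; the new deflation \<open>p'\<close>,
  followed by the next inflation if there is one, has the same composites.\<close>

lemma pushout_seq_splice:
  assumes x: "x \<in> Ch (Suc t) B A" and g: "g \<in> Arr \<A>" "src g = B" "tgt g = B'" "B' \<in> \<C>"
    and P: "is_pushout_seq \<A> g (spl x) E'"
  obtains x' where "x' \<in> Ch (Suc t) B' A" "mseq g (idn A) x x'" "E' = spl x'"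
proof -
  obtain c es K where e: "x = c # es" "conf B K c" "es \<in> Ch t K A" using Ch_SucE[OF x] .
  obtain i p where c: "c = (i, p)" by (cases c)
  note ef = conf_facts[OF e(2)[unfolded c]]
  obtain i0 d ds i' d' y where E: "spl x = i0 # d # ds" "E' = i' # d' # ds"
    "pushout_square \<A> i0 g y i'" "d' \<in> Hom \<A> (tgt i') (tgt d)" "d' \<cdot> y = d"
    "d' \<cdot> i' = nul (src i') (tgt d)"
    using P unfolding is_pushout_seq_def by blast
  have i0: "i0 = i" using E(1) splice_Cons[of c es] unfolding e(1) c by simp
  note P = E(3)[unfolded i0] note pf = pushout_square_facts[OF P]
  obtain p' where p': "conf B' K (i', p')" "p' \<cdot> y = p"
    using pushout_conf[OF e(2)[unfolded c] P] g by auto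
  note p'f = conf_facts[OF p'(1)]
  have "E' = spl ((i', p') # es)"
  proof (cases es)
    case Nil
    then have d: "d = p" "ds = []" using E(1) unfolding e(1) c by (simp_all add: splice_one)
    moreover have "d' = p'"
      by (rule pushout_square_eq[OF P]) (use d E p' p'f pf ef g in auto)
    ultimately show ?thesis using E(2) Nil by (simp add: splice_one)
  next
    case (Cons f fs)
    then obtain L where "conf K L (fst f, snd f)" using e(3) by (cases f) (auto simp: Ch_def)
    note ff = conf_facts[OF this]
    have d: "d = fst f \<cdot> p" "ds = tl (spl es)"
      using E(1) unfolding e(1) c Cons by (simp_all add: splice_two)
    have "d' = fst f \<cdot> p'"
    proof (rule pushout_square_eq[OF P])
      show "d' \<cdot> y = (fst f \<cdot> p') \<cdot> y" using E(5) d p' p'f pf ff ef by simp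
      show "d' \<cdot> i' = (fst f \<cdot> p') \<cdot> i'" using E(6) d p'f pf ff ef by simp
    qed (use E d p'f pf ff ef g in auto)
    then show ?thesis using E(2) d Cons by (simp add: splice_two)
  qed
  moreover have "cmor c (i', p') g (idn K)"
    unfolding c using pushout_cmor[OF e(2)[unfolded c] P p'] .
  then have "mseq g (idn A) x ((i', p') # es)" using e mseq_id[of K A es] by (auto simp: Ch_def)
  moreover have "(i', p') # es \<in> Ch (Suc t) B' A" using e p' by (auto simp: Ch_Suc)
  ultimately show thesis using that by blast
qed

lemma pushout_seq_exists:
  assumes x: "x \<in> Ch (Suc t) B A" and g: "g \<in> Arr \<A>" "src g = B" "tgt g = B'" "B' \<in> \<C>"
  shows "\<exists>E'. is_pushout_seq \<A> g (spl x) E'"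
proof -
  obtain c es K where e: "x = c # es" "conf B K c" "es \<in> Ch t K A" using Ch_SucE[OF x] .
  obtain i p where c: "c = (i, p)" by (cases c)
  note ef = conf_facts[OF e(2)[unfolded c]]
  obtain y i' where P: "pushout_square \<A> i g y i'" using pushout_exists[of i g] ef g by auto
  note pf = pushout_square_facts[OF P]
  obtain d ds where s: "spl x = i # d # ds"
    using splice_Cons[of c es] splice_length[of x] unfolding e(1) c
    by (cases "tl (spl ((i, p) # es))") auto
  have d: "d \<in> Arr \<A> \<and> src d = tgt i \<and> d \<cdot> i = nul B (tgt d)"
  proof (cases es)
    case Nil
    then show ?thesis using s ef unfolding e(1) c by (auto simp: splice_one)
  next
    case (Cons f fs)
    then obtain L where "conf K L (fst f, snd f)" using e(3) by (cases f) (auto simp: Ch_def)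
    note ff = conf_facts[OF this]
    show ?thesis using s ef ff unfolding e(1) c Cons by (auto simp: splice_two)
  qed
  obtain d' where d': "d' \<in> Arr \<A>" "src d' = tgt i'" "tgt d' = tgt d" "d' \<cdot> y = d"
    "d' \<cdot> i' = nul (tgt g) (tgt d)"
    by (rule pushout_square_factor[OF P, of d "nul (tgt g) (tgt d)"]) (use d g ef pf in auto)
  have "d' \<in> Hom \<A> (tgt i') (tgt d)" "d' \<cdot> i' = nul (src i') (tgt d)"
    by (simp_all add: d'(1-3,5) pf(7))
  then have "is_pushout_seq \<A> g (spl x) (i' # d' # ds)"
    unfolding is_pushout_seq_def s using P d'(4) by blast
  then show ?thesis ..
qed

lemma pullback_seq_splice:
  assumes x: "x \<in> Ch (Suc t) B A" and h: "h \<in> Arr \<A>" "tgt h = A" "src h = A'" "A' \<in> \<C>"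
    and P: "is_pullback_seq \<A> h (spl x) E'"
  obtains x' where "x' \<in> Ch (Suc t) B A'" "mseq (idn B) h x' x" "E' = spl x'"
proof -
  obtain c es K where e: "x = es @ [c]" "es \<in> Ch t B K" "conf K A c" using Ch_snocE[OF x] .
  obtain i p where c: "c = (i, p)" by (cases c)
  note ef = conf_facts[OF e(3)[unfolded c]]
  obtain ds d q d' p' y where E: "spl x = ds @ [d, q]" "E' = ds @ [d', p']"
    "pullback_square \<A> q h y p'" "d' \<in> Hom \<A> (src d) (src p')" "y \<cdot> d' = d"
    "p' \<cdot> d' = nul (src d) (tgt p')"
    using P unfolding is_pullback_seq_def by blast
  have q: "q = p" using E(1) splice_last[of x] unfolding e(1) c by simp
  note P = E(3)[unfolded q]
  note pf = ext_cat.pushout_square_facts[OF ext_cat_opposite, simplified, OF P]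
  note peq = ext_cat.pushout_square_eq[OF ext_cat_opposite, simplified, OF P]
  obtain i' where i': "conf K A' (i', p')" "y \<cdot> i' = i"
    using ext_cat.pushout_conf[OF ext_cat_opposite, of A K p i h y p'] P e(3) c h by auto
  note i'f = conf_facts[OF i'(1)]
  have "E' = spl (es @ [(i', p')])"
  proof (cases es rule: rev_cases)
    case Nil
    then have d: "d = i" "ds = []" using E(1) unfolding e(1) c by (simp_all add: splice_one)
    moreover have "d' = i'"
      by (rule peq) (use d E i' i'f pf ef h in auto)
    ultimately show ?thesis using E(2) Nil by (simp add: splice_one)
  next
    case (snoc fs f)
    then obtain L where "conf L K (fst f, snd f)"
      using e(2) by (cases f) (auto simp: Ch_def chain_append)
    note ff = conf_facts[OF this]
    have d: "d = i \<cdot> snd f" "ds = butlast (spl es)"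
      using E(1) unfolding e(1) c snoc by (simp_all add: splice_snoc)
    have "d' = i' \<cdot> snd f"
    proof (rule peq)
      show "y \<cdot> d' = y \<cdot> (i' \<cdot> snd f)" using comp_eq_assoc[OF i'(2), of "snd f"] E(5) d i'f pf ff ef by simp
      show "p' \<cdot> d' = p' \<cdot> (i' \<cdot> snd f)"
        using comp_eq_assoc[OF i'f(6), of "snd f"] E(6) d i'f pf ff ef by simp
    qed (use E d i'f pf ff ef h in auto)
    then show ?thesis using E(2) d snoc by (simp add: splice_snoc)
  qed
  moreover have "cmor (i', p') c (idn K) h"
    unfolding c by (rule cmorI[of y]) (use ef i'f i' pf h in auto)
  then have "mseq (idn B) h (es @ [(i', p')]) x"
    using e mseq_id[of B K es] by (auto simp: Ch_def mseq_append)
  moreover have "es @ [(i', p')] \<in> Ch (Suc t) B A'" using e i' by (auto simp: Ch_snoc)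
  ultimately show thesis using that by blast
qed

lemma pullback_seq_exists:
  assumes x: "x \<in> Ch (Suc t) B A" and h: "h \<in> Arr \<A>" "tgt h = A" "src h = A'" "A' \<in> \<C>"
  shows "\<exists>E'. is_pullback_seq \<A> h (spl x) E'"
proof -
  obtain c es K where e: "x = es @ [c]" "es \<in> Ch t B K" "conf K A c" using Ch_snocE[OF x] .
  obtain i p where c: "c = (i, p)" by (cases c)
  note ef = conf_facts[OF e(3)[unfolded c]]
  obtain y p' where P: "pullback_square \<A> p h y p'"
    using ext_cat.pushout_exists[OF ext_cat_opposite, of p h] ef h by auto
  note pf = ext_cat.pushout_square_facts[OF ext_cat_opposite, simplified, OF P]
  note pfac = ext_cat.pushout_square_factor[OF ext_cat_opposite, simplified, OF P]
  obtain ds d where s: "spl x = ds @ [d, p] \<and>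
    d \<in> Arr \<A> \<and> tgt d = src p \<and> p \<cdot> d = nul (src d) A"
  proof (cases es rule: rev_cases)
    case Nil
    then show ?thesis using that[of "[]" i] ef unfolding e(1) c by (auto simp: splice_one)
  next
    case (snoc fs f)
    then obtain L where "conf L K (fst f, snd f)"
      using e(2) by (cases f) (auto simp: Ch_def chain_append)
    note ff = conf_facts[OF this]
    have "p \<cdot> (i \<cdot> snd f) = nul (src (snd f)) A"
      using comp_eq_assoc[OF ef(6), of "snd f"] ef ff by simp
    then show ?thesis using that[of "butlast (spl es)" "i \<cdot> snd f"] ef ff
      unfolding e(1) c snoc by (auto simp: splice_snoc)
  qed
  obtain d' where d': "d' \<in> Arr \<A>" "tgt d' = src p'" "src d' = src d" "y \<cdot> d' = d"
    "p' \<cdot> d' = nul (src d) (src h)"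
    by (rule pfac[of d "nul (src d) (src h)"]) (use s h ef pf in auto)
  have "d' \<in> Hom \<A> (src d) (src p')" "p' \<cdot> d' = nul (src d) (tgt p')"
    by (simp_all add: d'(1-3,5) pf(7))
  moreover have "spl x = ds @ [d, p]" using s by simp
  ultimately have "is_pullback_seq \<A> h (spl x) (ds @ [d', p'])"
    unfolding is_pullback_seq_def using P d'(4) by blast
  then show ?thesis ..
qed

text \<open>The union defining \<open>push\<close> collapses to one class: the universal property of
  the push-out removes the choice of the push-out, and \<open>cls_eq_invariant\<close> the choice of
  the representative.\<close>

lemma push_cls:
  assumes x: "x \<in> Ch (Suc t) B A" and x': "x' \<in> Ch (Suc t) B' A" and m: "mseq g (idn A) x x'"
  shows "psh g (cls x) = cls x'"
proof -
  have xc: "chain B A x" "x \<noteq> []" and x'c: "chain B' A x'" using x x' by (auto simp: Ch_def)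
  note g = mseq_typ(1-3)[OF xc(1) x'c m xc(2)]
  have B': "B' \<in> \<C>" and AB: "A \<in> Obj \<A>" "B \<in> Obj \<A>" using x x' Ch_C by auto
  \<comment> \<open>Taking the set of all classes obtained from \<open>y\<close> avoids choosing a
    push-out for each \<open>y\<close>; it turns out to be a singleton.\<close>
  define S where "S y = {cls z | z. z \<in> Ch (Suc t) B' A \<and> mseq g (idn A) y z}" for y
  have single: "cls z = cls z'" if yz: "y \<in> Ch (Suc t) B A" "z \<in> Ch (Suc t) B' A" "mseq g (idn A) y z"
    "z' \<in> Ch (Suc t) B' A" "mseq g (idn A) y z'" for y z z'
  proof -
    obtain u where "u \<in> Ch (Suc t) B' A"
      "\<forall>v \<in> Ch (Suc t) B' A. mseq g (idn A) y v \<longrightarrow> mseq (idn B') (idn A) u v"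
      using Ch_push[OF yz(1) g B'] by metis
    then show ?thesis using cls_step[of u t B' A z] cls_step[of u t B' A z'] yz by metis
  qed
  have Sone: "S y = {cls z}" if yz: "y \<in> Ch (Suc t) B A" "z \<in> Ch (Suc t) B' A" "mseq g (idn A) y z" for y z
    unfolding S_def using single[OF yz(1) _ _ yz(2,3)] yz by blast
  have inv: "S y = {cls x'}" if y: "y \<in> Ch (Suc t) B A" "cls x = cls y" for y
  proof -
    have "S x = S y"
    proof (rule cls_eq_invariant[OF x y])
      fix u v assume uv: "u \<in> Ch (Suc t) B A" "v \<in> Ch (Suc t) B A" "mseq (idn B) (idn A) u v"
      \<comment> \<open>A push-out of \<open>v\<close> receives a morphism over \<open>g\<close>
        from \<open>u\<close> as well, so it serves both chains.\<close>
      obtain v' where v': "v' \<in> Ch (Suc t) B' A" "mseq g (idn A) v v'" using Ch_push[OF uv(2) g B'] .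
      have "mseq (g \<cdot> idn B) (idn A \<cdot> idn A) u v'"
        using mseq_comp[of B A u B A v B' A v'] uv v' by (auto simp: Ch_def)
      then have uv': "mseq g (idn A) u v'" using g AB by simp
      then show "S u = S v" using Sone[OF uv(1) v'(1)] Sone[OF uv(2) v'] by simp
    qed
    then show ?thesis using Sone[OF x x' m] by simp
  qed
  have "ext_class \<A> \<C> E' = cls x'" if EE: "E \<in> cls x" "is_pushout_seq \<A> g E E'" for E E'
  proof -
    obtain y where y: "y \<in> Ch (Suc t) B A" "E = spl y" "cls y = cls x"
      using ext_class_mem[OF x EE(1)] .
    obtain y' where "y' \<in> Ch (Suc t) B' A" "mseq g (idn A) y y'" "E' = spl y'"
      using pushout_seq_splice[OF y(1) g B'] EE y by blast
    then show ?thesis using inv[OF y(1)] y(3) unfolding S_def cls_def by fastforce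
  qed
  moreover have "spl x \<in> cls x" by (simp add: cls_def ext_class_def)
  ultimately show ?thesis unfolding push_def using pushout_seq_exists[OF x g B'] by blast
qed

lemma pull_cls:
  assumes x: "x \<in> Ch (Suc t) B A" and x': "x' \<in> Ch (Suc t) B A'" and m: "mseq (idn B) h x' x"
  shows "pll (cls x) h = cls x'"
proof -
  have xc: "chain B A x" and x'c: "chain B A' x'" "x' \<noteq> []" using x x' by (auto simp: Ch_def)
  note h = mseq_typ(4-6)[OF x'c(1) xc m x'c(2)]
  have A': "A' \<in> \<C>" and AB: "A \<in> Obj \<A>" "B \<in> Obj \<A>" using x x' Ch_C by auto
  define S where "S y = {cls z | z. z \<in> Ch (Suc t) B A' \<and> mseq (idn B) h z y}" for y
  have single: "cls z = cls z'" if yz: "y \<in> Ch (Suc t) B A" "z \<in> Ch (Suc t) B A'" "mseq (idn B) h z y"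
    "z' \<in> Ch (Suc t) B A'" "mseq (idn B) h z' y" for y z z'
  proof -
    obtain u where "u \<in> Ch (Suc t) B A'"
      "\<forall>v \<in> Ch (Suc t) B A'. mseq (idn B) h v y \<longrightarrow> mseq (idn B) (idn A') v u"
      using Ch_pull[OF yz(1) h A'] by metis
    then show ?thesis using cls_step[of z t B A' u] cls_step[of z' t B A' u] yz by metis
  qed
  have Sone: "S y = {cls z}" if yz: "y \<in> Ch (Suc t) B A" "z \<in> Ch (Suc t) B A'" "mseq (idn B) h z y" for y z
    unfolding S_def using single[OF yz(1) _ _ yz(2,3)] yz by blast
  have inv: "S y = {cls x'}" if y: "y \<in> Ch (Suc t) B A" "cls x = cls y" for y
  proof -
    have "S x = S y"
    proof (rule cls_eq_invariant[OF x y])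
      fix u v assume uv: "u \<in> Ch (Suc t) B A" "v \<in> Ch (Suc t) B A" "mseq (idn B) (idn A) u v"
      obtain u' where u': "u' \<in> Ch (Suc t) B A'" "mseq (idn B) h u' u" using Ch_pull[OF uv(1) h A'] .
      have "mseq (idn B \<cdot> idn B) (idn A \<cdot> h) u' v"
        using mseq_comp[of B A' u' B A u B A v] uv u' by (auto simp: Ch_def)
      then have uv': "mseq (idn B) h u' v" using h AB by simp
      then show "S u = S v" using Sone[OF uv(1) u'] Sone[OF uv(2) u'(1)] by simp
    qed
    then show ?thesis using Sone[OF x x' m] by simp
  qed
  have "ext_class \<A> \<C> E' = cls x'" if EE: "E \<in> cls x" "is_pullback_seq \<A> h E E'" for E E'
  proof -
    obtain y where y: "y \<in> Ch (Suc t) B A" "E = spl y" "cls y = cls x"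
      using ext_class_mem[OF x EE(1)] .
    obtain y' where "y' \<in> Ch (Suc t) B A'" "mseq (idn B) h y' y" "E' = spl y'"
      using pullback_seq_splice[OF y(1) h(1,3,2) A'] EE y by blast
    then show ?thesis using inv[OF y(1)] y(3) unfolding S_def cls_def by fastforce
  qed
  moreover have "spl x \<in> cls x" by (simp add: cls_def ext_class_def)
  ultimately show ?thesis unfolding pull_def using pullback_seq_exists[OF x h(1,3,2) A'] by blast
qed

abbreviation EE :: "nat \<Rightarrow> 'o \<Rightarrow> 'o \<Rightarrow> 'a list set set" where
  "EE t A B \<equiv> carrier (EXT t A B)"

lemma Ext_carrier: "EE (Suc t) A B = cls ` Ch (Suc t) B A"
  by (auto simp: Ext_def ext_seqs_eq cls_def image_image)

lemma Ext_classE: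
  assumes "\<gamma> \<in> EE (Suc t) A B"
  obtains x where "x \<in> Ch (Suc t) B A" "\<gamma> = cls x"
  using assms by (auto simp: Ext_carrier)

lemma Ext_class_ends: "\<gamma> \<in> EE (Suc t) A B \<Longrightarrow> A \<in> \<C>" "\<gamma> \<in> EE (Suc t) A B \<Longrightarrow> B \<in> \<C>"
  by (auto elim!: Ext_classE dest: Ch_C)

text \<open>The morphism factors through the push-out of \<open>x\<close> along \<open>g\<close>,
  and what remains exhibits that push-out as the pull-back of \<open>y\<close> along
  \<open>h\<close>. All identities for Baer sums below are produced by writing down a morphism and
  applying this.\<close>

lemma push_eq_pull:
  assumes x: "x \<in> Ch (Suc t) B A" and y: "y \<in> Ch (Suc t) B' A'" and m: "mseq g h x y"
  shows "psh g (cls x) = pll (cls y) h"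
proof -
  have xc: "chain B A x" "x \<noteq> []" and yc: "chain B' A' y" using x y by (auto simp: Ch_def)
  note g = mseq_typ[OF xc(1) yc m xc(2)]
  obtain x' where x': "x' \<in> Ch (Suc t) B' A" "mseq g (idn A) x x'" "mseq (idn B') h x' y"
    using Ch_push[OF x g(1-3) Ch_C(1)[OF y]] y m by metis
  then show ?thesis using push_cls[OF x x'(1,2)] pull_cls[OF y x'(1,3)] by simp
qed

lemma push_closed:
  assumes "\<gamma> \<in> EE (Suc t) A B" "g \<in> Arr \<A>" "src g = B" "tgt g = B'" "B' \<in> \<C>"
  shows "psh g \<gamma> \<in> EE (Suc t) A B'"
proof -
  obtain x where x: "x \<in> Ch (Suc t) B A" "\<gamma> = cls x" using Ext_classE[OF assms(1)] .
  obtain x' where "x' \<in> Ch (Suc t) B' A" "mseq g (idn A) x x'" using Ch_push[OF x(1) assms(2-5)] .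
  then show ?thesis using push_cls[OF x(1)] x(2) by (auto simp: Ext_carrier)
qed

lemma pull_closed:
  assumes "\<gamma> \<in> EE (Suc t) A B" "h \<in> Arr \<A>" "src h = A'" "tgt h = A" "A' \<in> \<C>"
  shows "pll \<gamma> h \<in> EE (Suc t) A' B"
proof -
  obtain x where x: "x \<in> Ch (Suc t) B A" "\<gamma> = cls x" using Ext_classE[OF assms(1)] .
  obtain x' where "x' \<in> Ch (Suc t) B A'" "mseq (idn B) h x' x" using Ch_pull[OF x(1) assms(2-5)] .
  then show ?thesis using pull_cls[OF x(1)] x(2) by (auto simp: Ext_carrier)
qed

lemma push_ident:
  assumes "\<gamma> \<in> EE (Suc t) A B" shows "psh (idn B) \<gamma> = \<gamma>"
proof -
  obtain x where x: "x \<in> Ch (Suc t) B A" "\<gamma> = cls x" using Ext_classE[OF assms(1)] .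
  then show ?thesis using push_cls[OF x(1) x(1)] mseq_id[of B A x] by (auto simp: Ch_def)
qed

lemma pull_ident:
  assumes "\<gamma> \<in> EE (Suc t) A B" shows "pll \<gamma> (idn A) = \<gamma>"
proof -
  obtain x where x: "x \<in> Ch (Suc t) B A" "\<gamma> = cls x" using Ext_classE[OF assms(1)] .
  then show ?thesis using pull_cls[OF x(1) x(1)] mseq_id[of B A x] by (auto simp: Ch_def)
qed

lemma push_push:
  assumes "\<gamma> \<in> EE (Suc t) A B" "g \<in> Arr \<A>" "src g = B" "tgt g = B'" "B' \<in> \<C>"
    "g' \<in> Arr \<A>" "src g' = B'" "tgt g' = B''" "B'' \<in> \<C>"
  shows "psh g' (psh g \<gamma>) = psh (g' \<cdot> g) \<gamma>"
proof -
  obtain x where x: "x \<in> Ch (Suc t) B A" "\<gamma> = cls x" using Ext_classE[OF assms(1)] .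
  obtain x' where x': "x' \<in> Ch (Suc t) B' A" "mseq g (idn A) x x'" using Ch_push[OF x(1) assms(2-5)] .
  obtain x'' where x'': "x'' \<in> Ch (Suc t) B'' A" "mseq g' (idn A) x' x''" using Ch_push[OF x'(1) assms(6-9)] .
  have "mseq (g' \<cdot> g) (idn A \<cdot> idn A) x x''"
    using mseq_comp[of B A x B' A x' B'' A x''] x x' x'' by (auto simp: Ch_def)
  then have "mseq (g' \<cdot> g) (idn A) x x''" using Ch_C[OF x(1)] by simp
  then show ?thesis using push_cls[OF x(1) x'] push_cls[OF x'(1) x''] push_cls[OF x(1) x''(1)] x(2) by simp
qed

lemma pull_pull:
  assumes "\<gamma> \<in> EE (Suc t) A B" "h \<in> Arr \<A>" "src h = A'" "tgt h = A" "A' \<in> \<C>"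
    "h' \<in> Arr \<A>" "src h' = A''" "tgt h' = A'" "A'' \<in> \<C>"
  shows "pll (pll \<gamma> h) h' = pll \<gamma> (h \<cdot> h')"
proof -
  obtain x where x: "x \<in> Ch (Suc t) B A" "\<gamma> = cls x" using Ext_classE[OF assms(1)] .
  obtain x' where x': "x' \<in> Ch (Suc t) B A'" "mseq (idn B) h x' x" using Ch_pull[OF x(1) assms(2-5)] .
  obtain x'' where x'': "x'' \<in> Ch (Suc t) B A''" "mseq (idn B) h' x'' x'" using Ch_pull[OF x'(1) assms(6-9)] .
  have "mseq (idn B \<cdot> idn B) (h \<cdot> h') x'' x"
    using mseq_comp[of B A'' x'' B A' x' B A x] x x' x'' by (auto simp: Ch_def)
  then have "mseq (idn B) (h \<cdot> h') x'' x" using Ch_C[OF x(1)] by simp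
  then show ?thesis using pull_cls[OF x(1) x'] pull_cls[OF x'(1) x''] pull_cls[OF x(1) x''(1)] x(2) by simp
qed

lemma push_pull:
  assumes "\<gamma> \<in> EE (Suc t) A B" "g \<in> Arr \<A>" "src g = B" "tgt g = B'" "B' \<in> \<C>"
    "h \<in> Arr \<A>" "src h = A'" "tgt h = A" "A' \<in> \<C>"
  shows "psh g (pll \<gamma> h) = pll (psh g \<gamma>) h"
proof -
  obtain x where x: "x \<in> Ch (Suc t) B A" "\<gamma> = cls x" using Ext_classE[OF assms(1)] .
  obtain y where y: "y \<in> Ch (Suc t) B' A" "mseq g (idn A) x y" using Ch_push[OF x(1) assms(2-5)] .
  obtain z where z: "z \<in> Ch (Suc t) B A'" "mseq (idn B) h z x" using Ch_pull[OF x(1) assms(6-9)] .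
  have "mseq (g \<cdot> idn B) (idn A \<cdot> h) z y"
    using mseq_comp[of B A' z B A x B' A y] x y z by (auto simp: Ch_def)
  then have "mseq g h z y" using assms Ch_C[OF x(1)] by simp
  then show ?thesis using push_cls[OF x(1) y] pull_cls[OF x(1) z] push_eq_pull[OF z(1) y(1)] x(2) by simp
qed

section \<open>The Baer sum\<close>

abbreviation sum_arrow :: "'a list \<Rightarrow> 'a list \<Rightarrow> (nat \<Rightarrow> 'a) \<Rightarrow> (nat \<Rightarrow> 'a) \<Rightarrow> (nat \<Rightarrow> 'a) \<Rightarrow> (nat \<Rightarrow> 'a) \<Rightarrow> nat \<Rightarrow> 'a" where
  "sum_arrow E E' i1 i2 p1 p2 k \<equiv> i1 (Suc k) \<cdot> ((E ! k) \<cdot> p1 k) \<boxplus> i2 (Suc k) \<cdot> ((E' ! k) \<cdot> p2 k)"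

lemma seq_term_splice_0: "trm (spl (c # cs)) 0 = src (fst c)"
  by (simp add: seq_term_def splice_conflations_def)

lemma seq_term_splice_1:
  assumes "chain B A (c # cs)"
  shows "trm (spl (c # cs)) (Suc 0) = tgt (fst c)"
proof (cases cs)
  case Nil
  then have "conf B A (fst c, snd c)" using assms by auto
  then show ?thesis using conf_facts[of B A "fst c" "snd c"] Nil by (simp add: seq_term_def splice_one)
next
  case (Cons d ds)
  then obtain K L where K: "conf B K (fst c, snd c)" "conf K L (fst d, snd d)" using assms by auto
  show ?thesis using conf_facts[OF K(1)] conf_facts[OF K(2)] Cons by (simp add: seq_term_def splice_two)
qed

lemma seq_term_splice_2:
  "trm (spl (c # d # cs)) (Suc (Suc k)) = trm (spl (d # cs)) (Suc k)"
  using splice_length[of "d # cs"]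
  by (cases "spl (d # cs)") (auto simp: seq_term_def splice_two)

lemma seq_term_splice_end:
  "cs \<noteq> [] \<Longrightarrow> trm (spl cs) (Suc (length cs)) = tgt (snd (last cs))"
  by (simp add: seq_term_def splice_length splice_last)

lemma chain_last: "chain B A cs \<Longrightarrow> cs \<noteq> [] \<Longrightarrow> tgt (snd (last cs)) = A"
  using spliceable_iff_chain by blast

text \<open>Biproducts are given only at the terms of the sequences. At the splice objects, which
  sequences do not mention, they have to be chosen before the sum can be cut into
  conflations.\<close>

lemma sum_chain:
  assumes "chain B A x" "chain B' A' y" "x \<noteq> []" "length x = length y"
    and "\<And>k. k \<le> Suc (length x) \<Longrightarrow> biproduct \<A> (trm (spl x) k)
      (trm (spl y) k) (Z k) (i1 k) (i2 k) (p1 k) (p2 k)"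
  shows "\<exists>s. chain (Z 0) (Z (Suc (length x))) s \<and> length s = length x \<and> spl s =
    map (sum_arrow (spl x) (spl y) i1 i2 p1 p2) [0..<Suc (length x)]"
  using assms
proof (induction x arbitrary: B B' y Z i1 i2 p1 p2 rule: induct_list012)
  case (2 c)
  then obtain c' where y: "y = [c']" by (cases y) auto
  have e: "conf B A (fst c, snd c)" "conf B' A' (fst c', snd c')" using 2 y by auto
  note cf = conf_facts[OF e(1)] and cf' = conf_facts[OF e(2)]
  have b: "biproduct \<A> B B' (Z 0) (i1 0) (i2 0) (p1 0) (p2 0)"
    "biproduct \<A> (tgt (fst c)) (tgt (fst c')) (Z 1) (i1 1) (i2 1) (p1 1) (p2 1)"
    "biproduct \<A> A A' (Z 2) (i1 2) (i2 2) (p1 2) (p2 2)"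
    using "2.prems"(5)[of 0] "2.prems"(5)[of 1] "2.prems"(5)[of 2] cf cf' unfolding y
    by (auto simp: seq_term_def splice_one numeral_2_eq_2)
  show ?case unfolding y
    by (rule exI[of _ "[(i1 1 \<cdot> (fst c \<cdot> p1 0) \<boxplus> i2 1 \<cdot> (fst c' \<cdot> p2 0), i1 2 \<cdot> (snd c \<cdot> p1 1) \<boxplus> i2 2 \<cdot> (snd c' \<cdot> p2 1))]"])
      (use sum_conf[OF b e] conf_C[OF sum_conf[OF b e]] in \<open>simp add: splice_one numeral_2_eq_2\<close>)
next
  case (3 c d xs)
  then obtain c' d' ys where y: "y = c' # d' # ys" by (cases y; cases "tl y") auto
  obtain K L K' L' where K: "conf B K (fst c, snd c)" "conf K L (fst d, snd d)" "chain K A (d # xs)"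
    "conf B' K' (fst c', snd c')" "conf K' L' (fst d', snd d')" "chain K' A' (d' # ys)"
    using 3(3,4) unfolding y prod.collapse chain.simps(2) by blast
  note cf = conf_facts[OF K(1)] conf_facts[OF K(2)] and cf' = conf_facts[OF K(4)] conf_facts[OF K(5)]
  obtain KZ k1 k2 l1 l2 where bK: "biproduct \<A> K K' KZ k1 k2 l1 l2"
    using biproduct_exists[of K K'] cf cf' by auto
  have b: "biproduct \<A> B B' (Z 0) (i1 0) (i2 0) (p1 0) (p2 0)"
    "biproduct \<A> (tgt (fst c)) (tgt (fst c')) (Z 1) (i1 1) (i2 1) (p1 1) (p2 1)"
    "biproduct \<A> (tgt (fst d)) (tgt (fst d')) (Z 2) (i1 2) (i2 2) (p1 2) (p2 2)"
    using "3.prems"(5)[of 0] "3.prems"(5)[of 1] "3.prems"(5)[of 2] cf cf' seq_term_splice_1[OF "3.prems"(1)]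
      seq_term_splice_1[OF K(3)] seq_term_splice_1[OF K(6)] seq_term_splice_1[OF "3.prems"(2)[unfolded y]]
    unfolding y by (auto simp: seq_term_splice_0 seq_term_splice_2 numeral_2_eq_2)
  note bf = biproduct_facts[OF b(1)] and bf1 = biproduct_facts[OF b(2)] and bf2 = biproduct_facts[OF b(3)]
    and bfK = biproduct_facts[OF bK]
  \<comment> \<open>For the tail, positions 0 and 1 of the whole sequence are replaced by a single
    entry \<open>a\<close> at the splice object.\<close>
  let ?sh = "\<lambda>a f. case_nat a (\<lambda>m. f (Suc (Suc m)))"
  let ?I = "i1 1 \<cdot> (fst c \<cdot> p1 0) \<boxplus> i2 1 \<cdot> (fst c' \<cdot> p2 0)" let ?P = "k1 \<cdot> (snd c \<cdot> p1 1) \<boxplus> k2 \<cdot> (snd c' \<cdot> p2 1)"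
  have e: "conf (Z 0) KZ (?I, ?P)" by (rule sum_conf[OF b(1,2) bK K(1,4)])
  have "\<exists>s. chain (?sh KZ Z 0) (?sh KZ Z (Suc (length (d # xs)))) s \<and> length s = length (d # xs) \<and> spl s =
    map (sum_arrow (spl (d # xs)) (spl (d' # ys)) (?sh k1 i1) (?sh k2 i2) (?sh l1 p1) (?sh l2 p2))
      [0..<Suc (length (d # xs))]"
  proof (rule "3.IH"(2)[OF K(3,6)])
    fix k assume k: "k \<le> Suc (length (d # xs))"
    show "biproduct \<A> (trm (spl (d # xs)) k) (trm (spl (d' # ys)) k)
      (?sh KZ Z k) (?sh k1 i1 k) (?sh k2 i2 k) (?sh l1 p1 k) (?sh l2 p2 k)"
    proof (cases k)
      case 0
      then show ?thesis using bK cf cf' by (simp add: seq_term_splice_0)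
    next
      case (Suc m)
      then show ?thesis using "3.prems"(5)[of "Suc (Suc m)"] k unfolding y by (simp add: seq_term_splice_2)
    qed
  qed (use 3(6) y in auto)
  then obtain s where s: "chain KZ (Z (Suc (length (c # d # xs)))) s" "length s = length (d # xs)" "spl s =
    map (sum_arrow (spl (d # xs)) (spl (d' # ys)) (?sh k1 i1) (?sh k2 i2) (?sh l1 p1) (?sh l2 p2))
      [0..<Suc (length (d # xs))]" by auto
  then obtain e1 es where es: "s = e1 # es" by (cases s) auto
  obtain ds where ds: "spl (d # xs) = fst d # ds" "length ds = Suc (length xs)"
    using splice_Cons[of d xs] splice_length[of "d # xs"] by (metis length_Cons list.distinct(1) list.inject length_tl diff_Suc_1)
  obtain ds' where ds': "spl (d' # ys) = fst d' # ds'" "length ds' = Suc (length ys)"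
    using splice_Cons[of d' ys] splice_length[of "d' # ys"] by (metis length_Cons list.distinct(1) list.inject length_tl diff_Suc_1)
  have up: "[0..<Suc n] = 0 # map Suc [0..<n]" for n by (simp add: upt_conv_Cons map_Suc_upt del: upt_Suc)
  have hd1: "fst e1 = i1 2 \<cdot> (fst d \<cdot> l1) \<boxplus> i2 2 \<cdot> (fst d' \<cdot> l2)"
    and tl1: "tl (spl s) =
      map (\<lambda>k. i1 (Suc (Suc (Suc k))) \<cdot> ((ds ! k) \<cdot> p1 (Suc (Suc k))) \<boxplus> i2 (Suc (Suc (Suc k))) \<cdot> ((ds' ! k) \<cdot> p2 (Suc (Suc k))))
       [0..<Suc (length xs)]"
    using arg_cong[OF s(3), of hd] arg_cong[OF s(3), of tl] splice_hd[of s] unfolding ds ds' es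
    by (simp_all add: up[of "Suc (length xs)"] numeral_2_eq_2 comp_def del: upt_Suc)
  \<comment> \<open>The biproduct chosen at the splice object cancels here, so the middle arrow is
    independent of it.\<close>
  have "fst e1 \<cdot> ?P = i1 2 \<cdot> ((fst d \<cdot> snd c) \<cdot> p1 1) \<boxplus> i2 2 \<cdot> ((fst d' \<cdot> snd c') \<cdot> p2 1)"
    unfolding hd1 using bf1(1-12,20) bf2(1-12) bfK cf(1-5,14-18) cf'(1-5,14-18)
      biproduct_comp[OF bK, of "snd c \<cdot> p1 1"] biproduct_comp[OF bK, of "snd c' \<cdot> p2 1"] by simp
  then have "spl ((?I, ?P) # s) =
    map (sum_arrow (spl (c # d # xs)) (spl y) i1 i2 p1 p2) [0..<Suc (length (c # d # xs))]"
    unfolding y splice_two es unfolding es[symmetric] tl1 ds ds'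
    by (simp add: up[of "Suc (Suc (length xs))"] up[of "Suc (length xs)"] numeral_2_eq_2 comp_def del: upt_Suc)
  then show ?case using e s by (intro exI[of _ "(?I, ?P) # s"]) auto
qed simp

text \<open>What Baer sums use of a direct sum: the biproducts at the two ends and the four
  structure morphisms, while the inner biproducts are forgotten.\<close>

definition is_dsum where
  "is_dsum t B A x y s ZB b1 b2 c1 c2 ZA a1 a2 d1 d2 \<longleftrightarrow>
     x \<in> Ch (Suc t) B A \<and> y \<in> Ch (Suc t) B A \<and> s \<in> Ch (Suc t) ZB ZA \<and>
     biproduct \<A> B B ZB b1 b2 c1 c2 \<and> biproduct \<A> A A ZA a1 a2 d1 d2 \<and>
     mseq b1 a1 x s \<and> mseq b2 a2 y s \<and> mseq c1 d1 s x \<and> mseq c2 d2 s y"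

lemma splice_nth_typ:
  assumes x: "x \<in> Ch (Suc t) B A" and k: "k \<le> Suc t"
  shows "spl x ! k \<in> Arr \<A>"
    "src (spl x ! k) = trm (spl x) k"
    "tgt (spl x ! k) = trm (spl x) (Suc k)"
proof -
  have c: "chain B A x" "x \<noteq> []" "length x = Suc t" using x by (auto simp: Ch_def)
  have len: "length (spl x) = Suc (Suc t)" using splice_length[OF c(2)] c by simp
  have suc: "successively (\<lambda>d d'. tgt d = src d') (spl x)"
    by (rule splice_successively[OF c(1,2)])
  have "\<forall>d \<in> set (spl x). d \<in> Arr \<A>"
    using c(1,2)
  proof (induction x arbitrary: B rule: induct_list012)
    case (2 e)
    then have "conf B A (fst e, snd e)" by simp
    then show ?case using conf_facts(1,2)[of B A "fst e" "snd e"] by (simp add: splice_one)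
  next
    case (3 c d xs)
    then obtain K L where K: "conf B K (fst c, snd c)" "conf K L (fst d, snd d)" "chain K A (d # xs)"
      unfolding prod.collapse chain.simps(2) by blast
    then have "\<forall>d \<in> set (spl (d # xs)). d \<in> Arr \<A>" using "3.IH"(2) by blast
    then have "\<forall>d \<in> set (tl (spl (d # xs))). d \<in> Arr \<A>"
      using splice_Cons[of d xs] by (metis list.set_intros(2))
    then show ?case unfolding splice_two using conf_facts[OF K(1)] conf_facts[OF K(2)] by simp
  qed simp
  then show "spl x ! k \<in> Arr \<A>" using k len by simp
  show "src (spl x ! k) = trm (spl x) k"
    using k len by (simp add: seq_term_def)
  show "tgt (spl x ! k) = trm (spl x) (Suc k)"
  proof (cases "k = Suc t")
    case True
    then show ?thesis using len by (simp add: seq_term_def last_conv_nth flip: length_0_conv)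
  next
    case False
    then show ?thesis using k len suc by (auto simp: seq_term_def successively_conv_nth)
  qed
qed

text \<open>The inclusions and projections at all positions form morphisms of sequences; passing to
  chains keeps their values at the end positions 0 and \<open>Suc (Suc t)\<close>.\<close>

lemma direct_sum_is_dsum:
  assumes x: "x \<in> Ch (Suc t) B A" and y: "y \<in> Ch (Suc t) B A"
    and S: "direct_sum_seq \<A> (spl x) (spl y) S i1 i2 p1 p2"
  obtains s ZB ZA where "S = spl s" "is_dsum t B A x y s ZB (i1 0) (i2 0) (p1 0) (p2 0)
    ZA (i1 (Suc (Suc t))) (i2 (Suc (Suc t))) (p1 (Suc (Suc t))) (p2 (Suc (Suc t)))"
proof -
  let ?x = "spl x" let ?y = "spl y"
  have xc: "chain B A x" "x \<noteq> []" "length x = Suc t" and yc: "chain B A y" "y \<noteq> []" "length y = Suc t"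
    using x y by (auto simp: Ch_def)
  have len: "length ?x = Suc (Suc t)" "length ?y = Suc (Suc t)" using splice_length xc yc by auto
  have Sl: "length S = Suc (Suc t)"
    and b: "\<And>k. k \<le> Suc (Suc t) \<Longrightarrow> biproduct \<A> (trm ?x k) (trm ?y k) (trm S k) (i1 k) (i2 k) (p1 k) (p2 k)"
    and Sk: "\<And>k. k < Suc (Suc t) \<Longrightarrow> S ! k = sum_arrow ?x ?y i1 i2 p1 p2 k"
    using S len unfolding direct_sum_seq_def by auto
  obtain s where s: "chain (trm S 0) (trm S (Suc (Suc t))) s" "length s = Suc t"
    "spl s = map (sum_arrow ?x ?y i1 i2 p1 p2) [0..<Suc (Suc t)]"
    using sum_chain[OF xc(1) yc(1) xc(2), of "trm S" i1 i2 p1 p2] xc yc b by auto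
  have Ss: "S = spl s"
    by (rule nth_equalityI) (use Sl Sk s(3) in \<open>auto simp del: upt_Suc\<close>)
  have sCh: "s \<in> Ch (Suc t) (trm S 0) (trm S (Suc (Suc t)))" using s by (auto simp: Ch_def)
  have sc: "s \<noteq> []" using s by auto
  have ends: "trm ?x 0 = B" "trm ?y 0 = B" "trm ?x (Suc (Suc t)) = A" "trm ?y (Suc (Suc t)) = A"
  proof -
    obtain c cs d ds where "x = c # cs" "y = d # ds" using xc yc by (metis list.exhaust)
    then show "trm ?x 0 = B" "trm ?y 0 = B"
      using xc yc by (auto simp: seq_term_splice_0 conf_def)
    show "trm ?x (Suc (Suc t)) = A" "trm ?y (Suc (Suc t)) = A"
      using seq_term_splice_end[of x] seq_term_splice_end[of y] xc yc chain_last by auto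
  qed
  have iff: "seq_morphism \<A> (spl u) (spl v) f \<longleftrightarrow>
      smor f (spl u) (spl v)"
    if "chain B' A' u" "u \<noteq> []" "chain B'' A'' v" "v \<noteq> []" for u v f B' A' B'' A''
    by (rule seq_morphism_iff_smor)
      (use splice_successively[OF that(1,2)] splice_successively[OF that(3,4)] splice_length[OF that(2)] in auto)
  have m: "(S ! k) \<cdot> i1 k = i1 (Suc k) \<cdot> (?x ! k)" "(S ! k) \<cdot> i2 k = i2 (Suc k) \<cdot> (?y ! k)"
    "(?x ! k) \<cdot> p1 k = p1 (Suc k) \<cdot> (S ! k)" "(?y ! k) \<cdot> p2 k = p2 (Suc k) \<cdot> (S ! k)" if k: "k < Suc (Suc t)" for k
  proof -
    have bk: "biproduct \<A> (trm ?x k) (trm ?y k) (trm S k) (i1 k) (i2 k) (p1 k) (p2 k)"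
      and bS: "biproduct \<A> (trm ?x (Suc k)) (trm ?y (Suc k)) (trm S (Suc k)) (i1 (Suc k)) (i2 (Suc k)) (p1 (Suc k)) (p2 (Suc k))"
      using b k by auto
    have k': "k \<le> Suc t" using k by simp
    note tx = splice_nth_typ[OF x k'] and ty = splice_nth_typ[OF y k']
    note f = biproduct_facts[OF bk] and g = biproduct_facts[OF bS]
    have S': "S ! k = i1 (Suc k) \<cdot> ((?x ! k) \<cdot> p1 k) \<boxplus> i2 (Suc k) \<cdot> ((?y ! k) \<cdot> p2 k)" using Sk[OF k] .
    show "(S ! k) \<cdot> i1 k = i1 (Suc k) \<cdot> (?x ! k)" "(S ! k) \<cdot> i2 k = i2 (Suc k) \<cdot> (?y ! k)"
      unfolding S' by (simp_all add: tx ty f g)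
    show "(?x ! k) \<cdot> p1 k = p1 (Suc k) \<cdot> (S ! k)" "(?y ! k) \<cdot> p2 k = p2 (Suc k) \<cdot> (S ! k)"
      unfolding S' by (simp_all add: tx ty f g biproduct_comp[OF bS])
  qed
  have h: "i1 k \<in> Hom \<A> (trm ?x k) (trm S k)" "i2 k \<in> Hom \<A> (trm ?y k) (trm S k)"
    "p1 k \<in> Hom \<A> (trm S k) (trm ?x k)" "p2 k \<in> Hom \<A> (trm S k) (trm ?y k)" if "k \<le> Suc (Suc t)" for k
    using biproduct_facts[OF b[OF that]] by auto
  have sm: "seq_morphism \<A> ?x S i1" "seq_morphism \<A> ?y S i2" "seq_morphism \<A> S ?x p1" "seq_morphism \<A> S ?y p2"
    unfolding seq_morphism_def using m h len Sl by (auto simp del: mem_Hom)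
  have "mseq (i1 0) (i1 (Suc (Suc t))) x s" "mseq (i2 0) (i2 (Suc (Suc t))) y s"
    "mseq (p1 0) (p1 (Suc (Suc t))) s x" "mseq (p2 0) (p2 (Suc (Suc t))) s y"
    using sm smor_splice_imp_mseq[OF xc(1) s(1) xc(2), of i1] smor_splice_imp_mseq[OF yc(1) s(1) yc(2), of i2]
      smor_splice_imp_mseq[OF s(1) xc(1) sc, of p1] smor_splice_imp_mseq[OF s(1) yc(1) sc, of p2] xc yc s(2)
      iff[OF xc(1,2) s(1) sc] iff[OF yc(1,2) s(1) sc] iff[OF s(1) sc xc(1,2)] iff[OF s(1) sc yc(1,2)]
    unfolding Ss by auto
  then have "is_dsum t B A x y s (trm S 0) (i1 0) (i2 0) (p1 0) (p2 0)
    (trm S (Suc (Suc t))) (i1 (Suc (Suc t))) (i2 (Suc (Suc t))) (p1 (Suc (Suc t))) (p2 (Suc (Suc t)))"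
    unfolding is_dsum_def using x y sCh b[of 0] b[of "Suc (Suc t)"] ends by auto
  then show thesis using that Ss by blast
qed

lemma seq_term_Obj:
  assumes x: "x \<in> Ch (Suc t) B A" and k: "k \<le> Suc (Suc t)"
  shows "trm (spl x) k \<in> Obj \<A>"
proof (cases k)
  case 0
  then show ?thesis using splice_nth_typ[OF x, of 0] by (metis Dom_Obj le0)
next
  case (Suc m)
  then show ?thesis using splice_nth_typ[OF x, of m] k by (metis Cod_Obj Suc_le_mono)
qed

lemma direct_sum_exists:
  assumes x: "x \<in> Ch (Suc t) B A" and y: "y \<in> Ch (Suc t) B A"
  shows "\<exists>S i1 i2 p1 p2. direct_sum_seq \<A> (spl x) (spl y) S i1 i2 p1 p2"
proof -
  let ?x = "spl x" let ?y = "spl y"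
  have xc: "x \<noteq> []" "length x = Suc t" and yc: "y \<noteq> []" "length y = Suc t"
    using x y by (auto simp: Ch_def)
  have len: "length ?x = Suc (Suc t)" "length ?y = Suc (Suc t)" using splice_length xc yc by auto
  have "\<forall>k. \<exists>Z i1 i2 p1 p2. k \<le> Suc (Suc t) \<longrightarrow> biproduct \<A> (trm ?x k) (trm ?y k) Z i1 i2 p1 p2"
    using biproduct_exists seq_term_Obj[OF x] seq_term_Obj[OF y] by metis
  then obtain Z i1 i2 p1 p2 where b: "\<And>k. k \<le> Suc (Suc t) \<Longrightarrow>
      biproduct \<A> (trm ?x k) (trm ?y k) (Z k) (i1 k) (i2 k) (p1 k) (p2 k)" by metis
  define S where "S = map (sum_arrow ?x ?y i1 i2 p1 p2) [0..<Suc (Suc t)]"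
  have Sl: "length S = Suc (Suc t)" by (simp add: S_def)
  have Sk: "S ! k = sum_arrow ?x ?y i1 i2 p1 p2 k" if "k < Suc (Suc t)" for k
    using that by (simp add: S_def del: upt_Suc)
  have t: "src (S ! k) = Z k" "tgt (S ! k) = Z (Suc k)" if k: "k < Suc (Suc t)" for k
  proof -
    have k': "k \<le> Suc t" using k by simp
    note tx = splice_nth_typ[OF x k'] and ty = splice_nth_typ[OF y k']
    note f = biproduct_facts[OF b[of k]] and g = biproduct_facts[OF b[of "Suc k"]]
    show "src (S ! k) = Z k" "tgt (S ! k) = Z (Suc k)"
      unfolding Sk[OF k] using k' by (simp_all add: tx ty f g)
  qed
  have "trm S k = Z k" if k: "k \<le> Suc (Suc t)" for k
  proof (cases "k = Suc (Suc t)")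
    case True
    then show ?thesis using t(2)[of "Suc t"] Sl by (simp add: seq_term_def last_conv_nth flip: length_0_conv)
  next
    case False
    then show ?thesis using t(1)[of k] k Sl by (simp add: seq_term_def)
  qed
  then have "direct_sum_seq \<A> ?x ?y S i1 i2 p1 p2"
    unfolding direct_sum_seq_def using len Sl Sk b by auto
  then show ?thesis by blast
qed

lemma dsum_exists:
  assumes x: "x \<in> Ch (Suc t) B A" and y: "y \<in> Ch (Suc t) B A"
  obtains s ZB b1 b2 c1 c2 ZA a1 a2 d1 d2 where "is_dsum t B A x y s ZB b1 b2 c1 c2 ZA a1 a2 d1 d2"
  using direct_sum_exists[OF assms] direct_sum_is_dsum[OF assms] by metis

text \<open>One computation covers both the choice of the direct sum and a step in each
  summand.\<close>

lemma dsum_independent: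
  assumes s: "is_dsum t B A x y s ZB b1 b2 c1 c2 ZA a1 a2 d1 d2"
    and s': "is_dsum t B A x' y' s' ZB' b1' b2' c1' c2' ZA' a1' a2' d1' d2'"
    and m: "mseq (idn B) (idn A) x x'" "mseq (idn B) (idn A) y y'"
  shows "psh (c1 \<boxplus> c2) (pll (cls s) (a1 \<boxplus> a2)) =
    psh (c1' \<boxplus> c2') (pll (cls s') (a1' \<boxplus> a2'))"
proof -
  note s = s[unfolded is_dsum_def] and s' = s'[unfolded is_dsum_def]
  have c: "chain B A x" "chain B A y" "chain ZB ZA s" "chain B A x'" "chain B A y'" "chain ZB' ZA' s'"
    using s s' by (auto simp: Ch_def)
  have C: "A \<in> \<C>" "B \<in> \<C>" "ZA \<in> \<C>" "ZB \<in> \<C>" "ZA' \<in> \<C>" "ZB' \<in> \<C>"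
    using chain_C[OF c(1)] chain_C[OF c(3)] chain_C[OF c(6)] by auto
  have b: "biproduct \<A> B B ZB b1 b2 c1 c2" "biproduct \<A> A A ZA a1 a2 d1 d2"
     "biproduct \<A> B B ZB' b1' b2' c1' c2'" "biproduct \<A> A A ZA' a1' a2' d1' d2'" using s s' by auto
  note bf = biproduct_facts[OF b(1)] and af = biproduct_facts[OF b(2)]
    and bf' = biproduct_facts[OF b(3)] and af' = biproduct_facts[OF b(4)]
  \<comment> \<open>\<open>u\<close> and \<open>v\<close> are the comparison arrows at the two ends.
    They underlie a morphism from \<open>s\<close> to \<open>s'\<close>; \<open>v\<close> carries
    diagonal to diagonal, and the codiagonal after \<open>u\<close> is the old codiagonal.\<close>
  define u where "u = b1' \<cdot> c1 \<boxplus> b2' \<cdot> c2" define v where "v = a1' \<cdot> d1 \<boxplus> a2' \<cdot> d2"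
  have u: "u \<in> Arr \<A>" "src u = ZB" "tgt u = ZB'" using bf(1-12) bf'(1-12) by (auto simp: u_def)
  have v: "v \<in> Arr \<A>" "src v = ZA" "tgt v = ZA'" using af(1-12) af'(1-12) by (auto simp: v_def)
  have "mseq (idn B \<cdot> c1) (idn A \<cdot> d1) s x'" "mseq (idn B \<cdot> c2) (idn A \<cdot> d2) s y'"
    using mseq_comp[OF c(3,1,4)] mseq_comp[OF c(3,2,5)] s m by blast+
  then have "mseq c1 d1 s x'" "mseq c2 d2 s y'" using bf af by simp_all
  then have "mseq (b1' \<cdot> c1) (a1' \<cdot> d1) s s'" "mseq (b2' \<cdot> c2) (a2' \<cdot> d2) s s'"
    using mseq_comp[OF c(3,4,6)] mseq_comp[OF c(3,5,6)] s' by blast+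
  then have "mseq u v s s'" unfolding u_def v_def by (rule mseq_add[OF c(3,6)])
  then have uv: "psh u (cls s) = pll (cls s') v" using push_eq_pull s s' by blast
  have cl: "cls s \<in> EE (Suc t) ZA ZB" "cls s' \<in> EE (Suc t) ZA' ZB'" using s s' by (auto simp: Ext_carrier)
  have va: "v \<cdot> (a1 \<boxplus> a2) = a1' \<boxplus> a2'" unfolding v_def using af af' by simp
  have cu: "(c1' \<boxplus> c2') \<cdot> u = c1 \<boxplus> c2" unfolding u_def using bf bf'
     biproduct_comp[OF b(3), of c1] biproduct_comp[OF b(3), of c2] by simp
  have a: "a1 \<boxplus> a2 \<in> Arr \<A>" "src (a1 \<boxplus> a2) = A" "tgt (a1 \<boxplus> a2) = ZA" using af by simp_all
  have c': "c1' \<boxplus> c2' \<in> Arr \<A>" "src (c1' \<boxplus> c2') = ZB'" "tgt (c1' \<boxplus> c2') = B" using bf' by simp_all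
  have "psh (c1' \<boxplus> c2') (pll (cls s') (a1' \<boxplus> a2')) =
      psh (c1' \<boxplus> c2') (pll (pll (cls s') v) (a1 \<boxplus> a2))"
    using pull_pull[OF cl(2) v C(3) a C(1)] va by simp
  also have "\<dots> = psh (c1' \<boxplus> c2') (psh u (pll (cls s) (a1 \<boxplus> a2)))"
    using push_pull[OF cl(1) u C(6) a C(1)] uv by simp
  also have "\<dots> = psh (c1 \<boxplus> c2) (pll (cls s) (a1 \<boxplus> a2))"
    using push_push[OF pull_closed[OF cl(1) a C(1)] u C(6) c' C(2)] cu by simp
  finally show ?thesis by simp
qed

lemma baer_sum_cls:
  assumes s: "is_dsum t B A x y s ZB b1 b2 c1 c2 ZA a1 a2 d1 d2"
  shows "baer_sum \<A> \<C> (cls x) (cls y) = psh (c1 \<boxplus> c2) (pll (cls s) (a1 \<boxplus> a2))" (is "_ = ?V")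
proof -
  \<comment> \<open>Collecting all values in a set lets \<open>cls_eq_invariant\<close> be applied
    to one summand at a time.\<close>
  define V where "V x y = {psh (c1 \<boxplus> c2) (pll (cls s) (a1 \<boxplus> a2)) |
     s ZB b1 b2 c1 c2 ZA a1 a2 d1 d2. is_dsum t B A x y s ZB b1 b2 c1 c2 ZA a1 a2 d1 d2}" for x y
  have ne: "V u v \<noteq> {}" if uv: "u \<in> Ch (Suc t) B A" "v \<in> Ch (Suc t) B A" for u v
  proof -
    obtain s ZB b1 b2 c1 c2 ZA a1 a2 d1 d2 where "is_dsum t B A u v s ZB b1 b2 c1 c2 ZA a1 a2 d1 d2"
      using dsum_exists[OF uv] .
    then have "psh (c1 \<boxplus> c2) (pll (cls s) (a1 \<boxplus> a2)) \<in> V u v" unfolding V_def by blast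
    then show ?thesis by blast
  qed
  have one: "V x y = V x' y'"
    if xx: "x \<in> Ch (Suc t) B A" "x' \<in> Ch (Suc t) B A" "mseq (idn B) (idn A) x x'"
      "y \<in> Ch (Suc t) B A" "y' \<in> Ch (Suc t) B A" "mseq (idn B) (idn A) y y'" for x y x' y'
  proof -
    have "v = v'" if vv: "v \<in> V x y" "v' \<in> V x' y'" for v v'
    proof -
      obtain s ZB b1 b2 c1 c2 ZA a1 a2 d1 d2 where v: "v = psh (c1 \<boxplus> c2) (pll (cls s) (a1 \<boxplus> a2))"
        "is_dsum t B A x y s ZB b1 b2 c1 c2 ZA a1 a2 d1 d2" using vv(1) unfolding V_def by blast
      obtain s' ZB' b1' b2' c1' c2' ZA' a1' a2' d1' d2' where
        v': "v' = psh (c1' \<boxplus> c2') (pll (cls s') (a1' \<boxplus> a2'))"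
        "is_dsum t B A x' y' s' ZB' b1' b2' c1' c2' ZA' a1' a2' d1' d2'" using vv(2) unfolding V_def by blast
      show ?thesis unfolding v(1) v'(1) by (rule dsum_independent[OF v(2) v'(2) xx(3,6)])
    qed
    moreover have "V x y \<noteq> {}" "V x' y' \<noteq> {}" using ne xx by blast+
    ultimately show ?thesis by blast
  qed
  have idm: "mseq (idn B) (idn A) u u" if "u \<in> Ch (Suc t) B A" for u
    using that mseq_id by (auto simp: Ch_def)
  have xy: "x \<in> Ch (Suc t) B A" "y \<in> Ch (Suc t) B A" using s by (auto simp: is_dsum_def)
  have V: "V x y = {?V}"
    using dsum_independent[OF s _ idm idm] xy s unfolding V_def by blast
  have inv: "V x' y' = {?V}" if xy': "x' \<in> Ch (Suc t) B A" "cls x' = cls x" "y' \<in> Ch (Suc t) B A" "cls y' = cls y" for x' y'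
  proof -
    have "V x y = V x' y"
      using cls_eq_invariant[OF xy(1) xy'(1), of "\<lambda>x. V x y"] one idm xy xy' by metis
    also have "\<dots> = V x' y'"
      using cls_eq_invariant[OF xy(2) xy'(3), of "\<lambda>y. V x' y"] one idm xy xy' by metis
    finally show ?thesis using V by simp
  qed
  define W where "W E E' = {psh (p1 0 \<boxplus> p2 0)
          (pll (ext_class \<A> \<C> S) (i1 (length E) \<boxplus> i2 (length E))) | S i1 i2 p1 p2.
        direct_sum_seq \<A> E E' S i1 i2 p1 p2}" for E E'
  have W: "W E E' = {?V}" if E: "E \<in> cls x" "E' \<in> cls y" for E E'
  proof -
    obtain x' where x': "x' \<in> Ch (Suc t) B A" "E = spl x'" "cls x' = cls x"
      using ext_class_mem[OF xy(1) E(1)] .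
    obtain y' where y': "y' \<in> Ch (Suc t) B A" "E' = spl y'" "cls y' = cls y"
      using ext_class_mem[OF xy(2) E(2)] .
    have len: "length E = Suc (Suc t)" using x' splice_length[of x'] by (cases "x' = []") (auto simp: Ch_def)
    have "w \<in> V x' y'" if wW: "w \<in> W E E'" for w
    proof -
      obtain S i1 i2 p1 p2 where S: "direct_sum_seq \<A> E E' S i1 i2 p1 p2"
        "w = psh (p1 0 \<boxplus> p2 0) (pll (ext_class \<A> \<C> S) (i1 (length E) \<boxplus> i2 (length E)))"
        using wW unfolding W_def by blast
      obtain s' ZB' ZA' where "S = spl s'" "is_dsum t B A x' y' s' ZB' (i1 0) (i2 0) (p1 0) (p2 0)
         ZA' (i1 (Suc (Suc t))) (i2 (Suc (Suc t))) (p1 (Suc (Suc t))) (p2 (Suc (Suc t)))"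
        using direct_sum_is_dsum[OF x'(1) y'(1)] S(1) x'(2) y'(2) by metis
      then show ?thesis unfolding V_def S(2) len cls_def by blast
    qed
    then have sub: "W E E' \<subseteq> {?V}" unfolding inv[OF x'(1,3) y'(1,3)] by (rule subsetI)
    have "W E E' \<noteq> {}" using direct_sum_exists[OF x'(1) y'(1)] unfolding x'(2) y'(2) W_def by blast
    then show ?thesis using sub by (metis subset_singletonD)
  qed
  have "baer_sum \<A> \<C> (cls x) (cls y) = (\<Union>E \<in> cls x. \<Union>E' \<in> cls y. \<Union>(W E E'))"
    unfolding baer_sum_def W_def by blast
  also have "\<dots> = ?V"
  proof -
    have "spl x \<in> cls x" "spl y \<in> cls y" by (simp_all add: cls_def ext_class_def)
    then show ?thesis using W by auto
  qed
  finally show ?thesis .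
qed

abbreviation bsum (infixl "\<uplus>" 65) where "\<gamma> \<uplus> \<gamma>' \<equiv> baer_sum \<A> \<C> \<gamma> \<gamma>'"

text \<open>This turns the group laws of \<open>Ext\<close> into laws for the addition of arrows.\<close>

lemma joint_class:
  assumes "\<gamma> \<in> EE (Suc t) A B" "\<gamma>' \<in> EE (Suc t) A B"
  obtains T Z g1 g2 where "T \<in> EE (Suc t) A Z" "g1 \<in> Arr \<A>" "src g1 = Z" "tgt g1 = B"
    "g2 \<in> Arr \<A>" "src g2 = Z" "tgt g2 = B" "Z \<in> \<C>"
    "psh g1 T = \<gamma>" "psh g2 T = \<gamma>'"
proof -
  obtain x where x: "x \<in> Ch (Suc t) B A" "\<gamma> = cls x" using Ext_classE[OF assms(1)] .
  obtain y where y: "y \<in> Ch (Suc t) B A" "\<gamma>' = cls y" using Ext_classE[OF assms(2)] .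
  obtain s ZB b1 b2 c1 c2 ZA a1 a2 d1 d2 where s: "is_dsum t B A x y s ZB b1 b2 c1 c2 ZA a1 a2 d1 d2"
    using dsum_exists[OF x(1) y(1)] .
  note s = s[unfolded is_dsum_def]
  have b: "biproduct \<A> B B ZB b1 b2 c1 c2" "biproduct \<A> A A ZA a1 a2 d1 d2" using s by auto
  note bf = biproduct_facts[OF b(1)] and af = biproduct_facts[OF b(2)]
  have C: "A \<in> \<C>" "B \<in> \<C>" "ZA \<in> \<C>" "ZB \<in> \<C>" using s Ch_C by auto
  have sc: "cls s \<in> EE (Suc t) ZA ZB" using s by (auto simp: Ext_carrier)
  have a: "a1 \<boxplus> a2 \<in> Arr \<A>" "src (a1 \<boxplus> a2) = A" "tgt (a1 \<boxplus> a2) = ZA" using af by simp_all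
  have p: "psh c1 (cls s) = pll (cls x) d1" "psh c2 (cls s) = pll (cls y) d2"
    using push_eq_pull s by blast+
  \<comment> \<open>The joint class is the direct sum pulled back along the diagonal. Pushing out
    along a projection on the left becomes pulling back along the projection on the right, which
    undoes the diagonal.\<close>
  have "psh c1 (pll (cls s) (a1 \<boxplus> a2)) = pll (pll \<gamma> d1) (a1 \<boxplus> a2)"
    using push_pull[OF sc bf(3,9,10) C(2) a C(1)] p x by simp
  also have "\<dots> = \<gamma>"
    using pull_pull[OF assms(1) af(3,9,10) C(3) a C(1)] af pull_ident[OF assms(1)] by simp
  finally have 1: "psh c1 (pll (cls s) (a1 \<boxplus> a2)) = \<gamma>" .
  have "psh c2 (pll (cls s) (a1 \<boxplus> a2)) = pll (pll \<gamma>' d2) (a1 \<boxplus> a2)"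
    using push_pull[OF sc bf(4,11,12) C(2) a C(1)] p y by simp
  also have "\<dots> = \<gamma>'"
    using pull_pull[OF assms(2) af(4,11,12) C(3) a C(1)] af pull_ident[OF assms(2)] by simp
  finally have 2: "psh c2 (pll (cls s) (a1 \<boxplus> a2)) = \<gamma>'" .
  show thesis by (rule that[OF pull_closed[OF sc a C(1)] bf(3,9,10,4,11,12) C(4) 1 2])
qed

text \<open>The arrow with components \<open>g1\<close>, \<open>g2\<close> on the left and the
  diagonal on the right form a morphism from \<open>x\<close> to the direct sum of its two
  push-outs. So the diagonal pull-back in the Baer sum is a push-out of \<open>x\<close>, and the
  codiagonal turns it into \<open>g1 + g2\<close>.\<close>

lemma push_plus:
  assumes \<gamma>: "\<gamma> \<in> EE (Suc t) A B" and g: "g1 \<in> Arr \<A>" "src g1 = B" "tgt g1 = B'"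
    "g2 \<in> Arr \<A>" "src g2 = B" "tgt g2 = B'" "B' \<in> \<C>"
  shows "psh (g1 \<boxplus> g2) \<gamma> = psh g1 \<gamma> \<uplus> psh g2 \<gamma>"
proof -
  obtain x where x: "x \<in> Ch (Suc t) B A" "\<gamma> = cls x" using Ext_classE[OF \<gamma>] .
  obtain x1 where x1: "x1 \<in> Ch (Suc t) B' A" "mseq g1 (idn A) x x1" using Ch_push[OF x(1) g(1-3,7)] .
  obtain x2 where x2: "x2 \<in> Ch (Suc t) B' A" "mseq g2 (idn A) x x2" using Ch_push[OF x(1) g(4-7)] .
  obtain s ZB b1 b2 c1 c2 ZA a1 a2 d1 d2 where s: "is_dsum t B' A x1 x2 s ZB b1 b2 c1 c2 ZA a1 a2 d1 d2"
    using dsum_exists[OF x1(1) x2(1)] .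
  note sf = s[unfolded is_dsum_def]
  have b: "biproduct \<A> B' B' ZB b1 b2 c1 c2" "biproduct \<A> A A ZA a1 a2 d1 d2" using sf by auto
  note bf = biproduct_facts[OF b(1)] and af = biproduct_facts[OF b(2)]
  have C: "A \<in> \<C>" "B \<in> \<C>" "ZA \<in> \<C>" "ZB \<in> \<C>" using sf x Ch_C by auto
  have c: "chain B A x" "chain B' A x1" "chain B' A x2" "chain ZB ZA s" using x x1 x2 sf by (auto simp: Ch_def)
  have "mseq (b1 \<cdot> g1) (a1 \<cdot> idn A) x s" "mseq (b2 \<cdot> g2) (a2 \<cdot> idn A) x s"
    using mseq_comp[OF c(1,2,4) x1(2)] mseq_comp[OF c(1,3,4) x2(2)] sf by blast+
  from mseq_add[OF c(1,4) this] have "mseq (b1 \<cdot> g1 \<boxplus> b2 \<cdot> g2) (a1 \<boxplus> a2) x s" using af by simp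
  then have p: "psh (b1 \<cdot> g1 \<boxplus> b2 \<cdot> g2) (cls x) = pll (cls s) (a1 \<boxplus> a2)"
    using push_eq_pull[OF x(1)] sf by blast
  have u: "b1 \<cdot> g1 \<boxplus> b2 \<cdot> g2 \<in> Arr \<A>" "src (b1 \<cdot> g1 \<boxplus> b2 \<cdot> g2) = B" "tgt (b1 \<cdot> g1 \<boxplus> b2 \<cdot> g2) = ZB"
    and v: "c1 \<boxplus> c2 \<in> Arr \<A>" "src (c1 \<boxplus> c2) = ZB" "tgt (c1 \<boxplus> c2) = B'"
    using bf g by simp_all
  have vu: "(c1 \<boxplus> c2) \<cdot> (b1 \<cdot> g1 \<boxplus> b2 \<cdot> g2) = g1 \<boxplus> g2"
    using bf g C biproduct_comp[OF b(1), of g1] biproduct_comp[OF b(1), of g2] by simp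
  have "psh g1 \<gamma> \<uplus> psh g2 \<gamma> = psh (c1 \<boxplus> c2) (psh (b1 \<cdot> g1 \<boxplus> b2 \<cdot> g2) \<gamma>)"
    using baer_sum_cls[OF s] push_cls[OF x(1) x1] push_cls[OF x(1) x2] p x by simp
  also have "\<dots> = psh (g1 \<boxplus> g2) \<gamma>" using push_push[OF \<gamma> u C(4) v g(7)] vu by simp
  finally show ?thesis by simp
qed

text \<open>Mirror image: the codiagonal on the left and \<open>h1\<close>, \<open>h2\<close> after
  the projections on the right form a morphism from the direct sum to \<open>x\<close>.\<close>

lemma pull_plus:
  assumes \<gamma>: "\<gamma> \<in> EE (Suc t) A B" and h: "h1 \<in> Arr \<A>" "src h1 = A'" "tgt h1 = A"
    "h2 \<in> Arr \<A>" "src h2 = A'" "tgt h2 = A" "A' \<in> \<C>"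
  shows "pll \<gamma> (h1 \<boxplus> h2) = pll \<gamma> h1 \<uplus> pll \<gamma> h2"
proof -
  obtain x where x: "x \<in> Ch (Suc t) B A" "\<gamma> = cls x" using Ext_classE[OF \<gamma>] .
  obtain x1 where x1: "x1 \<in> Ch (Suc t) B A'" "mseq (idn B) h1 x1 x" using Ch_pull[OF x(1) h(1-3,7)] .
  obtain x2 where x2: "x2 \<in> Ch (Suc t) B A'" "mseq (idn B) h2 x2 x" using Ch_pull[OF x(1) h(4-7)] .
  obtain s ZB b1 b2 c1 c2 ZA a1 a2 d1 d2 where s: "is_dsum t B A' x1 x2 s ZB b1 b2 c1 c2 ZA a1 a2 d1 d2"
    using dsum_exists[OF x1(1) x2(1)] .
  note sf = s[unfolded is_dsum_def]
  have b: "biproduct \<A> B B ZB b1 b2 c1 c2" "biproduct \<A> A' A' ZA a1 a2 d1 d2" using sf by auto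
  note bf = biproduct_facts[OF b(1)] and af = biproduct_facts[OF b(2)]
  have C: "A \<in> \<C>" "B \<in> \<C>" "ZA \<in> \<C>" "ZB \<in> \<C>" using sf x Ch_C by auto
  have c: "chain B A x" "chain B A' x1" "chain B A' x2" "chain ZB ZA s" using x x1 x2 sf by (auto simp: Ch_def)
  have "mseq (idn B \<cdot> c1) (h1 \<cdot> d1) s x" "mseq (idn B \<cdot> c2) (h2 \<cdot> d2) s x"
    using mseq_comp[OF c(4,2,1) _ x1(2)] mseq_comp[OF c(4,3,1) _ x2(2)] sf by blast+
  from mseq_add[OF c(4,1) this] have "mseq (c1 \<boxplus> c2) (h1 \<cdot> d1 \<boxplus> h2 \<cdot> d2) s x" using bf by simp
  then have p: "psh (c1 \<boxplus> c2) (cls s) = pll (cls x) (h1 \<cdot> d1 \<boxplus> h2 \<cdot> d2)"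
    using push_eq_pull x(1) sf by blast
  have sc: "cls s \<in> EE (Suc t) ZA ZB" using sf by (auto simp: Ext_carrier)
  have u: "h1 \<cdot> d1 \<boxplus> h2 \<cdot> d2 \<in> Arr \<A>" "src (h1 \<cdot> d1 \<boxplus> h2 \<cdot> d2) = ZA" "tgt (h1 \<cdot> d1 \<boxplus> h2 \<cdot> d2) = A"
    and a: "a1 \<boxplus> a2 \<in> Arr \<A>" "src (a1 \<boxplus> a2) = A'" "tgt (a1 \<boxplus> a2) = ZA"
    and v: "c1 \<boxplus> c2 \<in> Arr \<A>" "src (c1 \<boxplus> c2) = ZB" "tgt (c1 \<boxplus> c2) = B"
    using af bf h by simp_all
  have ua: "(h1 \<cdot> d1 \<boxplus> h2 \<cdot> d2) \<cdot> (a1 \<boxplus> a2) = h1 \<boxplus> h2"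
    using af h C by simp
  have "pll \<gamma> h1 \<uplus> pll \<gamma> h2 = psh (c1 \<boxplus> c2) (pll (cls s) (a1 \<boxplus> a2))"
    using baer_sum_cls[OF s] pull_cls[OF x(1) x1] pull_cls[OF x(1) x2] x by simp
  also have "\<dots> = pll (pll (cls x) (h1 \<cdot> d1 \<boxplus> h2 \<cdot> d2)) (a1 \<boxplus> a2)"
    using push_pull[OF sc v C(2) a h(7)] p by simp
  also have "\<dots> = pll \<gamma> (h1 \<boxplus> h2)" using pull_pull[OF \<gamma> u C(3) a h(7)] ua x by simp
  finally show ?thesis by simp
qed

lemma sum_closed:
  assumes "\<gamma> \<in> EE (Suc t) A B" "\<gamma>' \<in> EE (Suc t) A B"
  shows "\<gamma> \<uplus> \<gamma>' \<in> EE (Suc t) A B"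
proof -
  obtain T Z g1 g2 where T: "T \<in> EE (Suc t) A Z" "g1 \<in> Arr \<A>" "src g1 = Z" "tgt g1 = B"
    "g2 \<in> Arr \<A>" "src g2 = Z" "tgt g2 = B" "Z \<in> \<C>" "psh g1 T = \<gamma>" "psh g2 T = \<gamma>'"
    using joint_class[OF assms] .
  have "psh (g1 \<boxplus> g2) T \<in> EE (Suc t) A B"
    by (rule push_closed[OF T(1)]) (use T Ext_class_ends[OF assms(1)] in auto)
  then show ?thesis using push_plus[OF T(1-7)] T Ext_class_ends[OF assms(1)] by simp
qed

lemma push_sum:
  assumes \<gamma>: "\<gamma> \<in> EE (Suc t) A B" "\<gamma>' \<in> EE (Suc t) A B" and g: "g \<in> Arr \<A>" "src g = B" "tgt g = B'" "B' \<in> \<C>"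
  shows "psh g (\<gamma> \<uplus> \<gamma>') = psh g \<gamma> \<uplus> psh g \<gamma>'"
proof -
  obtain T Z g1 g2 where T: "T \<in> EE (Suc t) A Z" "g1 \<in> Arr \<A>" "src g1 = Z" "tgt g1 = B"
    "g2 \<in> Arr \<A>" "src g2 = Z" "tgt g2 = B" "Z \<in> \<C>" "psh g1 T = \<gamma>" "psh g2 T = \<gamma>'"
    using joint_class[OF \<gamma>] .
  have B: "B \<in> \<C>" using Ext_class_ends[OF \<gamma>(1)] by simp
  have "psh g (\<gamma> \<uplus> \<gamma>') = psh g (psh (g1 \<boxplus> g2) T)"
    using push_plus[OF T(1-7) B] T by simp
  also have "\<dots> = psh (g \<cdot> g1 \<boxplus> g \<cdot> g2) T"
    using push_push[OF T(1), of "g1 \<boxplus> g2" B g B'] T g B by simp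
  also have "\<dots> = psh (g \<cdot> g1) T \<uplus> psh (g \<cdot> g2) T"
    by (rule push_plus[OF T(1), where B' = B']) (use T g in auto)
  also have "\<dots> = psh g \<gamma> \<uplus> psh g \<gamma>'"
    using push_push[OF T(1-4) B g] push_push[OF T(1,5-7) B g] T by simp
  finally show ?thesis .
qed

lemma pull_sum:
  assumes \<gamma>: "\<gamma> \<in> EE (Suc t) A B" "\<gamma>' \<in> EE (Suc t) A B" and h: "h \<in> Arr \<A>" "src h = A'" "tgt h = A" "A' \<in> \<C>"
  shows "pll (\<gamma> \<uplus> \<gamma>') h = pll \<gamma> h \<uplus> pll \<gamma>' h"
proof -
  obtain T Z g1 g2 where T: "T \<in> EE (Suc t) A Z" "g1 \<in> Arr \<A>" "src g1 = Z" "tgt g1 = B"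
    "g2 \<in> Arr \<A>" "src g2 = Z" "tgt g2 = B" "Z \<in> \<C>" "psh g1 T = \<gamma>" "psh g2 T = \<gamma>'"
    using joint_class[OF \<gamma>] .
  have B: "B \<in> \<C>" using Ext_class_ends[OF \<gamma>(1)] by simp
  have "pll (\<gamma> \<uplus> \<gamma>') h = psh (g1 \<boxplus> g2) (pll T h)"
    using push_plus[OF T(1-7) B] push_pull[OF T(1), of "g1 \<boxplus> g2" B h A'] T B h by simp
  also have "\<dots> = psh g1 (pll T h) \<uplus> psh g2 (pll T h)"
    by (rule push_plus[OF pull_closed[OF T(1) h] T(2-7) B])
  also have "\<dots> = pll \<gamma> h \<uplus> pll \<gamma>' h"
    using push_pull[OF T(1-4) B h] push_pull[OF T(1,5-7) B h] T by simp
  finally show ?thesis .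
qed

lemma sum_comm:
  assumes "\<gamma> \<in> EE (Suc t) A B" "\<gamma>' \<in> EE (Suc t) A B"
  shows "\<gamma> \<uplus> \<gamma>' = \<gamma>' \<uplus> \<gamma>"
proof -
  obtain T Z g1 g2 where T: "T \<in> EE (Suc t) A Z" "g1 \<in> Arr \<A>" "src g1 = Z" "tgt g1 = B"
    "g2 \<in> Arr \<A>" "src g2 = Z" "tgt g2 = B" "Z \<in> \<C>" "psh g1 T = \<gamma>" "psh g2 T = \<gamma>'"
    using joint_class[OF assms] .
  have "B \<in> \<C>" using Ext_class_ends[OF assms(1)] by simp
  then show ?thesis
    using push_plus[OF T(1-7)] push_plus[OF T(1,5-7,2-4)] plus_comm[of g1 g2] T by simp
qed

lemma sum_assoc:
  assumes "\<gamma>1 \<in> EE (Suc t) A B" "\<gamma>2 \<in> EE (Suc t) A B" "\<gamma>3 \<in> EE (Suc t) A B"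
  shows "(\<gamma>1 \<uplus> \<gamma>2) \<uplus> \<gamma>3 = \<gamma>1 \<uplus> (\<gamma>2 \<uplus> \<gamma>3)"
proof -
  obtain T Z g1 g2 where T: "T \<in> EE (Suc t) A Z" "g1 \<in> Arr \<A>" "src g1 = Z" "tgt g1 = B"
    "g2 \<in> Arr \<A>" "src g2 = Z" "tgt g2 = B" "Z \<in> \<C>" "psh g1 T = \<gamma>1" "psh g2 T = \<gamma>2"
    using joint_class[OF assms(1,2)] .
  have B: "B \<in> \<C>" using Ext_class_ends[OF assms(1)] by simp
  \<comment> \<open>A joint class exists for two classes with the same left end; to treat three,
    \<open>T\<close> and \<open>\<gamma>3\<close> are first moved into the biproduct of
    \<open>Z\<close> and \<open>B\<close>.\<close>
  obtain z b1 b2 c1 c2 where bp: "biproduct \<A> Z B z b1 b2 c1 c2" "z \<in> \<C>" using biproduct_in T(8) B by blast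
  note bf = biproduct_facts[OF bp(1)]
  have T1: "psh b1 T \<in> EE (Suc t) A z" by (rule push_closed[OF T(1)]) (use bf bp in auto)
  have T2: "psh b2 \<gamma>3 \<in> EE (Suc t) A z" by (rule push_closed[OF assms(3)]) (use bf bp in auto)
  obtain U W u1 u2 where U: "U \<in> EE (Suc t) A W" "u1 \<in> Arr \<A>" "src u1 = W" "tgt u1 = z"
    "u2 \<in> Arr \<A>" "src u2 = W" "tgt u2 = z" "W \<in> \<C>" "psh u1 U = psh b1 T" "psh u2 U = psh b2 \<gamma>3"
    using joint_class[OF T1 T2] .
  have t: "psh (g \<cdot> (c1 \<cdot> u1)) U = psh g T" if g: "g \<in> Arr \<A>" "src g = Z" "tgt g = B" for g
  proof -
    have "psh (g \<cdot> (c1 \<cdot> u1)) U = psh (g \<cdot> c1) (psh u1 U)"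
      using push_push[OF U(1-4) bp(2), of "g \<cdot> c1" B] g bf U B by simp
    also have "\<dots> = psh ((g \<cdot> c1) \<cdot> b1) T"
      unfolding U(9) using push_push[OF T(1), of b1 z "g \<cdot> c1" B] g bf bp B by simp
    also have "\<dots> = psh g T" using g bf by simp
    finally show ?thesis .
  qed
  have u: "psh (c2 \<cdot> u2) U = \<gamma>3"
  proof -
    have "psh (c2 \<cdot> u2) U = psh c2 (psh u2 U)"
      using push_push[OF U(1,5-7) bp(2), of c2 B] bf U B by simp
    also have "\<dots> = psh (c2 \<cdot> b2) \<gamma>3"
      unfolding U(10) using push_push[OF assms(3), of b2 z c2 B] bf bp B by simp
    also have "\<dots> = \<gamma>3" using push_ident[OF assms(3)] bf by simp
    finally show ?thesis .
  qed
  define f1 where "f1 = g1 \<cdot> (c1 \<cdot> u1)" define f2 where "f2 = g2 \<cdot> (c1 \<cdot> u1)" define f3 where "f3 = c2 \<cdot> u2"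
  have f: "f1 \<in> Arr \<A>" "src f1 = W" "tgt f1 = B" "f2 \<in> Arr \<A>" "src f2 = W" "tgt f2 = B"
    "f3 \<in> Arr \<A>" "src f3 = W" "tgt f3 = B" using T U bf by (simp_all add: f1_def f2_def f3_def)
  have p: "psh f1 U = \<gamma>1" "psh f2 U = \<gamma>2" "psh f3 U = \<gamma>3"
    using t[of g1] t[of g2] u T by (simp_all add: f1_def f2_def f3_def)
  have s: "f1 \<boxplus> f2 \<in> Arr \<A>" "src (f1 \<boxplus> f2) = W" "tgt (f1 \<boxplus> f2) = B"
    "f2 \<boxplus> f3 \<in> Arr \<A>" "src (f2 \<boxplus> f3) = W" "tgt (f2 \<boxplus> f3) = B" using f by simp_all
  have "(\<gamma>1 \<uplus> \<gamma>2) \<uplus> \<gamma>3 = psh ((f1 \<boxplus> f2) \<boxplus> f3) U"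
    using push_plus[OF U(1) f(1-6) B] push_plus[OF U(1) s(1-3) f(7-9) B] p by simp
  also have "\<dots> = \<gamma>1 \<uplus> (\<gamma>2 \<uplus> \<gamma>3)"
    using push_plus[OF U(1) f(4-9) B] push_plus[OF U(1) f(1-3) s(4-6) B] p f by simp
  finally show ?thesis .
qed

section \<open>The neutral element and the group laws\<close>

text \<open>With parameter \<open>t\<close> the chain has \<open>Suc t\<close> conflations. It
  receives a morphism from every chain of that length ending at \<open>A\<close>, so it can serve as
  the common source of all zero classes.\<close>

primrec zero_chain :: "'o \<Rightarrow> nat \<Rightarrow> ('a \<times> 'a) list" where
  "zero_chain A 0 = [(nul zero_obj A, idn A)]"
| "zero_chain A (Suc t) = (nul zero_obj zero_obj, idn zero_obj) # zero_chain A t"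

lemma zero_chain_Ch: "A \<in> \<C> \<Longrightarrow> zero_chain A t \<in> Ch (Suc t) zero_obj A"
  by (induction t) (use zero_obj conf_zero_left[of _ zero_obj] in \<open>auto simp: Ch_def\<close>)

lemma mseq_zero_chain: "x \<in> Ch (Suc t) B A \<Longrightarrow> mseq (nul B zero_obj) (idn A) x (zero_chain A t)"
proof (induction t arbitrary: x B)
  case 0
  then obtain e where "x = [e]" "conf B A e" by (cases x) (auto simp: Ch_def)
  moreover obtain i p where "e = (i, p)" by (cases e)
  ultimately have x: "x = [(i, p)]" "conf B A (i, p)" by auto
  note f = conf_facts[OF x(2)]
  have "cmor (i, p) (nul zero_obj A, idn A) (nul B zero_obj) (idn A)"
    by (rule cmorI[of p]) (use f zero_obj(1) in auto)
  then show ?case unfolding x by simp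
next
  case (Suc t)
  then obtain i p es K where x: "x = (i, p) # es" "conf B K (i, p)" "es \<in> Ch (Suc t) K A"
    by (metis Ch_SucE surj_pair)
  note f = conf_facts[OF x(2)]
  have "cmor (i, p) (nul zero_obj zero_obj, idn zero_obj) (nul B zero_obj) (nul K zero_obj)"
    by (rule cmorI[of "nul (tgt i) zero_obj"]) (use f zero_obj(1) in auto)
  then show ?case unfolding x using Suc.IH[OF x(3)] by auto
qed

text \<open>The index is one less than the degree: \<open>zero_class t\<close> belongs to degree
  \<open>Suc t\<close>. Being a push-out, it behaves well under the operations before it is
  identified with \<open>ext_zero\<close>.\<close>

definition zero_class :: "nat \<Rightarrow> 'o \<Rightarrow> 'o \<Rightarrow> 'a list set" where
  "zero_class t A B = psh (nul zero_obj B) (cls (zero_chain A t))"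

text \<open>A zero arrow factors through \<open>zero_obj\<close>, and pushing any chain out to
  \<open>zero_obj\<close> gives the class of \<open>zero_chain\<close>; so nothing of \<gamma> but
  its right end survives.\<close>

lemma push_zero:
  assumes "\<gamma> \<in> EE (Suc t) A B" "B' \<in> \<C>"
  shows "psh (nul B B') \<gamma> = zero_class t A B'"
proof -
  have C: "A \<in> \<C>" "B \<in> \<C>" using Ext_class_ends[OF assms(1)] by auto
  obtain x where x: "x \<in> Ch (Suc t) B A" "\<gamma> = cls x" using Ext_classE[OF assms(1)] .
  have "psh (nul B zero_obj) \<gamma> = cls (zero_chain A t)"
    using push_cls[OF x(1) zero_chain_Ch[OF C(1)] mseq_zero_chain[OF x(1)]] x by simp
  moreover have "psh (nul zero_obj B') (psh (nul B zero_obj) \<gamma>) = psh (nul B B') \<gamma>"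
    using push_push[OF assms(1), of "nul B zero_obj" zero_obj "nul zero_obj B'" B'] zero_obj C assms(2) by simp
  ultimately show ?thesis by (simp add: zero_class_def)
qed

lemma zero_class_closed:
  assumes "A \<in> \<C>" "B \<in> \<C>" shows "zero_class t A B \<in> EE (Suc t) A B"
  unfolding zero_class_def
  by (rule push_closed[of _ t A zero_obj]) (use zero_chain_Ch[OF assms(1)] zero_obj assms in \<open>auto simp: Ext_carrier\<close>)

text \<open>A section of the first deflation gives a morphism to \<open>e\<close> from the
  conflation \<open>0 -> K = K\<close>, so the whole class is a push-out of one with left end
  \<open>zero_obj\<close>.\<close>

lemma cls_split_head:
  assumes x: "e # es \<in> Ch (Suc t) B A" and s: "split_conf e"
  shows "cls (e # es) = zero_class t A B"
proof -
  obtain K where e: "conf B K e" "es \<in> Ch t K A" using x by (auto simp: Ch_Suc)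
  obtain i p where ip: "e = (i, p)" by (cases e)
  note ef = conf_facts[OF e(1)[unfolded ip]]
  obtain s where s: "s \<in> Arr \<A>" "src s = K" "tgt s = tgt i" "p \<cdot> s = idn K"
    using split_conf_section[OF assms(2)[unfolded ip] e(1)[unfolded ip]] .
  let ?z = "(nul zero_obj K, idn K)"
  have z: "conf zero_obj K ?z" using conf_zero_left[of K zero_obj] zero_obj ef by auto
  have "cmor ?z e (nul zero_obj B) (idn K)" unfolding ip
    by (rule cmorI[of s]) (use s ef zero_obj(1) in auto)
  then have "mseq (nul zero_obj B) (idn A) (?z # es) (e # es)" using e mseq_id by (auto simp: Ch_def)
  moreover have zc: "?z # es \<in> Ch (Suc t) zero_obj A" using z e by (auto simp: Ch_Suc)
  ultimately have "cls (e # es) = psh (nul zero_obj B) (cls (?z # es))" using push_cls[OF zc x] by simp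
  then show ?thesis using push_zero[of "cls (?z # es)" t A zero_obj B] zc Ch_C[OF x] by (auto simp: Ext_carrier)
qed

text \<open>Guarantees that the union in \<open>ext_zero\<close> is not empty. It also supplies the
  comparison chain from which invariance arguments about zero classes start.\<close>

lemma all_split_exists:
  assumes "A \<in> \<C>" "B \<in> \<C>"
  shows "\<exists>x \<in> Ch (Suc t) B A. \<forall>e \<in> set x. split_conf e"
proof -
  have z: "\<forall>e \<in> set (zero_chain A t). split_conf e"
  proof (induction t)
    case 0
    have "nul A zero_obj \<cdot> nul zero_obj A = idn zero_obj"
      using to_zero_object[OF zero_obj(2), of "idn zero_obj"] zero_obj(1) assms by simp
    then have "split_conf (nul zero_obj A, idn A)"
      unfolding split_conf_def by (intro bexI[of _ "nul A zero_obj"]) (use zero_obj(1) assms in simp_all)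
    then show ?case by simp
  next
    case (Suc t)
    have "nul zero_obj zero_obj \<cdot> nul zero_obj zero_obj = idn zero_obj"
      using to_zero_object[OF zero_obj(2), of "idn zero_obj"] zero_obj(1) assms by simp
    then show ?case using Suc zero_obj(1) by (auto simp: split_conf_def intro!: bexI[of _ "nul zero_obj zero_obj"])
  qed
  show ?thesis
  proof (cases t)
    case 0
    obtain Z i1 i2 p1 p2 where b: "biproduct \<A> B A Z i1 i2 p1 p2" using biproduct_exists[of B A] assms by auto
    note bf = biproduct_facts[OF b]
    have "split_conf (i1, p2)" using bf by (auto simp: split_conf_def intro!: bexI[of _ p1])
    then show ?thesis using biproduct_conf[OF b assms(2,1)] assms 0 by (intro bexI[of _ "[(i1, p2)]"]) (auto simp: Ch_def)
  next
    case (Suc t')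
    let ?e = "(idn B, nul B zero_obj)"
    have "conf B zero_obj ?e" using conf_zero_right[of B zero_obj] zero_obj assms by auto
    moreover have "split_conf ?e" using assms by (auto simp: split_conf_def intro!: bexI[of _ "idn B"])
    moreover have "\<forall>e \<in> set (zero_chain A t'). split_conf e" using z Suc by simp
    ultimately show ?thesis using zero_chain_Ch[OF assms(1), of t'] unfolding Suc
      by (intro bexI[of _ "?e # zero_chain A t'"]) (auto simp: Ch_def)
  qed
qed

lemma ext_zero_eq:
  assumes "A \<in> \<C>" "B \<in> \<C>"
  shows "ext_zero \<A> \<C> (Suc t) A B = zero_class t A B"
proof -
  have iff: "x \<in> Ch (Suc t) B A \<and> (\<forall>e \<in> set x. split_conf e) \<longleftrightarrow> spliceable \<A> \<C> x \<and> length x = Suc t \<and>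
     src (fst (hd x)) = B \<and> tgt (snd (last x)) = A \<and>
     (\<forall>(i, p) \<in> set x. \<exists>r \<in> Hom \<A> (tgt i) (src i). r \<cdot> i = idn (src i))" for x
    using spliceable_iff_chain[of x B A]
    by (cases "x = []") (auto simp: Ch_def split_conf_def case_prod_beta simp del: mem_Hom)
  have "ext_zero \<A> \<C> (Suc t) A B = \<Union>{cls x | x. x \<in> Ch (Suc t) B A \<and> (\<forall>e \<in> set x. split_conf e)}"
    unfolding ext_zero_def cls_def iff by simp
  moreover have "cls x = zero_class t A B" if sp: "x \<in> Ch (Suc t) B A" "\<forall>e \<in> set x. split_conf e" for x
  proof -
    obtain e es where "x = e # es" using sp(1) by (cases x) (auto simp: Ch_def)
    then show ?thesis using sp cls_split_head[of e es t B A] by simp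
  qed
  then have "{cls x | x. x \<in> Ch (Suc t) B A \<and> (\<forall>e \<in> set x. split_conf e)} = {zero_class t A B}"
    using all_split_exists[OF assms, of t] by auto
  ultimately show ?thesis by simp
qed

lemma Ext_simps:
  "mult (EXT t A B) = baer_sum \<A> \<C>"
  "A \<in> \<C> \<Longrightarrow> B \<in> \<C> \<Longrightarrow> one (EXT (Suc t) A B) = zero_class t A B"
  by (simp_all add: Ext_def ext_zero_eq)

lemma Ext_comm_group:
  assumes "A \<in> \<C>" "B \<in> \<C>"
  shows "comm_group (EXT (Suc t) A B)"
proof -
  have B: "B \<in> Obj \<A>" using assms by simp
  have l1: "zero_class t A B \<uplus> \<gamma> = \<gamma>" if "\<gamma> \<in> EE (Suc t) A B" for \<gamma>
    using push_plus[OF that, of "nul B B" B "idn B"] push_zero[OF that assms(2)] push_ident[OF that] B assms by simp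
  \<comment> \<open>The inverse is push-out along minus the identity.\<close>
  have linv: "psh (neg (idn B)) \<gamma> \<uplus> \<gamma> = zero_class t A B" if "\<gamma> \<in> EE (Suc t) A B" for \<gamma>
    using push_plus[OF that, of "neg (idn B)" B "idn B"] push_zero[OF that assms(2)] push_ident[OF that] B assms by simp
  have cl: "psh (neg (idn B)) \<gamma> \<in> EE (Suc t) A B" if "\<gamma> \<in> EE (Suc t) A B" for \<gamma>
    using push_closed[OF that, of "neg (idn B)" B] B assms by simp
  have li: "\<exists>\<gamma>' \<in> EE (Suc t) A B. \<gamma>' \<uplus> \<gamma> = zero_class t A B" if "\<gamma> \<in> EE (Suc t) A B" for \<gamma>
    using linv[OF that] cl[OF that] by blast
  have "group (EXT (Suc t) A B)"
    by (rule groupI) (use sum_closed sum_assoc l1 li zero_class_closed[OF assms] in \<open>auto simp: Ext_simps assms\<close>)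
  then show ?thesis
    by (rule group.group_comm_groupI) (use sum_comm in \<open>auto simp: Ext_simps\<close>)
qed

lemma Ext_inv:
  assumes "\<gamma> \<in> EE (Suc t) A B"
  shows "inv\<^bsub>EXT (Suc t) A B\<^esub> \<gamma> = psh (neg (idn B)) \<gamma>"
proof -
  have C: "A \<in> \<C>" "B \<in> \<C>" using Ext_class_ends[OF assms] by auto
  interpret comm_group "EXT (Suc t) A B" by (rule Ext_comm_group[OF C])
  have "psh (neg (idn B)) \<gamma> \<uplus> \<gamma> = zero_class t A B"
    using push_plus[OF assms, of "neg (idn B)" B "idn B"] push_zero[OF assms C(2)] push_ident[OF assms] C by simp
  then show ?thesis using push_closed[OF assms, of "neg (idn B)" B] C assms
    by (intro inv_equality) (auto simp: Ext_simps)
qed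

lemma push_hom:
  assumes "g \<in> Arr \<A>" "src g = B" "tgt g = B'" "B' \<in> \<C>"
  shows "psh g \<in> hom (EXT (Suc t) A B) (EXT (Suc t) A B')"
  using assms push_closed push_sum by (auto simp: hom_def Ext_simps)

lemma push_one:
  assumes "g \<in> Arr \<A>" "src g = B" "tgt g = B'" "B' \<in> \<C>" "B \<in> \<C>" "A \<in> \<C>"
  shows "psh g (zero_class t A B) = zero_class t A B'"
proof -
  have z: "cls (zero_chain A t) \<in> EE (Suc t) A zero_obj" using zero_chain_Ch[OF assms(6)] by (auto simp: Ext_carrier)
  show ?thesis unfolding zero_class_def
    using push_push[OF z, of "nul zero_obj B" B g B'] assms zero_obj by simp
qed

lemma pull_one:
  assumes "h \<in> Arr \<A>" "src h = A'" "tgt h = A" "A' \<in> \<C>" "B \<in> \<C>" "A \<in> \<C>"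
  shows "pll (zero_class t A B) h = zero_class t A' B"
proof -
  have z: "cls (zero_chain A t) \<in> EE (Suc t) A zero_obj" using zero_chain_Ch[OF assms(6)] by (auto simp: Ext_carrier)
  have "pll (zero_class t A B) h = psh (nul zero_obj B) (pll (cls (zero_chain A t)) h)"
    unfolding zero_class_def using push_pull[OF z, of "nul zero_obj B" B h A'] assms zero_obj by simp
  then show ?thesis using push_zero[OF pull_closed[OF z assms(1-4)] assms(5)] by simp
qed

lemma Ext_classI: "x \<in> Ch (Suc t) B A \<Longrightarrow> cls x \<in> EE (Suc t) A B"
  by (simp add: Ext_carrier)

section \<open>Exactness\<close>

lemma cls_Cons_cong:
  assumes e: "conf B K e" and F: "F \<in> Ch (Suc t) K A" "F' \<in> Ch (Suc t) K A" "cls F = cls F'"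
  shows "cls (e # F) = cls (e # F')"
proof (rule cls_eq_invariant[OF F])
  fix x y assume "x \<in> Ch (Suc t) K A" "y \<in> Ch (Suc t) K A" "mseq (idn K) (idn A) x y"
  then show "cls (e # x) = cls (e # y)"
    using e cmor_id[OF e] by (intro cls_step[of _ "Suc t" B A]) (auto simp: Ch_Suc)
qed

text \<open>The sliding move: \<open>e\<close> is the pull-back of \<open>e'\<close> along
  \<open>k\<close>, and \<open>k\<close> passes from the first conflation to the rest. A single step
  suffices once \<open>F'\<close> is replaced by a push-out of \<open>F\<close> of the same
  class.\<close>

lemma cls_Cons_slide:
  assumes e: "conf B K e" "conf B K' e'" "cmor e e' (idn B) k"
    and F: "F \<in> Ch (Suc t) K A" "F' \<in> Ch (Suc t) K' A" "psh k (cls F) = cls F'"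
  shows "cls (e # F) = cls (e' # F')"
proof -
  note k = cmor_typ[OF e]
  obtain G where G: "G \<in> Ch (Suc t) K' A" "mseq k (idn A) F G" using Ch_push[OF F(1) k(4-6) conf_C(2)[OF e(2)]] .
  have "cls G = cls F'" using push_cls[OF F(1) G] F(3) by simp
  then have "cls (e' # G) = cls (e' # F')" by (rule cls_Cons_cong[OF e(2) G(1) F(2)])
  moreover have "cls (e # F) = cls (e' # G)"
    by (rule cls_step[of _ "Suc t" B A]) (use e F G in \<open>auto simp: Ch_Suc\<close>)
  ultimately show ?thesis by simp
qed

lemma push_Cons:
  assumes e: "conf B K e" "conf B' K e'" "cmor e e' g (idn K)" and F: "F \<in> Ch t K A"
  shows "psh g (cls (e # F)) = cls (e' # F)"
  by (rule push_cls[of _ t B A]) (use e F mseq_id[of K A F] in \<open>auto simp: Ch_def\<close>)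

text \<open>Splitting survives a step in either direction, since \<open>short_five\<close> reverses
  steps between single conflations; and the zero class contains a split one.\<close>

lemma split_of_cls:
  assumes e: "conf B A e" and z: "cls [e] = zero_class 0 A B"
  shows "split_conf e"
proof -
  have AB: "A \<in> \<C>" "B \<in> \<C>" using conf_C[OF e] by auto
  obtain x where x: "x \<in> Ch (Suc 0) B A" "\<forall>e \<in> set x. split_conf e" using all_split_exists[OF AB] by blast
  obtain e0 es where x0: "x = e0 # es" using x by (cases x) (auto simp: Ch_def)
  have e': "[e] \<in> Ch (Suc 0) B A" using e AB by (auto simp: Ch_def)
  have "cls [e] = cls x" using cls_split_head[of e0 es 0 B A] x z unfolding x0 by simp
  then have "split_conf (hd [e]) = split_conf (hd x)"
  proof (rule cls_eq_invariant[OF e' x(1)])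
    fix u v assume u: "u \<in> Ch (Suc 0) B A" and v: "v \<in> Ch (Suc 0) B A" and m: "mseq (idn B) (idn A) u v"
    obtain i p where u': "u = [(i, p)]" "conf B A (i, p)" using u
      by (cases u; cases "hd u") (auto simp: Ch_def)
    obtain j q where v': "v = [(j, q)]" "conf B A (j, q)" using v
      by (cases v; cases "hd v") (auto simp: Ch_def)
    have c: "cmor (i, p) (j, q) (idn B) (idn A)" using m u' v' by simp
    show "split_conf (hd u) = split_conf (hd v)"
      using split_conf_cmor[OF u'(2) v'(2) c] split_conf_cmor[OF v'(2) u'(2) short_five[OF u'(2) v'(2) c]] u' v' by auto
  qed
  then show ?thesis using x x0 by simp
qed

lemma exact_middle_0:
  assumes a: "conf A C (f, q)" "tgt f = B" and \<gamma>: "\<gamma> \<in> EE (Suc 0) X B" "psh q \<gamma> = zero_class 0 X C"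
  shows "\<exists>\<alpha> \<in> EE (Suc 0) X A. psh f \<alpha> = \<gamma>"
proof -
  note af = conf_facts[OF a(1)]
  obtain x where x: "x \<in> Ch (Suc 0) B X" "\<gamma> = cls x" using Ext_classE[OF \<gamma>(1)] .
  obtain e where e: "x = [e]" "conf B X e" using x by (cases x) (auto simp: Ch_def)
  have X: "[] \<in> Ch 0 X X" using conf_C[OF e(2)] by (simp add: Ch_def)
  obtain e1 where e1: "conf C X e1" "cmor e e1 q (idn X)"
    using push_conf[OF e(2), of q] af a(2) by auto
  have "cls [e1] = zero_class 0 X C" using push_Cons[OF e(2) e1 X] \<gamma> x e by simp
  then have "split_conf e1" by (rule split_of_cls[OF e1(1)])
  then obtain e' where e': "conf A X e'" "cmor e' e f (idn X)" using conf_lift[OF a e(2) e1] by blast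
  have "psh f (cls [e']) = \<gamma>" using push_Cons[OF e'(1) e(2) e'(2) X] x e by simp
  moreover have "cls [e'] \<in> EE (Suc 0) X A" using e'(1) conf_C[OF e'(1)] by (auto simp: Ext_carrier Ch_def)
  ultimately show ?thesis by blast
qed

text \<open>The sum of the push-outs along \<open>i1\<close> and \<open>i2\<close> works; the mixed
  terms vanish because \<open>p1 \<cdot> i2\<close> and \<open>p2 \<cdot> i1\<close> are
  zero.\<close>

lemma biproduct_push:
  assumes b: "biproduct \<A> X Y Z i1 i2 p1 p2" and C: "X \<in> \<C>" "Y \<in> \<C>"
    and \<gamma>: "\<gamma> \<in> EE (Suc t) A X" "\<gamma>' \<in> EE (Suc t) A Y"
  obtains T where "T \<in> EE (Suc t) A Z" "psh p1 T = \<gamma>" "psh p2 T = \<gamma>'"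
proof -
  note bf = biproduct_facts[OF b]
  have Z: "Z \<in> \<C>" by (rule biproduct_C[OF b C])
  have A: "A \<in> \<C>" using Ext_class_ends[OF \<gamma>(1)] by simp
  note s1 = push_closed[OF \<gamma>(1) bf(1,5,6) Z] note s2 = push_closed[OF \<gamma>(2) bf(2,7,8) Z]
  interpret X: comm_group "EXT (Suc t) A X" by (rule Ext_comm_group[OF A C(1)])
  interpret Y: comm_group "EXT (Suc t) A Y" by (rule Ext_comm_group[OF A C(2)])
  have u: "\<gamma> \<uplus> zero_class t A X = \<gamma>" "zero_class t A Y \<uplus> \<gamma>' = \<gamma>'"
    using X.r_one[OF \<gamma>(1)] Y.l_one[OF \<gamma>(2)] A C by (simp_all add: Ext_simps)
  have "psh p1 (psh i1 \<gamma> \<uplus> psh i2 \<gamma>') = psh (p1 \<cdot> i1) \<gamma> \<uplus> psh (p1 \<cdot> i2) \<gamma>'"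
    using push_sum[OF s1 s2 bf(3,9,10) C(1)] push_push[OF \<gamma>(1) bf(1,5,6) Z bf(3,9,10) C(1)]
      push_push[OF \<gamma>(2) bf(2,7,8) Z bf(3,9,10) C(1)] by simp
  also have "\<dots> = \<gamma>" unfolding bf using push_ident[OF \<gamma>(1)] push_zero[OF \<gamma>(2) C(1)] u by simp
  finally have 1: "psh p1 (psh i1 \<gamma> \<uplus> psh i2 \<gamma>') = \<gamma>" .
  have "psh p2 (psh i1 \<gamma> \<uplus> psh i2 \<gamma>') = psh (p2 \<cdot> i1) \<gamma> \<uplus> psh (p2 \<cdot> i2) \<gamma>'"
    using push_sum[OF s1 s2 bf(4,11,12) C(2)] push_push[OF \<gamma>(1) bf(1,5,6) Z bf(4,11,12) C(2)]
      push_push[OF \<gamma>(2) bf(2,7,8) Z bf(4,11,12) C(2)] by simp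
  also have "\<dots> = \<gamma>'" unfolding bf using push_ident[OF \<gamma>(2)] push_zero[OF \<gamma>(1) C(2)] u by simp
  finally have 2: "psh p2 (psh i1 \<gamma> \<uplus> psh i2 \<gamma>') = \<gamma>'" .
  show thesis by (rule that[OF sum_closed[OF s1 s2] 1 2])
qed

text \<open>
  That the right-hand factor of a chain lifts along the first deflation is invariant under single steps,
  and it holds for chains whose first conflation splits.
\<close>

lemma exact_right_step:
  assumes E1: "\<And>A B C f q X \<gamma>. \<lbrakk>conf A C (f, q); tgt f = B; \<gamma> \<in> EE (Suc t) X B; psh q \<gamma> = zero_class t X C\<rbrakk>
      \<Longrightarrow> \<exists>\<alpha> \<in> EE (Suc t) X A. psh f \<alpha> = \<gamma>"
    and a: "conf A C (f, q)" "tgt f = B" and F: "F \<in> Ch (Suc t) C X" "cls ((f, q) # F) = zero_class (Suc t) X A"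
  shows "\<exists>\<beta> \<in> EE (Suc t) X B. psh q \<beta> = cls F"
proof -
  \<comment> \<open>For a chain \<open>(i, p) # G\<close> this says that the class of
    \<open>G\<close> is in the image of push-out along \<open>p\<close>.\<close>
  define P where "P x \<longleftrightarrow> (\<exists>\<beta> \<in> EE (Suc t) X (tgt (fst (hd x))). psh (snd (hd x)) \<beta> = cls (tl x))" for x
  have C: "X \<in> \<C>" "A \<in> \<C>" using Ch_C[OF F(1)] conf_C[OF a(1)] by auto
  \<comment> \<open>The all-split chain has zero class too, so a zigzag links it to
    \<open>(f, q) # F\<close>; for it a section of the first deflation provides the lift.\<close>
  obtain x where x: "x \<in> Ch (Suc (Suc t)) A X" "\<forall>e \<in> set x. split_conf e" using all_split_exists[OF C] by blast
  obtain e es K where xe: "x = e # es" "conf A K e" "es \<in> Ch (Suc t) K X" using Ch_SucE[OF x(1)] .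
  have "cls x = zero_class (Suc t) X A" using x cls_split_head[of e es "Suc t" A X] unfolding xe by simp
  have "P x"
  proof -
    obtain i p where ip: "e = (i, p)" by (cases e)
    note ef = conf_facts[OF xe(2)[unfolded ip]]
    obtain s where s: "s \<in> Arr \<A>" "src s = K" "tgt s = tgt i" "p \<cdot> s = idn K"
      using split_conf_section[OF _ xe(2)[unfolded ip]] x xe ip by auto
    have es: "cls es \<in> EE (Suc t) X K" using xe by (auto simp: Ext_carrier)
    have "psh p (psh s (cls es)) = cls es"
      using push_push[OF es s(1-3), of p K] push_ident[OF es] ef s(4) by simp
    moreover have "psh s (cls es) \<in> EE (Suc t) X (tgt i)" using push_closed[OF es s(1-3)] ef by simp
    ultimately show ?thesis unfolding P_def xe ip by auto
  qed
  have x': "(f, q) # F \<in> Ch (Suc (Suc t)) A X" using a F by (auto simp: Ch_Suc)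
  have "P ((f, q) # F) = P x"
  proof (rule cls_eq_invariant[OF x' x(1)])
    show "cls ((f, q) # F) = cls x" using F \<open>cls x = _\<close> by simp
    fix u v assume u: "u \<in> Ch (Suc (Suc t)) A X" and v: "v \<in> Ch (Suc (Suc t)) A X"
      and m: "mseq (idn A) (idn X) u v"
    obtain e G K where ue: "u = e # G" "conf A K e" "G \<in> Ch (Suc t) K X" using Ch_SucE[OF u] .
    obtain e' G' K' where ve: "v = e' # G'" "conf A K' e'" "G' \<in> Ch (Suc t) K' X" using Ch_SucE[OF v] .
    obtain i p i' p' where ip: "e = (i, p)" "e' = (i', p')" by (cases e, cases e')
    note uc = ue(2)[unfolded ip] and vc = ve(2)[unfolded ip]
    note ef = conf_facts[OF uc] and ef' = conf_facts[OF vc]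
    obtain k where k: "cmor (i, p) (i', p') (idn A) k" "mseq k (idn X) G G'" using m ue ve ip by auto
    obtain g where g: "g \<in> Arr \<A>" "src g = tgt i" "tgt g = tgt i'" "p' \<cdot> g = k \<cdot> p"
      "k \<in> Arr \<A>" "src k = K" "tgt k = K'"
      using cmorE[OF k(1) uc vc] by metis
    have G: "cls G \<in> EE (Suc t) X K" "cls G' \<in> EE (Suc t) X K'" using ue ve by (auto simp: Ext_carrier)
    have kG: "psh k (cls G) = cls G'" by (rule push_cls[OF ue(3) ve(3) k(2)])
    show "P u = P v"
    proof
      assume "P u"
      then obtain \<beta> where \<beta>: "\<beta> \<in> EE (Suc t) X (tgt i)" "psh p \<beta> = cls G"
        unfolding P_def ue ip by auto
      \<comment> \<open>Forward along a step, the lift is transported by the middle component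
        \<open>g\<close>.\<close>
      have "psh p' (psh g \<beta>) = psh k (psh p \<beta>)"
        using push_push[OF \<beta>(1) g(1-3), of p' K'] push_push[OF \<beta>(1), of p K k K'] g ef ef' by simp
      then have "psh p' (psh g \<beta>) = cls G'" using \<beta> kG by simp
      moreover have "psh g \<beta> \<in> EE (Suc t) X (tgt i')" using push_closed[OF \<beta>(1) g(1-3)] ef' by simp
      ultimately show "P v" unfolding P_def ve ip by auto
    next
      assume "P v"
      then obtain \<beta> where \<beta>: "\<beta> \<in> EE (Suc t) X (tgt i')" "psh p' \<beta> = cls G'"
        unfolding P_def ve ip by auto
      \<comment> \<open>Backward there is no arrow to transport \<beta> along. But \<beta> and the
        class of \<open>G\<close> have the same image over \<open>K'\<close>, so a class on the
        biproduct with these two components is killed by the difference map, and \<open>E1\<close>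
        lifts it to the pull-back.\<close>
      obtain Z j1 j2 q1 q2 where b: "biproduct \<A> (tgt i') K Z j1 j2 q1 q2"
        using biproduct_exists[of "tgt i'" K] ef ef' by auto
      note bf = biproduct_facts[OF b]
      obtain y i0 p0 where y: "conf A K (i0, p0)" "cmor (i0, p0) (i', p') (idn A) k"
        "conf (tgt i0) K' (j1 \<cdot> y \<boxplus> j2 \<cdot> p0, p' \<cdot> q1 \<boxplus> neg (k \<cdot> q2))"
        "y \<in> Arr \<A>" "src y = tgt i0" "tgt y = tgt i'"
        using pullback_conf[OF vc g(5-7) ef(8) b] .
      note yf = conf_facts[OF y(1)]
      obtain T where T: "T \<in> EE (Suc t) X Z" "psh q1 T = \<beta>" "psh q2 T = cls G"
        using biproduct_push[OF b ef'(9) ef(8) \<beta>(1) G(1)] .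
      have Z: "Z \<in> \<C>" by (rule biproduct_C[OF b ef'(9) ef(8)])
      interpret K': comm_group "EXT (Suc t) X K'" by (rule Ext_comm_group[OF C(1) ef'(8)])
      have q1: "psh (p' \<cdot> q1) T = cls G'"
        using push_push[OF T(1) bf(3,9,10) ef'(9), of p' K'] ef' \<beta> T by simp
      have kq: "psh (k \<cdot> q2) T = cls G'"
        using push_push[OF T(1) bf(4,11,12) ef(8) g(5-7) ef'(8)] kG T by simp
      have "psh (neg (idn K')) (psh (k \<cdot> q2) T) = psh (neg (k \<cdot> q2)) T"
        using push_push[OF T(1), of "k \<cdot> q2" K' "neg (idn K')" K'] bf g ef' by simp
      then have q2: "psh (neg (k \<cdot> q2)) T = inv\<^bsub>EXT (Suc t) X K'\<^esub> (cls G')"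
        using Ext_inv[OF G(2)] kq by simp
      have "psh (p' \<cdot> q1 \<boxplus> neg (k \<cdot> q2)) T = zero_class t X K'"
        using push_plus[OF T(1), of "p' \<cdot> q1" K' "neg (k \<cdot> q2)"] q1 q2 K'.r_inv[OF G(2)] bf g ef' C
        by (simp add: Ext_simps)
      moreover have "tgt (j1 \<cdot> y \<boxplus> j2 \<cdot> p0) = Z" using bf y yf by simp
      ultimately obtain \<alpha> where \<alpha>: "\<alpha> \<in> EE (Suc t) X (tgt i0)" "psh (j1 \<cdot> y \<boxplus> j2 \<cdot> p0) \<alpha> = T"
        using E1[OF y(3) _ T(1)] by blast
      have "q2 \<cdot> (j1 \<cdot> y \<boxplus> j2 \<cdot> p0) = p0"
        using bf y yf biproduct_comp[OF b, of y] biproduct_comp[OF b, of p0] by simp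
      then have p0: "psh p0 \<alpha> = cls G"
        using push_push[OF \<alpha>(1), of "j1 \<cdot> y \<boxplus> j2 \<cdot> p0" Z q2 K] bf y yf Z ef \<alpha> T by simp
      \<comment> \<open>\<open>e\<close> is itself a pull-back of \<open>e'\<close> along
        \<open>k\<close>, so the constructed pull-back maps to it and the lift can be moved to
        \<open>tgt i\<close>.\<close>
      have "cmor (i0, p0) (i, p) (idn A) (idn K)" by (rule cmor_pull_factor[OF y(1) uc vc k(1) y(2)])
      then obtain w where w: "w \<in> Arr \<A>" "src w = tgt i0" "tgt w = tgt i" "p \<cdot> w = idn K \<cdot> p0"
        using cmorE[OF _ y(1) uc] by metis
      then have "psh p (psh w \<alpha>) = cls G"
        using push_push[OF \<alpha>(1) w(1-3), of p K] ef yf p0 by simp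
      moreover have "psh w \<alpha> \<in> EE (Suc t) X (tgt i)" using push_closed[OF \<alpha>(1) w(1-3)] ef by simp
      ultimately show "P u" unfolding P_def ue ip by auto
    qed
  qed
  then show ?thesis using \<open>P x\<close> a unfolding P_def by simp
qed

text \<open>Representing \<beta> by \<open>F2\<close> and sliding \<open>p\<close> replaces
  \<open>e\<close> by its pull-back along \<open>p\<close>. Pushed out along \<open>g\<close>, this
  is the pull-back of \<open>(j, p)\<close> along its own deflation, hence split.\<close>

lemma lift_along_deflation:
  assumes e: "conf B K e" "conf B' K (j, p)" "cmor e (j, p) g (idn K)"
    and F: "F \<in> Ch (Suc t) K X" and \<beta>: "\<beta> \<in> EE (Suc t) X (tgt j)" "psh p \<beta> = cls F"
  obtains e2 e3 F2 where "conf B (tgt j) e2" "F2 \<in> Ch (Suc t) (tgt j) X" "cls (e # F) = cls (e2 # F2)"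
    "conf B' (tgt j) e3" "cmor e2 e3 g (idn (tgt j))" "split_conf e3"
proof -
  note ef = conf_facts[OF e(2)]
  have g: "g \<in> Arr \<A>" "src g = B" "tgt g = B'" using cmor_typ[OF e] by auto
  obtain F2 where F2: "F2 \<in> Ch (Suc t) (tgt j) X" "\<beta> = cls F2" using Ext_classE[OF \<beta>(1)] .
  obtain e2 where e2: "conf B (tgt j) e2" "cmor e2 e (idn B) p"
    using pull_conf[OF e(1), of p] ef by auto
  obtain e3 where e3: "conf B' (tgt j) e3" "cmor e2 e3 g (idn (tgt j))"
    using push_conf[OF e2(1), of g] g ef by auto
  have "cmor e2 (j, p) g p" using cmor_comp[OF e2(1) e(1,2) e2(2) e(3)] g ef by simp
  then have "cmor e3 (j, p) (idn B') p" by (rule cmor_factor[OF e2(1) e3(1) e(2) e3(2)])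
  then have "split_conf e3" by (rule split_pull_self[OF e(2) e3(1)])
  moreover have "cls (e2 # F2) = cls (e # F)"
    by (rule cls_Cons_slide[OF e2(1) e(1) e2(2) F2(1) F]) (use \<beta> F2 in simp)
  ultimately show thesis using that e2 F2 e3 by metis
qed

text \<open>In higher degree, vanishing of the push-out along \<open>q\<close> need not split its
  first conflation. The rest \<open>F\<close> is therefore lifted along the first deflation, by
  exactness one degree lower; after sliding, the first conflation does split, and the case of a
  single conflation applies to it alone.\<close>

lemma exact_middle:
  assumes a: "conf A C (f, q)" "tgt f = B" and \<gamma>: "\<gamma> \<in> EE (Suc t) X B" "psh q \<gamma> = zero_class t X C"
  shows "\<exists>\<alpha> \<in> EE (Suc t) X A. psh f \<alpha> = \<gamma>"
  using assms
proof (induction t arbitrary: A B C f q X \<gamma>)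
  case 0
  then show ?case using exact_middle_0 by blast
next
  case (Suc t)
  note a = Suc.prems(1,2) and \<gamma> = Suc.prems(3,4)
  note af = conf_facts[OF a(1)]
  obtain x where x: "x \<in> Ch (Suc (Suc t)) B X" "\<gamma> = cls x" using Ext_classE[OF \<gamma>(1)] .
  obtain e F K where e: "x = e # F" "conf B K e" "F \<in> Ch (Suc t) K X" using Ch_SucE[OF x(1)] .
  obtain i1 p1 where e1: "conf C K (i1, p1)" "cmor e (i1, p1) q (idn K)"
    using push_conf[OF e(2), of q] af a(2) by (metis surj_pair)
  have "cls ((i1, p1) # F) = zero_class (Suc t) X C" using push_Cons[OF e(2) e1 e(3)] \<gamma> x e by simp
  then have "\<exists>\<beta> \<in> EE (Suc t) X (tgt i1). psh p1 \<beta> = cls F"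
    by (rule exact_right_step[OF _ e1(1) refl e(3), rotated]) (rule Suc.IH)
  then obtain \<beta> where \<beta>: "\<beta> \<in> EE (Suc t) X (tgt i1)" "psh p1 \<beta> = cls F" by blast
  obtain e2 e3 F2 where e2: "conf B (tgt i1) e2" "F2 \<in> Ch (Suc t) (tgt i1) X" "cls (e # F) = cls (e2 # F2)"
    "conf C (tgt i1) e3" "cmor e2 e3 q (idn (tgt i1))" "split_conf e3"
    using lift_along_deflation[OF e(2) e1 e(3) \<beta>] .
  obtain e' where e': "conf A (tgt i1) e'" "cmor e' e2 f (idn (tgt i1))"
    using conf_lift[OF a e2(1,4,5,6)] .
  have "psh f (cls (e' # F2)) = \<gamma>" using push_Cons[OF e'(1) e2(1) e'(2) e2(2)] e2(3) x e by simp
  moreover have "cls (e' # F2) \<in> EE (Suc (Suc t)) X A" using e' e2 by (intro Ext_classI) (auto simp: Ch_Suc)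
  ultimately show ?case by blast
qed

lemma exact_right:
  assumes "conf A C (f, q)" "tgt f = B" "F \<in> Ch (Suc t) C X" "cls ((f, q) # F) = zero_class (Suc t) X A"
  shows "\<exists>\<beta> \<in> EE (Suc t) X B. psh q \<beta> = cls F"
  by (rule exact_right_step[OF _ assms]) (rule exact_middle)

text \<open>Same preparation as in \<open>exact_middle\<close>, but now it is the push-out along
  \<open>f\<close> that becomes split. Then \<open>conf_connecting\<close> makes the first
  conflation a pull-back of \<open>(f, q)\<close> along some \<open>h\<close>, and \<open>h\<close>
  slides onto the rest.\<close>

lemma exact_left:
  assumes a: "conf A C (f, q)" "tgt f = B"
    and \<gamma>: "\<gamma> \<in> EE (Suc (Suc t)) X A" "psh f \<gamma> = zero_class (Suc t) X B"
  shows "\<exists>F \<in> Ch (Suc t) C X. \<gamma> = cls ((f, q) # F)"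
proof -
  note af = conf_facts[OF a(1)]
  obtain x where x: "x \<in> Ch (Suc (Suc t)) A X" "\<gamma> = cls x" using Ext_classE[OF \<gamma>(1)] .
  obtain e F K where e: "x = e # F" "conf A K e" "F \<in> Ch (Suc t) K X" using Ch_SucE[OF x(1)] .
  obtain i1 p1 where e1: "conf B K (i1, p1)" "cmor e (i1, p1) f (idn K)"
    using push_conf[OF e(2), of f] af a(2) by (metis surj_pair)
  have "cls ((i1, p1) # F) = zero_class (Suc t) X B" using push_Cons[OF e(2) e1 e(3)] \<gamma> x e by simp
  then obtain \<beta> where \<beta>: "\<beta> \<in> EE (Suc t) X (tgt i1)" "psh p1 \<beta> = cls F"
    using exact_right[OF e1(1) refl e(3)] by blast
  obtain e2 e3 F2 where e2: "conf A (tgt i1) e2" "F2 \<in> Ch (Suc t) (tgt i1) X" "cls (e # F) = cls (e2 # F2)"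
    "conf B (tgt i1) e3" "cmor e2 e3 f (idn (tgt i1))" "split_conf e3"
    using lift_along_deflation[OF e(2) e1 e(3) \<beta>] .
  obtain h where h: "h \<in> Arr \<A>" "src h = tgt i1" "tgt h = C" "cmor e2 (f, q) (idn A) h"
    using conf_connecting[OF a e2(1,4,5,6)] .
  have "psh h (cls F2) \<in> EE (Suc t) X C"
    by (rule push_closed[OF _ h(1-3)]) (use e2 af in \<open>auto simp: Ext_carrier\<close>)
  then obtain G where G: "G \<in> Ch (Suc t) C X" "psh h (cls F2) = cls G" by (rule Ext_classE)
  then have "\<gamma> = cls ((f, q) # G)" using cls_Cons_slide[OF e2(1) a(1) h(4) e2(2) G] e2(3) x e by simp
  then show ?thesis using G by blast
qed

lemma push_own_inflation:
  assumes a: "conf A C (f, q)" "tgt f = B" and F: "F \<in> Ch (Suc t) C X"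
  shows "psh f (cls ((f, q) # F)) = zero_class (Suc t) X B"
proof -
  note af = conf_facts[OF a(1)]
  have B: "B \<in> \<C>" "B \<in> Obj \<A>" using af a by auto
  obtain i1 p1 where e1: "conf B C (i1, p1)" "cmor (f, q) (i1, p1) f (idn C)"
    using push_conf[OF a(1), of f] af a(2) by (metis surj_pair)
  note ef = conf_facts[OF e1(1)]
  \<comment> \<open>A morphism to the conflation \<open>B = B -> 0\<close> with left component
    \<open>f\<close> is an extension of \<open>f\<close>, here the identity of \<open>B\<close>.
    Factored through the push-out it becomes a retraction of \<open>i1\<close>.\<close>
  have z: "conf B zero_obj (idn B, nul B zero_obj)" using conf_zero_right zero_obj B by blast
  have "cmor (f, q) (idn B, nul B zero_obj) f (nul C zero_obj)"
    by (rule cmorI[of "idn B"]) (use af a B zero_obj in auto)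
  then have "cmor (i1, p1) (idn B, nul B zero_obj) (idn B) (nul C zero_obj)"
    by (rule cmor_factor[OF a(1) e1(1) z e1(2)])
  then obtain r where r: "r \<in> Arr \<A>" "src r = tgt i1" "tgt r = B" "r \<cdot> i1 = idn B"
    using B by (elim cmorE[OF _ e1(1) z]) auto
  then have "split_conf (i1, p1)" unfolding split_conf_def using ef by (intro bexI[of _ r]) auto
  moreover have "(i1, p1) # F \<in> Ch (Suc (Suc t)) B X" using e1 F by (auto simp: Ch_Suc)
  ultimately show ?thesis using push_Cons[OF a(1) e1 F] cls_split_head by simp
qed

section \<open>Unit conflations and angled pairs\<close>

lemma n_projective_iff:
  "n_projective \<A> \<C> n P \<longleftrightarrow> P \<in> \<C> \<and> (\<forall>t \<ge> n. \<forall>Y \<in> \<C>. EE (Suc t) P Y = {zero_class t P Y})"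
proof -
  have s: "(\<forall>i > n. Q i) \<longleftrightarrow> (\<forall>t \<ge> n. Q (Suc t))" for Q :: "nat \<Rightarrow> bool"
    by (metis Suc_le_D Suc_le_eq Suc_le_mono)
  show ?thesis unfolding n_projective_def s by (auto simp: Ext_simps)
qed

lemma n_injective_iff:
  "n_injective \<A> \<C> n P \<longleftrightarrow> P \<in> \<C> \<and> (\<forall>t \<ge> n. \<forall>Y \<in> \<C>. EE (Suc t) Y P = {zero_class t Y P})"
proof -
  have s: "(\<forall>i > n. Q i) \<longleftrightarrow> (\<forall>t \<ge> n. Q (Suc t))" for Q :: "nat \<Rightarrow> bool"
    by (metis Suc_le_D Suc_le_eq Suc_le_mono)
  show ?thesis unfolding n_injective_def s by (auto simp: Ext_simps)
qed

lemma n_injective_zero: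
  "\<lbrakk>n_injective \<A> \<C> n P; t \<ge> n; \<gamma> \<in> EE (Suc t) Y P\<rbrakk> \<Longrightarrow> \<gamma> = zero_class t Y P"
  using Ext_class_ends unfolding n_injective_iff by blast

lemma n_injectiveI:
  assumes "P \<in> \<C>" "\<And>t Y \<gamma>. \<lbrakk>t \<ge> n; Y \<in> \<C>; \<gamma> \<in> EE (Suc t) Y P\<rbrakk> \<Longrightarrow> \<gamma> = zero_class t Y P"
  shows "n_injective \<A> \<C> n P"
  unfolding n_injective_iff using assms zero_class_closed by blast

lemma n_injective_middle:
  assumes e: "conf A C (f, q)" and A: "n_injective \<A> \<C> n A" and C: "n_injective \<A> \<C> n C"
  shows "n_injective \<A> \<C> n (tgt f)"
proof (rule n_injectiveI)
  note ef = conf_facts[OF e]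
  fix t Y \<gamma> assume t: "t \<ge> n" "Y \<in> \<C>" and \<gamma>: "\<gamma> \<in> EE (Suc t) Y (tgt f)"
  have "psh q \<gamma> \<in> EE (Suc t) Y C" using push_closed[OF \<gamma>, of q C] ef by simp
  then have "psh q \<gamma> = zero_class t Y C" by (rule n_injective_zero[OF C t(1)])
  then obtain \<alpha> where \<alpha>: "\<alpha> \<in> EE (Suc t) Y A" "psh f \<alpha> = \<gamma>" using exact_middle[OF e refl \<gamma>] by blast
  then show "\<gamma> = zero_class t Y (tgt f)"
    using n_injective_zero[OF A t(1) \<alpha>(1)] push_one[of f A "tgt f" Y t] ef t by simp
qed (use conf_facts[OF e] in simp)

text \<open>The connecting image of \<gamma> lies one degree higher in \<open>Ext\<close> into
  \<open>A\<close>, which vanishes; so \<gamma> comes from the middle term, where \<open>Ext\<close>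
  vanishes as well.\<close>

lemma n_injective_cokernel:
  assumes e: "conf A C (f, q)" and A: "n_injective \<A> \<C> n A" and B: "n_injective \<A> \<C> n (tgt f)"
  shows "n_injective \<A> \<C> n C"
proof (rule n_injectiveI)
  note ef = conf_facts[OF e]
  fix t Y \<gamma> assume t: "t \<ge> n" "Y \<in> \<C>" and \<gamma>: "\<gamma> \<in> EE (Suc t) Y C"
  obtain F where F: "F \<in> Ch (Suc t) C Y" "\<gamma> = cls F" using Ext_classE[OF \<gamma>] .
  have "cls ((f, q) # F) \<in> EE (Suc (Suc t)) Y A" using e F by (intro Ext_classI) (auto simp: Ch_Suc)
  then have "cls ((f, q) # F) = zero_class (Suc t) Y A" by (rule n_injective_zero[OF A, rotated]) (use t in simp)
  then obtain \<beta> where \<beta>: "\<beta> \<in> EE (Suc t) Y (tgt f)" "psh q \<beta> = cls F"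
    using exact_right[OF e refl F(1)] by blast
  then show "\<gamma> = zero_class t Y C"
    using n_injective_zero[OF B t(1) \<beta>(1)] push_one[of q "tgt f" C Y t] ef t F by simp
qed (use conf_facts[OF e] in simp)

text \<open>Writing the identity of \<open>Z\<close> as a sum of two idempotents splits a class into
  two parts, pulled back from \<open>P\<close> and \<open>P'\<close>, where they vanish.\<close>

lemma n_projective_biproduct:
  assumes b: "biproduct \<A> P P' Z i1 i2 p1 p2" and P: "n_projective \<A> \<C> n P" "n_projective \<A> \<C> n P'"
  shows "n_projective \<A> \<C> n Z"
proof -
  note bf = biproduct_facts[OF b]
  have C: "P \<in> \<C>" "P' \<in> \<C>" using P by (simp_all add: n_projective_iff)
  have Z: "Z \<in> \<C>" by (rule biproduct_C[OF b C])
  have "\<gamma> = zero_class t Z Y" if t: "t \<ge> n" "Y \<in> \<C>" and \<gamma>: "\<gamma> \<in> EE (Suc t) Z Y" for t Y \<gamma>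
  proof -
    interpret comm_group "EXT (Suc t) Z Y" by (rule Ext_comm_group[OF Z t(2)])
    have "pll \<gamma> i1 = zero_class t P Y" "pll \<gamma> i2 = zero_class t P' Y"
      using pull_closed[OF \<gamma> bf(1,5,6) C(1)] pull_closed[OF \<gamma> bf(2,7,8) C(2)] P t
      unfolding n_projective_iff by blast+
    then have z: "pll \<gamma> (i1 \<cdot> p1) = zero_class t Z Y" "pll \<gamma> (i2 \<cdot> p2) = zero_class t Z Y"
      using pull_pull[OF \<gamma> bf(1,5,6) C(1) bf(3,9,10) Z] pull_pull[OF \<gamma> bf(2,7,8) C(2) bf(4,11,12) Z]
        pull_one[OF bf(3,9,10) Z t(2) C(1), of t] pull_one[OF bf(4,11,12) Z t(2) C(2), of t] by simp_all
    have "\<gamma> = pll \<gamma> (i1 \<cdot> p1 \<boxplus> i2 \<cdot> p2)" using pull_ident[OF \<gamma>] bf by simp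
    also have "\<dots> = zero_class t Z Y \<uplus> zero_class t Z Y"
      using pull_plus[OF \<gamma>, of "i1 \<cdot> p1" Z "i2 \<cdot> p2"] z bf(1-12) Z by simp
    also have "\<dots> = zero_class t Z Y" using l_one[OF one_closed] Z t by (simp add: Ext_simps)
    finally show ?thesis .
  qed
  then show ?thesis unfolding n_projective_iff using Z zero_class_closed by blast
qed

section \<open>The subgroup of \<P>-conflations\<close>

lemma P_conflationsI:
  "\<lbrakk>n_projective \<A> \<C> n P; h \<in> Hom \<A> X P; \<eta> \<in> EE n P Y\<rbrakk> \<Longrightarrow> pll \<eta> h \<in> PC n X Y"
  unfolding P_conflations_def by blast

lemma P_conflationsE:
  assumes "x \<in> PC n X Y"
  obtains P h \<eta> where "n_projective \<A> \<C> n P" "P \<in> \<C>" "h \<in> Arr \<A>" "src h = X" "tgt h = P"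
    "\<eta> \<in> EE n P Y" "x = pll \<eta> h"
  using assms that unfolding P_conflations_def n_projective_iff by auto

lemma P_conflations_closed:
  assumes "x \<in> PC (Suc m) X Y" "X \<in> \<C>"
  shows "x \<in> EE (Suc m) X Y"
  using assms(1) by (rule P_conflationsE) (use assms(2) pull_closed in blast)

lemma P_conflations_push:
  assumes x: "x \<in> PC (Suc m) X Y" and X: "X \<in> \<C>"
    and g: "g \<in> Arr \<A>" "src g = Y" "tgt g = Y'" "Y' \<in> \<C>"
  shows "psh g x \<in> PC (Suc m) X Y'"
proof -
  obtain P h \<eta> where P: "n_projective \<A> \<C> (Suc m) P" "P \<in> \<C>" "h \<in> Arr \<A>" "src h = X" "tgt h = P"
    "\<eta> \<in> EE (Suc m) P Y" "x = pll \<eta> h" using P_conflationsE[OF x] .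
  have "psh g x = pll (psh g \<eta>) h" using push_pull[OF P(6) g P(3-5) X] P(7) by simp
  also have "\<dots> \<in> PC (Suc m) X Y'"
    by (rule P_conflationsI[OF P(1)]) (use P push_closed[OF P(6) g] in auto)
  finally show ?thesis .
qed

text \<open>Both factorisations are merged into one through the biproduct of \<open>P\<close> and
  \<open>P'\<close>, by the arrow with components \<open>h\<close> and \<open>h'\<close>.\<close>

lemma P_conflations_sum:
  assumes x: "x \<in> PC (Suc m) X Y" "x' \<in> PC (Suc m) X Y" and X: "X \<in> \<C>"
  shows "x \<uplus> x' \<in> PC (Suc m) X Y"
proof -
  obtain P h \<eta> where P: "n_projective \<A> \<C> (Suc m) P" "P \<in> \<C>" "h \<in> Arr \<A>" "src h = X" "tgt h = P"
    "\<eta> \<in> EE (Suc m) P Y" "x = pll \<eta> h" using P_conflationsE[OF x(1)] .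
  obtain P' h' \<eta>' where P': "n_projective \<A> \<C> (Suc m) P'" "P' \<in> \<C>" "h' \<in> Arr \<A>" "src h' = X" "tgt h' = P'"
    "\<eta>' \<in> EE (Suc m) P' Y" "x' = pll \<eta>' h'" using P_conflationsE[OF x(2)] .
  obtain Z i1 i2 p1 p2 where b: "biproduct \<A> P P' Z i1 i2 p1 p2" using biproduct_exists[of P P'] P P' by auto
  note bf = biproduct_facts[OF b]
  have Z: "Z \<in> \<C>" by (rule biproduct_C[OF b P(2) P'(2)])
  note q = pull_closed[OF P(6) bf(3,9,10) Z] pull_closed[OF P'(6) bf(4,11,12) Z]
  let ?k = "i1 \<cdot> h \<boxplus> i2 \<cdot> h'"
  have k: "?k \<in> Arr \<A>" "src ?k = X" "tgt ?k = Z" using bf P P' by simp_all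
  have pk: "p1 \<cdot> ?k = h" "p2 \<cdot> ?k = h'"
    using bf P P' X biproduct_comp[OF b, of h] biproduct_comp[OF b, of h'] by simp_all
  have "pll (pll \<eta> p1 \<uplus> pll \<eta>' p2) ?k = x \<uplus> x'"
    using pull_sum[OF q k X] pull_pull[OF P(6) bf(3,9,10) Z k X] pull_pull[OF P'(6) bf(4,11,12) Z k X] pk P P' by simp
  moreover have "pll (pll \<eta> p1 \<uplus> pll \<eta>' p2) ?k \<in> PC (Suc m) X Y"
    by (rule P_conflationsI[OF n_projective_biproduct[OF b P(1) P'(1)]]) (use k sum_closed[OF q] in auto)
  ultimately show ?thesis by simp
qed

lemma P_conflations_subgroup:
  assumes F: "n_Frobenius \<A> \<C> (Suc m)" and C: "X \<in> \<C>" "Y \<in> \<C>"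
  shows "subgroup (PC (Suc m) X Y) (EXT (Suc m) X Y)"
proof -
  interpret comm_group "EXT (Suc m) X Y" by (rule Ext_comm_group[OF C])
  show ?thesis
  proof
    show "PC (Suc m) X Y \<subseteq> EE (Suc m) X Y" using P_conflations_closed C by blast
    \<comment> \<open>Some \<open>n\<close>-projective object is wanted through which the zero class
      can factor; the source of a deflation supplied by the Frobenius condition is one.\<close>
    obtain p where p: "n_projective \<A> \<C> (Suc m) (src p)" using F C unfolding n_Frobenius_def by blast
    then have P: "src p \<in> \<C>" by (simp add: n_projective_iff)
    have "pll (zero_class m (src p) Y) (nul X (src p)) \<in> PC (Suc m) X Y"
      by (rule P_conflationsI[OF p]) (use C P zero_class_closed in auto)
    then show "\<one>\<^bsub>EXT (Suc m) X Y\<^esub> \<in> PC (Suc m) X Y"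
      using pull_one[of "nul X (src p)" X "src p" Y m] C P by (simp add: Ext_simps)
  next
    fix x y assume "x \<in> PC (Suc m) X Y" "y \<in> PC (Suc m) X Y"
    then show "x \<otimes>\<^bsub>EXT (Suc m) X Y\<^esub> y \<in> PC (Suc m) X Y"
      using P_conflations_sum C by (simp add: Ext_simps)
  next
    fix x assume x: "x \<in> PC (Suc m) X Y"
    show "inv\<^bsub>EXT (Suc m) X Y\<^esub> x \<in> PC (Suc m) X Y"
      using P_conflations_push[OF x C(1), of "neg (idn Y)" Y] Ext_inv P_conflations_closed[OF x C(1)] C by simp
  qed
qed

section \<open>Push-outs of unit conflations\<close>

lemma pushout_square_sym: "pushout_square \<A> i g x i' \<Longrightarrow> pushout_square \<A> g i i' x"
  unfolding pushout_square_def by (metis (no_types, lifting))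

lemma unit_conflationE:
  assumes "\<delta> \<in> UC (Suc m) N"
  obtains x where "x \<in> Ch (Suc m) (left_end \<A> \<delta>) N" "\<delta> = spl x"
    "\<And>k. \<lbrakk>1 \<le> k; k \<le> Suc m\<rbrakk> \<Longrightarrow> n_projective \<A> \<C> (Suc m) (trm \<delta> k)"
proof -
  obtain K x where x: "x \<in> Ch (Suc m) K N" "\<delta> = spl x"
    "\<And>k. \<lbrakk>1 \<le> k; k \<le> Suc m\<rbrakk> \<Longrightarrow> n_projective \<A> \<C> (Suc m) (trm \<delta> k)"
    using assms unfolding unit_conflations_def by (auto simp: ext_seqs_eq)
  have "left_end \<A> \<delta> = K" using x(1) unfolding left_end_def x(2) splice_hd by (auto elim!: Ch_SucE simp: conf_def)
  then show thesis using that x by blast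
qed

lemma is_pushout_seqE:
  assumes "is_pushout_seq \<A> a \<delta> E"
  obtains i d ds i' d' x where "\<delta> = i # d # ds" "E = i' # d' # ds" "pushout_square \<A> i a x i'"
    "trm \<delta> 1 = tgt i" "trm E 1 = tgt i'" "i \<in> Arr \<A>" "src i = src a"
proof -
  obtain i d ds i' d' x where e: "\<delta> = i # d # ds" "E = i' # d' # ds" "pushout_square \<A> i a x i'"
     "d' \<in> Hom \<A> (tgt i') (tgt d)" "d' \<cdot> x = d"
    using assms unfolding is_pushout_seq_def by blast
  note pf = pushout_square_facts[OF e(3)]
  have "src d = tgt i" unfolding e(5)[symmetric] using pf e(4) by simp
  then show thesis using that[OF e(1-3)] e pf by (simp add: seq_term_def)
qed

text \<open>
  In a push-out square the two parallel inflations have the same cokernel, so the middle terms of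
  \<open>\<delta>\<close> and \<open>a\<delta>\<close> control the cokernel of \<open>a\<close>.
\<close>

lemma unit_pushout_cokernel:
  assumes Fr: "n_Frobenius \<A> \<C> (Suc m)" and \<delta>: "\<delta> \<in> UC (Suc m) N"
    and E: "E \<in> UC (Suc m) N" and P: "is_pushout_seq \<A> a \<delta> E"
    and a: "conf K D (a, s)"
  shows "n_injective \<A> \<C> (Suc m) D"
proof -
  obtain i d ds i' d' x where e: "\<delta> = i # d # ds" "E = i' # d' # ds" "pushout_square \<A> i a x i'"
    "trm \<delta> 1 = tgt i" "trm E 1 = tgt i'" using is_pushout_seqE[OF P] by metis
  have "n_projective \<A> \<C> (Suc m) (trm \<delta> 1)" "n_projective \<A> \<C> (Suc m) (trm E 1)"
    using \<delta> E unfolding unit_conflations_def by auto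
  then have inj: "n_injective \<A> \<C> (Suc m) (tgt i)" "n_injective \<A> \<C> (Suc m) (tgt i')"
    using Fr e unfolding n_Frobenius_def by auto
  then have C: "tgt i \<in> \<C>" by (simp add: n_injective_iff)
  \<comment> \<open>The square is read the other way: as a push-out of \<open>(a, s)\<close> along
    \<open>i\<close> it keeps the cokernel \<open>D\<close>.\<close>
  obtain s' where s': "conf (tgt i) D (x, s')"
    using pushout_conf[OF a pushout_square_sym[OF e(3)] C] by blast
  have "tgt x = tgt i'" using pushout_square_facts[OF e(3)] by simp
  then show ?thesis using n_injective_cokernel[OF s' inj(1)] inj by simp
qed

text \<open>The first middle term of the push-out is an extension of \<open>D\<close> by the first
  middle term of \<delta>, hence \<open>n\<close>-injective and so \<open>n\<close>-projective; the
  later middle terms do not change.\<close>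

lemma unit_pushout:
  assumes Fr: "n_Frobenius \<A> \<C> (Suc m)" and \<delta>: "\<delta> \<in> UC (Suc m) N"
    and a: "conf (left_end \<A> \<delta>) D (a, s)" and D: "n_injective \<A> \<C> (Suc m) D"
  shows "\<exists>E \<in> UC (Suc m) N. is_pushout_seq \<A> a \<delta> E"
proof -
  note af = conf_facts[OF a]
  obtain x where x: "x \<in> Ch (Suc m) (left_end \<A> \<delta>) N" "\<delta> = spl x"
    "\<And>k. \<lbrakk>1 \<le> k; k \<le> Suc m\<rbrakk> \<Longrightarrow> n_projective \<A> \<C> (Suc m) (trm \<delta> k)"
    using unit_conflationE[OF \<delta>] by blast
  obtain E where P: "is_pushout_seq \<A> a \<delta> E" using pushout_seq_exists[OF x(1) af(1,3) refl af(9)] x(2) by blast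
  obtain x' where x': "x' \<in> Ch (Suc m) (tgt a) N" "E = spl x'"
    using pushout_seq_splice[OF x(1) af(1,3) refl af(9)] P x(2) by metis
  obtain i d ds i' d' y where e: "\<delta> = i # d # ds" "E = i' # d' # ds" "pushout_square \<A> i a y i'"
    "trm \<delta> 1 = tgt i" "trm E 1 = tgt i'" using is_pushout_seqE[OF P] by metis
  have inj: "n_injective \<A> \<C> (Suc m) (tgt i)" using x(3)[of 1] Fr e unfolding n_Frobenius_def by auto
  then have C: "tgt i \<in> \<C>" by (simp add: n_injective_iff)
  obtain s' where s': "conf (tgt i) D (y, s')"
    using pushout_conf[OF a pushout_square_sym[OF e(3)] C] by blast
  have "tgt y = tgt i'" using pushout_square_facts[OF e(3)] by simp
  then have 1: "n_projective \<A> \<C> (Suc m) (trm E 1)"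
    using n_injective_middle[OF s' inj D] Fr e unfolding n_Frobenius_def by simp
  have len: "length \<delta> = Suc (Suc m)" using x splice_length[of x] by (cases "x = []") (auto simp: Ch_def)
  have "n_projective \<A> \<C> (Suc m) (trm E k)" if k: "k \<in> {1..Suc m}" for k
  proof (cases "k = 1")
    case False
    then obtain j where j: "k = Suc (Suc j)" using k by (cases k; cases "k - 1") auto
    have "trm E k = trm \<delta> k" unfolding e(1,2) j using k len j e by (simp add: seq_term_def)
    then show ?thesis using x(3)[of k] k by simp
  qed (use 1 in simp)
  then have "E \<in> UC (Suc m) N"
    unfolding unit_conflations_def using x' by (auto simp: ext_seqs_eq)
  then show ?thesis using P by blast
qed

section \<open>Quasi-invertible arrows\<close>

lemma quasi_invertible_ident:
  assumes "K \<in> \<C>" shows "quasi_invertible \<A> \<C> n (idn K)"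
proof -
  have "psh (idn K) \<in> iso (EXT (n + 1) X K) (EXT (n + 1) X K)" if "X \<in> \<C>" for X
  proof -
    have "psh (idn K) \<in> hom (EXT (Suc n) X K) (EXT (Suc n) X K)"
      by (rule push_hom) (use assms in auto)
    moreover have "bij_betw (psh (idn K)) (EE (Suc n) X K) (EE (Suc n) X K)"
      using bij_betw_cong[THEN iffD1, OF _ bij_betw_id, of "EE (Suc n) X K" "psh (idn K)"]
        push_ident[of _ n X K] by simp
    ultimately show ?thesis by (simp add: iso_def)
  qed
  then show ?thesis using assms by (simp add: quasi_invertible_def)
qed

lemma quasi_invertible_comp:
  assumes a: "quasi_invertible \<A> \<C> n a" and b: "quasi_invertible \<A> \<C> n b" and ab: "tgt a = src b"
  shows "quasi_invertible \<A> \<C> n (b \<cdot> a)"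
proof -
  note a = a[unfolded quasi_invertible_def] and b = b[unfolded quasi_invertible_def]
  have C: "a \<in> Arr \<A>" "tgt a \<in> \<C>" "b \<in> Arr \<A>" "tgt b \<in> \<C>" using a b by auto
  have "psh (b \<cdot> a) \<in> iso (EXT (n + 1) X (src a)) (EXT (n + 1) X (tgt b))" if X: "X \<in> \<C>" for X
  proof -
    have h: "psh (b \<cdot> a) \<in> hom (EXT (Suc n) X (src a)) (EXT (Suc n) X (tgt b))"
      by (rule push_hom) (simp_all add: C ab)
    have "bij_betw (psh b \<circ> psh a) (EE (Suc n) X (src a)) (EE (Suc n) X (tgt b))"
      by (rule bij_betw_trans[of _ _ "EE (Suc n) X (tgt a)"]) (use a b X in \<open>simp_all add: iso_def ab\<close>)
    moreover have "(psh b \<circ> psh a) \<gamma> = psh (b \<cdot> a) \<gamma>" if "\<gamma> \<in> EE (Suc n) X (src a)" for \<gamma>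
      using push_push[OF that C(1) refl refl C(2,3) ab[symmetric] refl C(4)] by simp
    ultimately have "bij_betw (psh (b \<cdot> a)) (EE (Suc n) X (src a)) (EE (Suc n) X (tgt b))"
      using bij_betw_cong[of "EE (Suc n) X (src a)" "psh b \<circ> psh a" "psh (b \<cdot> a)"] by blast
    then show ?thesis using h by (simp add: iso_def)
  qed
  then show ?thesis using a b ab by (simp add: quasi_invertible_def)
qed

text \<open>
  If \<open>c'\<close> kills a class, that class is \<open>b\<epsilon>y\<close> for the conflation \<open>\<epsilon>\<close> starting with \<open>c\<close>; as \<open>c\<epsilon> = 0\<close> and \<open>c\<close>
  is quasi-invertible, already \<open>\<epsilon>y\<close> vanishes.
\<close>

lemma quasi_invertible_pushout:
  assumes c: "conf K D (c, r)" "quasi_invertible \<A> \<C> (Suc m) c" and D: "n_injective \<A> \<C> (Suc m) D"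
    and c': "conf L D (c', r')" "cmor (c, r) (c', r') b (idn D)"
  shows "quasi_invertible \<A> \<C> (Suc m) c'"
proof -
  note cf = conf_facts[OF c(1)] and cf' = conf_facts[OF c'(1)]
  have b: "b \<in> Arr \<A>" "src b = K" "tgt b = L" using cmor_typ[OF c(1) c'] by auto
  have "psh c' \<in> iso (EXT (Suc (Suc m)) X L) (EXT (Suc (Suc m)) X (tgt c'))" if X: "X \<in> \<C>" for X
  proof -
    let ?G = "EXT (Suc (Suc m)) X"
    have h: "psh c' \<in> hom (?G L) (?G (tgt c'))" by (rule push_hom) (use cf' in auto)
    interpret GL: comm_group "?G L" by (rule Ext_comm_group) (use X cf' in auto)
    interpret GQ: comm_group "?G (tgt c')" by (rule Ext_comm_group) (use X cf' in auto)
    interpret group_hom "?G L" "?G (tgt c')" "psh c'" by unfold_locales (rule h)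
    have bij: "inj_on (psh c) (EE (Suc (Suc m)) X K)"
      using c(2) X cf by (auto simp: quasi_invertible_def iso_def bij_betw_def)
    have z: "x = zero_class (Suc m) X L" if x: "x \<in> EE (Suc (Suc m)) X L" "psh c' x = zero_class (Suc m) X (tgt c')" for x
    proof -
      obtain F where F: "F \<in> Ch (Suc m) D X" "x = cls ((c', r') # F)"
        using exact_left[OF c'(1) refl x] by blast
      let ?y = "cls ((c, r) # F)"
      have y: "?y \<in> EE (Suc (Suc m)) X K" using c F by (intro Ext_classI) (auto simp: Ch_Suc)
      have ezK: "zero_class (Suc m) X K \<in> EE (Suc (Suc m)) X K" using zero_class_closed X cf by simp
      have "psh c ?y = psh c (zero_class (Suc m) X K)"
        using push_own_inflation[OF c(1) refl F(1)] push_one[of c K "tgt c" X "Suc m"] cf X by simp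
      then have "?y = zero_class (Suc m) X K" by (rule inj_onD[OF bij _ y ezK])
      moreover have "psh b ?y = x" using push_Cons[OF c(1) c' F(1)] F by simp
      ultimately show ?thesis using push_one[of b K L X "Suc m"] b cf cf' X by simp
    qed
    have "inj_on (psh c') (EE (Suc (Suc m)) X L)"
      using z X cf' by (simp add: inj_on_one_iff Ext_simps)
    \<comment> \<open>Surjectivity: the obstruction to lifting along \<open>c'\<close> lies in
      \<open>Ext\<close> into the \<open>n\<close>-injective cokernel \<open>D\<close>.\<close>
    moreover have "y \<in> psh c' ` EE (Suc (Suc m)) X L" if y: "y \<in> EE (Suc (Suc m)) X (tgt c')" for y
    proof -
      have "psh r' y \<in> EE (Suc (Suc m)) X D" using push_closed[OF y, of r' D] cf' by simp
      then have "psh r' y = zero_class (Suc m) X D" by (rule n_injective_zero[OF D, rotated]) simp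
      then show ?thesis using exact_middle[OF c'(1) refl y] by blast
    qed
    then have "psh c' ` EE (Suc (Suc m)) X L = EE (Suc (Suc m)) X (tgt c')" by auto
    ultimately show ?thesis using h by (simp add: iso_def bij_betw_def)
  qed
  then show ?thesis using cf' by (simp add: quasi_invertible_def)
qed

section \<open>Angled pairs\<close>

lemma angled_pair_sym: "angled_pair \<A> \<C> n N a \<delta> b \<delta>' \<Longrightarrow> angled_pair \<A> \<C> n N b \<delta>' a \<delta>"
  unfolding angled_pair_def by metis

text \<open>The identity is an inflation because its cokernel can be taken to be a zero object. As
  the definition asks for a unit conflation among the push-out sequences themselves, \<delta> is
  exhibited as a push-out of itself.\<close>

lemma angled_pair_refl:
  assumes \<delta>: "\<delta> \<in> UC (Suc m) N"
  shows "angled_pair \<A> \<C> (Suc m) N (idn (left_end \<A> \<delta>)) \<delta> (idn (left_end \<A> \<delta>)) \<delta>"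
proof -
  obtain x where x: "x \<in> Ch (Suc m) (left_end \<A> \<delta>) N" "\<delta> = spl x"
    using unit_conflationE[OF \<delta>] by blast
  let ?K = "left_end \<A> \<delta>" let ?id = "idn ?K"
  have K: "?K \<in> \<C>" "?K \<in> Obj \<A>" using Ch_C(1)[OF x(1)] by auto
  have inf: "inflation \<A> \<C> ?id"
    using conf_zero_right[OF K(1) zero_obj(2,1)] unfolding inflation_def conf_def by auto
  \<comment> \<open>From this arbitrary push-out the shape of \<delta> and the vanishing of
    \<open>d \<cdot> i\<close> are read off.\<close>
  obtain E where P: "is_pushout_seq \<A> ?id \<delta> E" using pushout_seq_exists[OF x(1), of ?id ?K] K x by auto
  obtain i d ds i' d' y where e: "\<delta> = i # d # ds" "trm \<delta> 1 = tgt i" "i \<in> Arr \<A>" "src i = ?K"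
    using is_pushout_seqE[OF P] K by (metis ident_Hom(2))
  have xc: "x \<noteq> []" "length x = Suc m" using x by (auto simp: Ch_def)
  have d: "d \<in> Arr \<A>" "src d = tgt i" "d \<cdot> i = nul ?K (tgt d)"
  proof -
    obtain i0 d0 ds0 i' d' z where e0: "\<delta> = i0 # d0 # ds0" "pushout_square \<A> i0 ?id z i'"
      "d' \<in> Hom \<A> (tgt i') (tgt d0)" "d' \<cdot> z = d0" "d' \<cdot> i' = nul (src i') (tgt d0)"
      using P unfolding is_pushout_seq_def by blast
    have eq: "i0 = i" "d0 = d" using e0(1) e(1) by auto
    note pf = pushout_square_facts[OF e0(2)[unfolded eq]] note d' = e0(3-5)[unfolded eq]
    show "d \<in> Arr \<A>" "src d = tgt i" using d'(1) pf unfolding d'(2)[symmetric] by simp_all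
    have "d \<cdot> i = d' \<cdot> (z \<cdot> i)" unfolding d'(2)[symmetric] using d'(1) pf by simp
    also have "\<dots> = d' \<cdot> i'" using pf K by simp
    finally show "d \<cdot> i = nul ?K (tgt d)" using d' pf K by simp
  qed
  have "pushout_square \<A> i ?id (idn (tgt i)) i"
    unfolding pushout_square_def
  proof (intro conjI exI[of _ "tgt i"] ballI impI)
    fix W u v assume u: "u \<in> Hom \<A> (tgt i) W" "v \<in> Hom \<A> (tgt ?id) W" "u \<cdot> i = v \<cdot> ?id"
    show "\<exists>!w. w \<in> Hom \<A> (tgt i) W \<and> w \<cdot> idn (tgt i) = u \<and> w \<cdot> i = v"
    proof (rule ex1I[of _ u])
      have "v \<cdot> ?id = v" using u(2) K by simp
      then show "u \<in> Hom \<A> (tgt i) W \<and> u \<cdot> idn (tgt i) = u \<and> u \<cdot> i = v"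
        using u by simp
      fix w assume w: "w \<in> Hom \<A> (tgt i) W \<and> w \<cdot> idn (tgt i) = u \<and> w \<cdot> i = v"
      then have "w \<cdot> idn (tgt i) = w" by (intro comp_ident) (simp_all del: comp_ident)
      then show "w = u" using w by metis
    qed
  qed (simp_all add: e(3,4) K)
  then have "is_pushout_seq \<A> ?id \<delta> \<delta>"
    unfolding is_pushout_seq_def e(1)
    by (intro exI[of _ i] exI[of _ d] exI[of _ ds] exI[of _ "idn (tgt i)"]) (use d e in auto)
  then show ?thesis unfolding angled_pair_def
    using \<delta> inf quasi_invertible_ident[OF K(1)] K by auto
qed

text \<open>Trades the push-out sequences for \<open>n\<close>-injectivity of the cokernels, the
  form in which both legs enter the gluing of angled pairs.\<close>

lemma angled_pairE:
  assumes "angled_pair \<A> \<C> (Suc m) N a \<delta> b \<delta>'" "n_Frobenius \<A> \<C> (Suc m)"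
  obtains D r D' r' where "conf (left_end \<A> \<delta>) D (a, r)" "n_injective \<A> \<C> (Suc m) D" "quasi_invertible \<A> \<C> (Suc m) a"
    "conf (left_end \<A> \<delta>') D' (b, r')" "n_injective \<A> \<C> (Suc m) D'" "quasi_invertible \<A> \<C> (Suc m) b"
    "tgt a = tgt b" "psh a (ext_class \<A> \<C> \<delta>) = psh b (ext_class \<A> \<C> \<delta>')"
    "\<delta> \<in> UC (Suc m) N" "\<delta>' \<in> UC (Suc m) N"
proof -
  note ap = assms(1)[unfolded angled_pair_def]
  obtain r r' where r: "conflation \<A> \<C> a r" "conflation \<A> \<C> b r'" using ap unfolding inflation_def by blast
  note c = conf_of_conflation[OF r(1)] conf_of_conflation[OF r(2)]
  obtain E E' where "E \<in> UC (Suc m) N" "is_pushout_seq \<A> a \<delta> E"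
    "E' \<in> UC (Suc m) N" "is_pushout_seq \<A> b \<delta>' E'" using ap by blast
  then have "n_injective \<A> \<C> (Suc m) (tgt r)" "n_injective \<A> \<C> (Suc m) (tgt r')"
    using unit_pushout_cokernel[OF assms(2) _ _ _ c(1)] unit_pushout_cokernel[OF assms(2) _ _ _ c(2)] ap by blast+
  moreover have "conf (left_end \<A> \<delta>) (tgt r) (a, r)" "conf (left_end \<A> \<delta>') (tgt r') (b, r')"
    using c ap by auto
  ultimately show thesis using that ap by blast
qed

lemma angled_pair_trans:
  assumes Fr: "n_Frobenius \<A> \<C> (Suc m)" and ab: "angled_pair \<A> \<C> (Suc m) N a \<delta> b \<delta>'"
    and cd: "angled_pair \<A> \<C> (Suc m) N c \<delta>' d \<delta>''"
  obtains b' c' where "angled_pair \<A> \<C> (Suc m) N (c' \<cdot> a) \<delta> (b' \<cdot> d) \<delta>''" "c' \<cdot> b = b' \<cdot> c"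
    "c' \<in> Arr \<A>" "src c' = tgt a" "b' \<in> Arr \<A>" "src b' = tgt c" "tgt c' = tgt b'" "tgt c' \<in> \<C>"
proof -
  obtain Da ra Db rb where A: "conf (left_end \<A> \<delta>) Da (a, ra)" "n_injective \<A> \<C> (Suc m) Da" "quasi_invertible \<A> \<C> (Suc m) a"
    "conf (left_end \<A> \<delta>') Db (b, rb)" "n_injective \<A> \<C> (Suc m) Db" "quasi_invertible \<A> \<C> (Suc m) b"
    "tgt a = tgt b" "psh a (ext_class \<A> \<C> \<delta>) = psh b (ext_class \<A> \<C> \<delta>')"
    "\<delta> \<in> UC (Suc m) N" "\<delta>' \<in> UC (Suc m) N"
    using angled_pairE[OF ab Fr] .
  obtain Dc rc Dd rd where B: "conf (left_end \<A> \<delta>') Dc (c, rc)" "n_injective \<A> \<C> (Suc m) Dc" "quasi_invertible \<A> \<C> (Suc m) c"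
    "conf (left_end \<A> \<delta>'') Dd (d, rd)" "n_injective \<A> \<C> (Suc m) Dd" "quasi_invertible \<A> \<C> (Suc m) d"
    "tgt c = tgt d" "psh c (ext_class \<A> \<C> \<delta>') = psh d (ext_class \<A> \<C> \<delta>'')"
    "\<delta>' \<in> UC (Suc m) N" "\<delta>'' \<in> UC (Suc m) N"
    using angled_pairE[OF cd Fr] .
  note af = conf_facts[OF A(1)] and bf = conf_facts[OF A(4)] and cf = conf_facts[OF B(1)] and df = conf_facts[OF B(4)]
  obtain b' c' where P: "pushout_square \<A> c b b' c'" using pushout_exists[of c b] bf cf by auto
  note pf = pushout_square_facts[OF P] note P' = pushout_square_sym[OF P]
  obtain r' where r': "conf (tgt b) Dc (c', r')" "r' \<cdot> b' = rc" using pushout_conf[OF B(1) P bf(9)] .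
  obtain s' where s': "conf (tgt c) Db (b', s')" "s' \<cdot> c' = rb" using pushout_conf[OF A(4) P' cf(9)] .
  note c'f = conf_facts[OF r'(1)] and b'f = conf_facts[OF s'(1)]
  have qc: "quasi_invertible \<A> \<C> (Suc m) c'"
    by (rule quasi_invertible_pushout[OF B(1,3,2) r'(1) pushout_cmor[OF B(1) P r']])
  have qb: "quasi_invertible \<A> \<C> (Suc m) b'"
    by (rule quasi_invertible_pushout[OF A(4,6,5) s'(1) pushout_cmor[OF A(4) P' s']])
  obtain De xe v w where e: "conf (left_end \<A> \<delta>) De (c' \<cdot> a, xe)" "conf Da Dc (v, w)" "tgt v = De"
    using conf_compose[OF A(1) r'(1) A(7)] by metis
  \<comment> \<open>The cokernel of the composite leg is an extension of \<open>Dc\<close> by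
    \<open>Da\<close>; its injectivity is what \<open>unit_pushout\<close> needs to keep the middle
    terms \<open>n\<close>-projective.\<close>
  have De: "n_injective \<A> \<C> (Suc m) De" using n_injective_middle[OF e(2) A(2) B(2)] e(3) by simp
  obtain Df xf v' w' where f: "conf (left_end \<A> \<delta>'') Df (b' \<cdot> d, xf)" "conf Dd Db (v', w')" "tgt v' = Df"
    using conf_compose[OF B(4) s'(1) B(7)[symmetric]] by metis
  have Df: "n_injective \<A> \<C> (Suc m) Df" using n_injective_middle[OF f(2) B(5) A(5)] f(3) by simp
  have cl: "ext_class \<A> \<C> \<delta> \<in> EE (Suc m) N (left_end \<A> \<delta>)" "ext_class \<A> \<C> \<delta>' \<in> EE (Suc m) N (left_end \<A> \<delta>')"
    "ext_class \<A> \<C> \<delta>'' \<in> EE (Suc m) N (left_end \<A> \<delta>'')"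
    using unit_conflationE[OF A(9)] unit_conflationE[OF A(10)] unit_conflationE[OF B(10)] Ext_classI unfolding cls_def by metis+
  have Q: "tgt c' = tgt b'" "tgt c' \<in> \<C>" using pf c'f by auto
  have "psh (c' \<cdot> a) (ext_class \<A> \<C> \<delta>) = psh c' (psh a (ext_class \<A> \<C> \<delta>))"
    by (rule push_push[where B' = "tgt a" and B'' = "tgt c'", OF cl(1), symmetric]) (use af c'f A(7) in simp_all)
  also have "\<dots> = psh (c' \<cdot> b) (ext_class \<A> \<C> \<delta>')"
    unfolding A(8) by (rule push_push[where B' = "tgt b" and B'' = "tgt c'", OF cl(2)]) (use bf c'f in simp_all)
  also have "\<dots> = psh b' (psh c (ext_class \<A> \<C> \<delta>'))"
    unfolding pf(9)[symmetric] by (rule push_push[where B' = "tgt c" and B'' = "tgt b'", OF cl(2), symmetric]) (use cf b'f in simp_all)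
  also have "\<dots> = psh (b' \<cdot> d) (ext_class \<A> \<C> \<delta>'')"
    unfolding B(8) by (rule push_push[where B' = "tgt d" and B'' = "tgt b'", OF cl(3)]) (use df b'f B(7) in simp_all)
  finally have eq: "psh (c' \<cdot> a) (ext_class \<A> \<C> \<delta>) = psh (b' \<cdot> d) (ext_class \<A> \<C> \<delta>'')" .
  have "inflation \<A> \<C> (c' \<cdot> a)" "inflation \<A> \<C> (b' \<cdot> d)"
    using e(1) f(1) unfolding inflation_def conf_def by auto
  moreover have "quasi_invertible \<A> \<C> (Suc m) (c' \<cdot> a)" "quasi_invertible \<A> \<C> (Suc m) (b' \<cdot> d)"
    using quasi_invertible_comp[OF A(3) qc] quasi_invertible_comp[OF B(6) qb] A(7) B(7) c'f b'f by auto
  moreover note unit_pushout[OF Fr A(9) e(1) De] unit_pushout[OF Fr B(10) f(1) Df] eq A(9) B(10)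
  moreover have "src (c' \<cdot> a) = left_end \<A> \<delta>" "src (b' \<cdot> d) = left_end \<A> \<delta>''" "tgt (c' \<cdot> a) = tgt (b' \<cdot> d)"
    using af df c'f b'f A(7) B(7) Q by simp_all
  ultimately have "angled_pair \<A> \<C> (Suc m) N (c' \<cdot> a) \<delta> (b' \<cdot> d) \<delta>''"
    unfolding angled_pair_def by blast
  then show thesis by (rule that) (use pf A(7) bf Q in simp_all)
qed

section \<open>Congruence modulo \<P>-conflations and the equivalence relation\<close>

text \<open>Membership in the carrier is built in, so that the group laws apply without separate
  side conditions.\<close>

definition P_cong :: "nat \<Rightarrow> 'o \<Rightarrow> 'o \<Rightarrow> 'a list set \<Rightarrow> 'a list set \<Rightarrow> bool" where
  "P_cong n M Y x y \<longleftrightarrow> x \<in> EE n M Y \<and> y \<in> EE n M Y \<and>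
     x \<otimes>\<^bsub>EXT n M Y\<^esub> inv\<^bsub>EXT n M Y\<^esub> y \<in> PC n M Y"

lemma P_cong_sym:
  assumes F: "n_Frobenius \<A> \<C> (Suc m)" and xy: "P_cong (Suc m) M Y x y"
  shows "P_cong (Suc m) M Y y x"
proof -
  have xy': "x \<in> EE (Suc m) M Y" "y \<in> EE (Suc m) M Y" using xy by (simp_all add: P_cong_def)
  have C: "M \<in> \<C>" "Y \<in> \<C>" using Ext_class_ends[OF xy'(1)] by auto
  interpret comm_group "EXT (Suc m) M Y" by (rule Ext_comm_group[OF C])
  interpret subgroup "PC (Suc m) M Y" "EXT (Suc m) M Y"
    by (rule P_conflations_subgroup[OF F C])
  have "inv\<^bsub>EXT (Suc m) M Y\<^esub> (x \<otimes>\<^bsub>EXT (Suc m) M Y\<^esub> inv\<^bsub>EXT (Suc m) M Y\<^esub> y) \<in> PC (Suc m) M Y"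
    using xy unfolding P_cong_def by (intro m_inv_closed) simp
  then show ?thesis using xy' unfolding P_cong_def by (simp add: inv_mult_group)
qed

lemma P_cong_trans:
  assumes F: "n_Frobenius \<A> \<C> (Suc m)" and xy: "P_cong (Suc m) M Y x y" and yz: "P_cong (Suc m) M Y y z"
  shows "P_cong (Suc m) M Y x z"
proof -
  let ?G = "EXT (Suc m) M Y"
  have c: "x \<in> carrier ?G" "y \<in> carrier ?G" "z \<in> carrier ?G" using xy yz by (simp_all add: P_cong_def)
  have C: "M \<in> \<C>" "Y \<in> \<C>" using Ext_class_ends[OF c(1)] by auto
  interpret comm_group ?G by (rule Ext_comm_group[OF C])
  interpret subgroup "PC (Suc m) M Y" ?G
    by (rule P_conflations_subgroup[OF F C])
  have "x \<otimes>\<^bsub>?G\<^esub> inv\<^bsub>?G\<^esub> y \<in> PC (Suc m) M Y" "y \<otimes>\<^bsub>?G\<^esub> inv\<^bsub>?G\<^esub> z \<in> PC (Suc m) M Y"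
    using xy yz unfolding P_cong_def by blast+
  then have "(x \<otimes>\<^bsub>?G\<^esub> inv\<^bsub>?G\<^esub> y) \<otimes>\<^bsub>?G\<^esub> (y \<otimes>\<^bsub>?G\<^esub> inv\<^bsub>?G\<^esub> z) \<in> PC (Suc m) M Y"
    by (rule subgroup.m_closed[OF subgroup_axioms])
  moreover have "(x \<otimes>\<^bsub>?G\<^esub> inv\<^bsub>?G\<^esub> y) \<otimes>\<^bsub>?G\<^esub> (y \<otimes>\<^bsub>?G\<^esub> inv\<^bsub>?G\<^esub> z) = x \<otimes>\<^bsub>?G\<^esub> inv\<^bsub>?G\<^esub> z"
    using c m_assoc[of "inv\<^bsub>?G\<^esub> y" y "inv\<^bsub>?G\<^esub> z"] by (simp add: m_assoc)
  ultimately show ?thesis using c unfolding P_cong_def by simp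
qed

lemma P_cong_push:
  assumes xy: "P_cong (Suc m) M Y x y" and g: "g \<in> Arr \<A>" "src g = Y" "tgt g = Y'" "Y' \<in> \<C>"
  shows "P_cong (Suc m) M Y' (psh g x) (psh g y)"
proof -
  let ?G = "EXT (Suc m) M Y" let ?G' = "EXT (Suc m) M Y'"
  have c: "x \<in> carrier ?G" "y \<in> carrier ?G" using xy by (simp_all add: P_cong_def)
  have C: "M \<in> \<C>" "Y \<in> \<C>" using Ext_class_ends[OF c(1)] by auto
  interpret G: comm_group ?G by (rule Ext_comm_group[OF C])
  interpret G': comm_group ?G' by (rule Ext_comm_group[OF C(1) g(4)])
  interpret group_hom ?G ?G' "psh g" by unfold_locales (rule push_hom[OF g])
  have "psh g (x \<otimes>\<^bsub>?G\<^esub> inv\<^bsub>?G\<^esub> y) = psh g x \<otimes>\<^bsub>?G'\<^esub> inv\<^bsub>?G'\<^esub> (psh g y)" using c by simp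
  moreover have "psh g (x \<otimes>\<^bsub>?G\<^esub> inv\<^bsub>?G\<^esub> y) \<in> PC (Suc m) M Y'"
    by (rule P_conflations_push[OF _ C(1) g]) (use xy in \<open>simp add: P_cong_def\<close>)
  ultimately show ?thesis using c unfolding P_cong_def by simp
qed

lemma P_cong_coset:
  assumes F: "n_Frobenius \<A> \<C> (Suc m)" and MY: "M \<in> \<C>" "Y \<in> \<C>"
    and c: "c \<in> carrier (EXT (Suc m) M Y Mod PC (Suc m) M Y)"
  shows "c \<noteq> {}" "x \<in> c \<Longrightarrow> x \<in> EE (Suc m) M Y" "\<lbrakk>x \<in> c; y \<in> c\<rbrakk> \<Longrightarrow> P_cong (Suc m) M Y x y"
proof -
  let ?G = "EXT (Suc m) M Y" let ?H = "PC (Suc m) M Y"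
  interpret comm_group ?G by (rule Ext_comm_group[OF MY])
  interpret subgroup ?H ?G by (rule P_conflations_subgroup[OF F MY])
  obtain z where z: "z \<in> carrier ?G" "c = ?H #>\<^bsub>?G\<^esub> z" using c by (auto simp: FactGroup_def RCOSETS_def)
  have ce: "\<exists>h \<in> ?H. x = h \<otimes>\<^bsub>?G\<^esub> z" if "x \<in> c" for x using that z by (auto simp: r_coset_def)
  show "c \<noteq> {}" unfolding z(2) r_coset_def using subgroup.one_closed[OF subgroup_axioms] by blast
  show cl: "x \<in> carrier ?G" if "x \<in> c" for x using ce[OF that] z by auto
  show "P_cong (Suc m) M Y x y" if x: "x \<in> c" and y: "y \<in> c"
  proof -
    obtain h where h: "h \<in> ?H" "x = h \<otimes>\<^bsub>?G\<^esub> z" using ce[OF x] by blast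
    obtain k where k: "k \<in> ?H" "y = k \<otimes>\<^bsub>?G\<^esub> z" using ce[OF y] by blast
    have hk: "h \<in> carrier ?G" "k \<in> carrier ?G" using h k by auto
    have "x \<otimes>\<^bsub>?G\<^esub> inv\<^bsub>?G\<^esub> y = h \<otimes>\<^bsub>?G\<^esub> inv\<^bsub>?G\<^esub> k"
      using hk z m_assoc[of z "inv\<^bsub>?G\<^esub> z" "inv\<^bsub>?G\<^esub> k"] unfolding h k by (simp add: inv_mult_group m_assoc)
    then show ?thesis using h k cl[OF x] cl[OF y] unfolding P_cong_def by (simp add: m_closed m_inv_closed)
  qed
qed

lemma equiv_unit_pair_rel:
  assumes Fr: "n_Frobenius \<A> \<C> (Suc m)" and M: "M \<in> \<C>"
  shows "equiv (unit_pairs \<A> \<C> (Suc m) M N) (unit_pair_rel \<A> \<C> (Suc m) M N)"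
proof -
  let ?U = "UC (Suc m) N" let ?R = "unit_pair_rel \<A> \<C> (Suc m) M N"
  let ?S = "unit_pairs \<A> \<C> (Suc m) M N"
  have K: "left_end \<A> \<delta> \<in> \<C>" if "\<delta> \<in> ?U" for \<delta> using unit_conflationE[OF that] Ch_C(1) by metis
  have S: "\<delta> \<in> ?U" "c \<in> carrier (EXT (Suc m) M (left_end \<A> \<delta>) Mod PC (Suc m) M (left_end \<A> \<delta>))"
    if "(c, \<delta>) \<in> ?S" for c \<delta> using that unfolding unit_pairs_def by auto
  note coset = P_cong_coset[OF Fr M K[OF S(1)] S(2)]
  have arr: "a \<in> Arr \<A>" "src a = left_end \<A> \<delta>" "b \<in> Arr \<A>" "src b = left_end \<A> \<delta>'" "tgt a = tgt b"
      "tgt b \<in> \<C>" if "angled_pair \<A> \<C> (Suc m) N a \<delta> b \<delta>'" for a b \<delta> \<delta>'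
    using that unfolding angled_pair_def quasi_invertible_def by auto
  \<comment> \<open>Push-outs of coset representatives lie in the carrier, so the relation can be
    expressed by \<open>P_cong\<close>.\<close>
  have R: "((c, \<delta>), (c', \<delta>')) \<in> ?R \<longleftrightarrow> (c, \<delta>) \<in> ?S \<and> (c', \<delta>') \<in> ?S \<and> (\<exists>\<gamma> \<in> c. \<exists>\<gamma>' \<in> c'. \<exists>a b.
      angled_pair \<A> \<C> (Suc m) N a \<delta> b \<delta>' \<and> P_cong (Suc m) M (tgt a) (psh a \<gamma>) (psh b \<gamma>'))"
    for c \<delta> c' \<delta>'
  proof -
    have "psh a \<gamma> \<in> EE (Suc m) M (tgt a) \<and> psh b \<gamma>' \<in> EE (Suc m) M (tgt a)"
      if s: "(c, \<delta>) \<in> ?S" "(c', \<delta>') \<in> ?S" "\<gamma> \<in> c" "\<gamma>' \<in> c'" and ap: "angled_pair \<A> \<C> (Suc m) N a \<delta> b \<delta>'" for \<gamma> \<gamma>' a b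
      using push_closed[OF coset(2)[OF s(1,1,3)], of a "tgt a"] push_closed[OF coset(2)[OF s(2,2,4)], of b "tgt a"] arr[OF ap]
      by simp
    then show ?thesis unfolding unit_pair_rel_def P_cong_def by blast
  qed
  show ?thesis
  proof (rule equivI)
    show "?R \<subseteq> ?S \<times> ?S" unfolding unit_pair_rel_def by auto
    show "refl_on ?S ?R"
    proof (rule refl_onI)
      fix z assume z: "z \<in> ?S"
      obtain c \<delta> where cd: "z = (c, \<delta>)" by (cases z)
      note s = z[unfolded cd]
      obtain \<gamma> where g: "\<gamma> \<in> c" using coset(1)[OF s s] by blast
      let ?id = "idn (left_end \<A> \<delta>)"
      have ap: "angled_pair \<A> \<C> (Suc m) N ?id \<delta> ?id \<delta>" by (rule angled_pair_refl[OF S(1)[OF s]])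
      have "P_cong (Suc m) M (tgt ?id) (psh ?id \<gamma>) (psh ?id \<gamma>)"
        using P_cong_push[OF coset(3)[OF s s g g], of ?id "tgt ?id"] arr[OF ap] by simp
      then show "(z, z) \<in> ?R" unfolding cd R using s g ap by blast
    qed
    show "sym ?R"
    proof (rule symI)
      fix z z' assume zz: "(z, z') \<in> ?R"
      obtain c \<delta> c' \<delta>' where cd: "z = (c, \<delta>)" "z' = (c', \<delta>')" by (cases z, cases z')
      obtain \<gamma> \<gamma>' a b where r: "(c, \<delta>) \<in> ?S" "(c', \<delta>') \<in> ?S" "\<gamma> \<in> c" "\<gamma>' \<in> c'" "angled_pair \<A> \<C> (Suc m) N a \<delta> b \<delta>'"
        "P_cong (Suc m) M (tgt a) (psh a \<gamma>) (psh b \<gamma>')" using zz unfolding cd R by blast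
      have "P_cong (Suc m) M (tgt b) (psh b \<gamma>') (psh a \<gamma>)"
        using P_cong_sym[OF Fr r(6)] arr[OF r(5)] by simp
      then show "(z', z) \<in> ?R" unfolding cd R using r angled_pair_sym[OF r(5)] by blast
    qed
    show "trans ?R"
    proof (rule transI)
      fix z z' z'' assume zz: "(z, z') \<in> ?R" "(z', z'') \<in> ?R"
      obtain c \<delta> c' \<delta>' c'' \<delta>'' where cd: "z = (c, \<delta>)" "z' = (c', \<delta>')" "z'' = (c'', \<delta>'')" by (cases z, cases z', cases z'')
      obtain \<gamma>1 \<gamma>2 a b where r: "(c, \<delta>) \<in> ?S" "(c', \<delta>') \<in> ?S" "\<gamma>1 \<in> c" "\<gamma>2 \<in> c'" "angled_pair \<A> \<C> (Suc m) N a \<delta> b \<delta>'"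
        "P_cong (Suc m) M (tgt a) (psh a \<gamma>1) (psh b \<gamma>2)" using zz(1) unfolding cd R by blast
      obtain \<gamma>2' \<gamma>3 f d where s: "(c'', \<delta>'') \<in> ?S" "\<gamma>2' \<in> c'" "\<gamma>3 \<in> c''" "angled_pair \<A> \<C> (Suc m) N f \<delta>' d \<delta>''"
        "P_cong (Suc m) M (tgt f) (psh f \<gamma>2') (psh d \<gamma>3)" using zz(2) unfolding cd R by blast
      \<comment> \<open>\<open>f\<close> and \<open>f'\<close> are the arrows written
        \<open>c\<close> and \<open>c'\<close> in the overview, since \<open>c\<close> denotes a
        coset here.\<close>
      obtain b' f' where t: "angled_pair \<A> \<C> (Suc m) N (f' \<cdot> a) \<delta> (b' \<cdot> d) \<delta>''" "f' \<cdot> b = b' \<cdot> f"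
        "f' \<in> Arr \<A>" "src f' = tgt a" "b' \<in> Arr \<A>" "src b' = tgt f" "tgt f' = tgt b'" "tgt f' \<in> \<C>"
        using angled_pair_trans[OF Fr r(5) s(4)] .
      note ra = arr[OF r(5)] and sa = arr[OF s(4)]
      let ?Q = "tgt f'"
      have g: "\<gamma>1 \<in> EE (Suc m) M (left_end \<A> \<delta>)" "\<gamma>2 \<in> EE (Suc m) M (left_end \<A> \<delta>')"
        "\<gamma>2' \<in> EE (Suc m) M (left_end \<A> \<delta>')" "\<gamma>3 \<in> EE (Suc m) M (left_end \<A> \<delta>'')"
        using coset(2) r s by blast+
      have p: "psh f' (psh a \<gamma>1) = psh (f' \<cdot> a) \<gamma>1" "psh f' (psh b \<gamma>2) = psh (f' \<cdot> b) \<gamma>2"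
        "psh b' (psh f \<gamma>2') = psh (b' \<cdot> f) \<gamma>2'" "psh b' (psh d \<gamma>3) = psh (b' \<cdot> d) \<gamma>3"
        using push_push[OF g(1) ra(1,2) refl] push_push[OF g(2) ra(3,4) refl] push_push[OF g(3) sa(1,2) refl]
          push_push[OF g(4) sa(3,4) refl] ra sa t by simp_all
      have "P_cong (Suc m) M ?Q (psh (f' \<cdot> a) \<gamma>1) (psh (f' \<cdot> b) \<gamma>2)"
        using P_cong_push[OF r(6) t(3,4) refl t(8)] p by simp
      \<comment> \<open>The two hypotheses may use different representatives of the middle coset;
        their difference is a \<P>-conflation and remains one after push-out.\<close>
      moreover have "P_cong (Suc m) M ?Q (psh (f' \<cdot> b) \<gamma>2) (psh (f' \<cdot> b) \<gamma>2')"
        by (rule P_cong_push[OF coset(3)[OF r(2,2,4) s(2)]]) (simp_all add: ra t(3-6,8))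
      moreover have "P_cong (Suc m) M ?Q (psh (f' \<cdot> b) \<gamma>2') (psh (b' \<cdot> d) \<gamma>3)"
        using P_cong_push[OF s(5) t(5,6) t(7)[symmetric] t(8)] p t by simp
      ultimately have "P_cong (Suc m) M ?Q (psh (f' \<cdot> a) \<gamma>1) (psh (b' \<cdot> d) \<gamma>3)"
        using P_cong_trans[OF Fr] by blast
      moreover have "tgt (f' \<cdot> a) = ?Q" using ra t by simp
      ultimately show "(z, z'') \<in> ?R" unfolding cd R using r s t by metis
    qed
  qed
qed

end

theorem theorem8p2:
  fixes \<A> :: "('o, 'a) precategory" and \<C> :: "'o set" and n :: nat and M N :: 'o
  assumes "extension_closed_subcategory \<A> \<C>"
    and "n \<ge> 1"
    and "n_Frobenius \<A> \<C> n"
    and "M \<in> \<C>" and "N \<in> \<C>"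
  shows "equiv (unit_pairs \<A> \<C> n M N) (unit_pair_rel \<A> \<C> n M N)"
proof -
  interpret ext_cat \<A> \<C> using assms(1) by (rule ext_cat.intro)
  \<comment> \<open>The lemmas on \<open>Ext\<close> are stated in degrees of the form
    \<open>Suc t\<close>, hence the passage to the predecessor of \<open>n\<close>.\<close>
  obtain m where n: "n = Suc m" using assms(2) by (cases n) auto
  show ?thesis unfolding n by (rule equiv_unit_pair_rel) (use assms n in auto)
qed

end
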